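(* \textsc{Diameter} can be solved in $O(k\cdot n)$ time on graphs with $n$ vertices and feedback edge number $k$.
   Context: \textsc{Diameter}: given an undirected, connected, unweighted graph $G=(V,E)$ with $n=|V|$, compute the length of a longest shortest path in $G$. The feedback edge number of $G$ is the minimum number of edges whose deletion makes $G$ acyclic (a tree, for connected $G$).
   Formalization: The time bound is proved as O((k+1)·n), since for trees (k = 0) a bound of O(k·n) would literally allow zero steps; for k ≥ 1 it is the stated O(k·n). Time is counted on a unit-cost word RAM with words of O(log n) bits, for n ≥ 1. *)

theory Defs
  imports Main
begin

text \<open>A simple undirected graph on vertex set {0..<n} is given by a list of edges es;
each edge (u,v) stands for the unordered pair {u,v}.\<close>

definition simple_graph :: "nat \<Rightarrow> (nat \<times> nat) list \<Rightarrow> bool" where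
  "simple_graph n es \<longleftrightarrow>
     (\<forall>(u,v) \<in> set es. u < n \<and> v < n \<and> u \<noteq> v) \<and>
     distinct (map (\<lambda>(u,v). {u,v}) es)"

definition adjE :: "(nat \<times> nat) set \<Rightarrow> nat \<Rightarrow> nat \<Rightarrow> bool" where
  "adjE E u v \<longleftrightarrow> (u,v) \<in> E \<or> (v,u) \<in> E"

definition walk :: "(nat \<times> nat) set \<Rightarrow> nat list \<Rightarrow> bool" where
  "walk E xs \<longleftrightarrow> xs \<noteq> [] \<and> (\<forall>i. Suc i < length xs \<longrightarrow> adjE E (xs ! i) (xs ! Suc i))"

definition connected_graph :: "nat \<Rightarrow> (nat \<times> nat) list \<Rightarrow> bool" where
  "connected_graph n es \<longleftrightarrow>
     (\<forall>u < n. \<forall>v < n. \<exists>xs. walk (set es) xs \<and> hd xs = u \<and> last xs = v)"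

definition dist :: "(nat \<times> nat) set \<Rightarrow> nat \<Rightarrow> nat \<Rightarrow> nat" where
  "dist E u v = (LEAST l. \<exists>xs. walk E xs \<and> hd xs = u \<and> last xs = v \<and> length xs = Suc l)"

definition diameter :: "nat \<Rightarrow> (nat \<times> nat) list \<Rightarrow> nat" where
  "diameter n es = Max {dist (set es) u v | u v. u < n \<and> v < n}"

definition has_cycle :: "(nat \<times> nat) set \<Rightarrow> bool" where
  "has_cycle E \<longleftrightarrow> (\<exists>xs. 3 \<le> length xs \<and> distinct xs \<and> walk E xs \<and> adjE E (last xs) (hd xs))"

definition acyclic_graph :: "(nat \<times> nat) set \<Rightarrow> bool" where
  "acyclic_graph E \<longleftrightarrow> \<not> has_cycle E"

definition feedback_edge_number :: "(nat \<times> nat) list \<Rightarrow> nat" where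
  "feedback_edge_number es =
     (LEAST k. \<exists>F. F \<subseteq> set es \<and> card F = k \<and> acyclic_graph (set es - F))"

text \<open>Memory-to-memory RAM with addition, truncated subtraction, indirect addressing
and a conditional jump. All operands are memory addresses.\<close>
datatype instr =
    Const nat nat
  | Add nat nat nat
  | Sub nat nat nat
  | Load nat nat
  | Store nat nat
  | Jz nat nat

type_synonym config = "nat \<times> (nat \<Rightarrow> nat)"

definition halted :: "instr list \<Rightarrow> config \<Rightarrow> bool" where
  "halted prog cf \<longleftrightarrow> length prog \<le> fst cf"

fun exec_instr :: "instr \<Rightarrow> config \<Rightarrow> config" where
  "exec_instr (Const a c) (pc, m) = (Suc pc, m(a := c))"
| "exec_instr (Add a b c) (pc, m) = (Suc pc, m(a := m b + m c))"
| "exec_instr (Sub a b c) (pc, m) = (Suc pc, m(a := m b - m c))"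
| "exec_instr (Load a b) (pc, m) = (Suc pc, m(a := m (m b)))"
| "exec_instr (Store a b) (pc, m) = (Suc pc, m(m a := m b))"
| "exec_instr (Jz a t) (pc, m) = ((if m a = 0 then t else Suc pc), m)"

definition step :: "instr list \<Rightarrow> config \<Rightarrow> config" where
  "step prog cf = (if halted prog cf then cf else exec_instr (prog ! fst cf) cf)"

definition run :: "instr list \<Rightarrow> nat \<Rightarrow> config \<Rightarrow> config" where
  "run prog t cf = (step prog ^^ t) cf"

text \<open>Input encoding: mem[0] = n, mem[1] = number of edges, edge i occupies
mem[2+2i], mem[3+2i]; all other cells are 0. Program counter starts at 0.\<close>
definition input_mem :: "nat \<Rightarrow> (nat \<times> nat) list \<Rightarrow> nat \<Rightarrow> nat" where
  "input_mem n es a =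
     (if a = 0 then n
      else if a = 1 then length es
      else if 2 \<le> a \<and> a < 2 + 2 * length es then
        (if even a then fst (es ! ((a - 2) div 2)) else snd (es ! ((a - 2) div 2)))
      else 0)"

definition init_config :: "nat \<Rightarrow> (nat \<times> nat) list \<Rightarrow> config" where
  "init_config n es = (0, input_mem n es)"

end

theory Submission
  imports Defs
begin

text \<open>Leaves are pruned one by one while every vertex remembers the height of the trees pruned at it. With
  feedback edge number \<open>k\<close> the remaining core \<open>H\<close> has degree excess \<open>\<Sum>v\<in>H. (deg v - 2) \<le> 2 * k - 2\<close>, so all
  but \<open>O(k)\<close> vertices lie on \<open>O(k)\<close> chains of vertices of degree two. A breadth-first search from every
  vertex of degree at least three takes care of all pairs that involve such a vertex. Each chain is cut in
  two halves. Within a half the shortest paths run along the chain, and a shortest path from a vertex \<open>u\<close>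
  outside a half enters it through one of its two ends. Which end is used depends on a threshold position
  that is determined by the distances of \<open>u\<close> to the two ends; so after one search from either end, prefix
  and suffix maxima along the half give the farthest vertex of the half from each \<open>u\<close> in constant time.
  There are at most \<open>min n (6 * k)\<close> chains with an inner vertex, each costs \<open>O(n + k)\<close>, which sums up to
  \<open>O(k * n)\<close>.\<close>

text \<open>The statement concerns a concrete machine without multiplication, division or free
  registers, whose cells must stay polynomially bounded. The algorithm is therefore written in a
  small array language with a timed semantics and compiled; a unit of its time costs a constant
  number of machine steps. Only sums, truncated differences and maxima are available, which shapes
  the tests, the doubled thresholds and the way a vertex of degree two is passed. Chains are cut
  because two vertices of one chain may be closer around its ends than along it. In a half the way
  around is never shorter, so one sweep that adds 1 per position sees all pairs inside the half.
  Distances always refer to the input graph; the core is kept isometric, so that shortest paths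
  between core vertices can be followed inside it. The number \<open>k\<close> may exceed
  \<open>n\<close>, and a round costs O(n + k). The bound \<open>6 * k\<close> on the number of
  rounds pays for the summand \<open>n\<close>, the bound \<open>n\<close> for the summand
  \<open>k\<close>. For a tree \<open>k\<close> is 0 while pruning takes linear time, hence the
  factor \<open>k + 1\<close>.\<close>

type_synonym mem = "nat \<Rightarrow> nat"

text \<open>The machine model bounds every cell at every moment, so the bound on all intermediate
  configurations is part of the relation and composes together with the running time.\<close>

definition reaches :: "instr list \<Rightarrow> nat \<Rightarrow> config \<Rightarrow> nat \<Rightarrow> config \<Rightarrow> bool" where
  "reaches prog B cf t cf' \<longleftrightarrow>
     run prog t cf = cf' \<and> (\<forall>s\<le>t. \<forall>a. snd (run prog s cf) a \<le> B)"

lemma run_add: "run prog (t1 + t2) cf = run prog t2 (run prog t1 cf)"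
  unfolding run_def by (subst add.commute) (simp add: funpow_add)

lemma reaches_trans:
  assumes "reaches prog B c0 t1 c1" "reaches prog B c1 t2 c2"
  shows "reaches prog B c0 (t1 + t2) c2"
  unfolding reaches_def
proof (intro conjI allI impI)
  show "run prog (t1 + t2) c0 = c2"
    using assms by (simp add: run_add reaches_def)
next
  fix s a assume s: "s \<le> t1 + t2"
  show "snd (run prog s c0) a \<le> B"
  proof (cases "s \<le> t1")
    case True then show ?thesis using assms(1) by (simp add: reaches_def)
  next
    case False
    then have "s = t1 + (s - t1)" "s - t1 \<le> t2" using s by auto
    then have "run prog s c0 = run prog (s - t1) c1"
      using assms(1) run_add[of prog t1 "s - t1" c0] by (simp add: reaches_def)
    then show ?thesis using assms(2) \<open>s - t1 \<le> t2\<close> by (simp add: reaches_def)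
  qed
qed

lemma reaches_refl: "(\<And>a. m a \<le> B) \<Longrightarrow> reaches prog B (p, m) 0 (p, m)"
  by (simp add: reaches_def run_def)

lemma reaches_step:
  assumes "p < length prog" "exec_instr (prog ! p) (p, m) = (p', m')"
    "\<And>a. m a \<le> B" "\<And>a. m' a \<le> B"
  shows "reaches prog B (p, m) 1 (p', m')"
proof -
  have 1: "run prog 1 (p, m) = (p', m')"
    using assms(1,2) by (simp add: run_def step_def halted_def)
  moreover have "snd (run prog s (p, m)) a \<le> B" if "s \<le> 1" for s a
  proof (cases "s = 0")
    case True then show ?thesis using assms(3) by (simp add: run_def)
  next
    case False
    then have "s = 1" using that by simp
    then show ?thesis using 1 assms(4) by simp
  qed
  ultimately show ?thesis by (simp add: reaches_def)
qed

section \<open>Structured RAM programs\<close>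

text \<open>\<open>RIf\<close> tests a cell that is already computed, whereas \<open>RWhile\<close>
  carries the straight-line code that recomputes its guard cell before each test.\<close>

datatype rcom =
    Block "instr list"
  | RSeq rcom rcom
  | RIf nat rcom rcom
  | RWhile "instr list" nat rcom

fun ex1 :: "instr \<Rightarrow> mem \<Rightarrow> mem" where
  "ex1 (Const a c) m = m(a := c)"
| "ex1 (Add a b c) m = m(a := m b + m c)"
| "ex1 (Sub a b c) m = m(a := m b - m c)"
| "ex1 (Load a b) m = m(a := m (m b))"
| "ex1 (Store a b) m = m(m a := m b)"
| "ex1 (Jz a t) m = m"

text \<open>Only \<open>Const\<close> and \<open>Add\<close> can create a value larger than all
  present ones: \<open>Sub\<close> truncates, \<open>Load\<close> and \<open>Store\<close> copy.
  \<open>Jz\<close> never fits, which forces blocks to be straight-line code.\<close>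

fun fits :: "nat \<Rightarrow> instr \<Rightarrow> mem \<Rightarrow> bool" where
  "fits B (Const a c) m = (c \<le> B)"
| "fits B (Add a b c) m = (m b + m c \<le> B)"
| "fits B (Jz a t) m = False"
| "fits B _ m = True"

fun exs :: "instr list \<Rightarrow> mem \<Rightarrow> mem" where
  "exs [] m = m"
| "exs (i # is) m = exs is (ex1 i m)"

fun fitss :: "nat \<Rightarrow> instr list \<Rightarrow> mem \<Rightarrow> bool" where
  "fitss B [] m = True"
| "fitss B (i # is) m = (fits B i m \<and> fitss B is (ex1 i m))"

lemma exs_append: "exs (xs @ ys) m = exs ys (exs xs m)"
  by (induction xs arbitrary: m) auto

lemma fitss_append: "fitss B (xs @ ys) m = (fitss B xs m \<and> fitss B ys (exs xs m))"
  by (induction xs arbitrary: m) auto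

lemma ex1_bounded: "(\<And>a. m a \<le> B) \<Longrightarrow> fits B i m \<Longrightarrow> ex1 i m a \<le> B"
  by (cases i) (auto intro: le_trans[OF diff_le_self])

lemma exs_bounded: "(\<And>a. m a \<le> B) \<Longrightarrow> fitss B is m \<Longrightarrow> exs is m a \<le> B"
  by (induction "is" arbitrary: m) (auto intro: ex1_bounded)

text \<open>Cell 0 is cleared before every backward or skipping jump, which turns the conditional
  jump into an unconditional one.\<close>

inductive rbig :: "nat \<Rightarrow> rcom \<Rightarrow> mem \<Rightarrow> nat \<Rightarrow> mem \<Rightarrow> bool" for B where
  Block: "fitss B is m \<Longrightarrow> rbig B (Block is) m (length is) (exs is m)"
| RSeq: "rbig B c1 m t1 m1 \<Longrightarrow> rbig B c2 m1 t2 m2 \<Longrightarrow> rbig B (RSeq c1 c2) m (t1 + t2) m2"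
| RIfT: "m x \<noteq> 0 \<Longrightarrow> rbig B c1 m t m1 \<Longrightarrow> rbig B (RIf x c1 c2) m (t + 3) (m1(0 := 0))"
| RIfF: "m x = 0 \<Longrightarrow> rbig B c2 m t m1 \<Longrightarrow> rbig B (RIf x c1 c2) m (t + 1) m1"
| RWhileF: "fitss B is m \<Longrightarrow> exs is m x = 0 \<Longrightarrow>
    rbig B (RWhile is x c) m (length is + 1) (exs is m)"
| RWhileT: "fitss B is m \<Longrightarrow> exs is m x \<noteq> 0 \<Longrightarrow> rbig B c (exs is m) t1 m1 \<Longrightarrow>
    rbig B (RWhile is x c) (m1(0 := 0)) t2 m2 \<Longrightarrow>
    rbig B (RWhile is x c) m (length is + t1 + t2 + 3) m2"

fun clen :: "rcom \<Rightarrow> nat" where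
  "clen (Block is) = length is"
| "clen (RSeq a b) = clen a + clen b"
| "clen (RIf x a b) = clen a + clen b + 3"
| "clen (RWhile is x c) = length is + clen c + 3"

text \<open>Jump targets are absolute, hence the start address \<open>p\<close>. The three
  additional instructions of \<open>RIf\<close> and \<open>RWhile\<close> are the test and the pair
  that acts as an unconditional jump.\<close>

fun code :: "nat \<Rightarrow> rcom \<Rightarrow> instr list" where
  "code p (Block is) = is"
| "code p (RSeq a b) = code p a @ code (p + clen a) b"
| "code p (RIf x a b) =
    [Jz x (p + clen a + 3)] @ code (p + 1) a @ [Const 0 0, Jz 0 (p + clen a + clen b + 3)]
      @ code (p + clen a + 3) b"
| "code p (RWhile is x c) =
    is @ [Jz x (p + length is + clen c + 3)] @ code (p + length is + 1) c @ [Const 0 0, Jz 0 p]"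

lemma length_code [simp]: "length (code p c) = clen c"
  by (induction c arbitrary: p) auto

lemma rbig_bounded: "rbig B c m t m' \<Longrightarrow> (\<And>a. m a \<le> B) \<Longrightarrow> m' a \<le> B"
proof (induction arbitrary: a rule: rbig.induct)
  case (RWhileT "is" m x c t1 m1 t2 m2)
  have "exs is m b \<le> B" for b using RWhileT exs_bounded by blast
  then have "m1 b \<le> B" for b using RWhileT by blast
  then have "(m1(0 := 0)) b \<le> B" for b by simp
  then show ?case using RWhileT by blast
qed (auto intro: exs_bounded)

section \<open>Execution of compiled commands on the machine\<close>

lemma reaches_block:
  assumes "\<And>a. m a \<le> B" "fitss B is m"
  shows "reaches (pre @ is @ post) B (length pre, m) (length is) (length pre + length is, exs is m)"
  using assms
proof (induction "is" arbitrary: m pre)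
  case Nil then show ?case by (simp add: reaches_refl)
next
  case (Cons i "is")
  have b: "\<And>a. ex1 i m a \<le> B" using Cons.prems by (auto intro: ex1_bounded)
  have "exec_instr i (length pre, m) = (Suc (length pre), ex1 i m)"
    using Cons.prems(2) by (cases i) auto
  then have 1: "reaches (pre @ (i # is) @ post) B (length pre, m) 1 (Suc (length pre), ex1 i m)"
    using b Cons.prems(1) by (intro reaches_step) auto
  have 2: "reaches ((pre @ [i]) @ is @ post) B (length (pre @ [i]), ex1 i m) (length is)
      (length (pre @ [i]) + length is, exs is (ex1 i m))"
    using Cons.prems b by (intro Cons.IH) auto
  show ?case using reaches_trans[OF 1] 2 by simp
qed

lemma reaches_Jz:
  assumes "prog = pre @ Jz x q # post" "\<And>a. m a \<le> B"
  shows "reaches prog B (length pre, m) 1 (if m x = 0 then q else Suc (length pre), m)"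
  using assms by (intro reaches_step) auto

lemma reaches_goto:
  assumes "prog = pre @ Const 0 0 # Jz 0 q # post" "\<And>a. m a \<le> B"
  shows "reaches prog B (length pre, m) 2 (q, m(0 := 0))"
proof -
  have "reaches prog B (length pre, m) 1 (Suc (length pre), m(0 := 0))"
    using assms by (intro reaches_step) auto
  moreover have "reaches prog B (length (pre @ [Const 0 0]), m(0 := 0)) 1
     (if (m(0 := 0)) 0 = 0 then q else Suc (length (pre @ [Const 0 0])), m(0 := 0))"
    using assms by (intro reaches_Jz) auto
  ultimately have "reaches prog B (length pre, m) (1 + 1) (q, m(0 := 0))"
    by (intro reaches_trans) auto
  then show ?thesis by (simp add: numeral_2_eq_2)
qed

text \<open>The code stands between arbitrary \<open>pre\<close> and \<open>post\<close>, so that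
  the induction hypotheses apply to a subcommand at its final address in the whole program.\<close>

theorem code_correct:
  assumes "rbig B c m t m'" "\<And>a. m a \<le> B" "prog = pre @ code (length pre) c @ post"
  shows "reaches prog B (length pre, m) t (length pre + clen c, m')"
  using assms
proof (induction arbitrary: pre post rule: rbig.induct)
  case (Block "is" m)
  then show ?case using reaches_block by simp
next
  case (RSeq c1 m t1 m1 c2 t2 m2)
  have 1: "reaches prog B (length pre, m) t1 (length pre + clen c1, m1)"
    using RSeq.prems by (intro RSeq.IH(1)[of _ "code (length pre + clen c1) c2 @ post"]) auto
  have "\<And>a. m1 a \<le> B" using RSeq rbig_bounded by blast
  then have 2: "reaches prog B (length (pre @ code (length pre) c1), m1) t2
      (length (pre @ code (length pre) c1) + clen c2, m2)"
    using RSeq.prems by (intro RSeq.IH(2)[of _ post]) auto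
  show ?case using reaches_trans[OF 1] 2 by (simp add: add.assoc)
next
  case (RIfT m x c1 t m1 c2)
  have 1: "reaches prog B (length pre, m) 1 (Suc (length pre), m)"
    using reaches_Jz[of prog pre x "length pre + clen c1 + 3" _ m B] RIfT by simp
  have 2: "reaches prog B (length (pre @ [Jz x (length pre + clen c1 + 3)]), m) t
     (length (pre @ [Jz x (length pre + clen c1 + 3)]) + clen c1, m1)"
    using RIfT.prems by (intro RIfT.IH) auto
  have b: "\<And>a. m1 a \<le> B" using RIfT rbig_bounded by blast
  have "reaches prog B (length (pre @ [Jz x (length pre + clen c1 + 3)] @ code (Suc (length pre)) c1), m1)
     2 (length pre + clen c1 + clen c2 + 3, m1(0 := 0))"
    using RIfT.prems b by (intro reaches_goto) auto
  then have 3: "reaches prog B (Suc (length pre + clen c1), m1) 2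
     (length pre + clen c1 + clen c2 + 3, m1(0 := 0))" by simp
  have "reaches prog B (length pre, m) (1 + (t + 2)) (length pre + clen c1 + clen c2 + 3, m1(0 := 0))"
    using 2 by (intro reaches_trans[OF 1 reaches_trans[OF _ 3]]) simp
  moreover have "1 + (t + 2) = t + 3"
    "length pre + clen c1 + clen c2 + 3 = length pre + clen (RIf x c1 c2)" by auto
  ultimately show ?case by metis
next
  case (RIfF m x c2 t m1 c1)
  have 1: "reaches prog B (length pre, m) 1 (length pre + clen c1 + 3, m)"
    using reaches_Jz[of prog pre x "length pre + clen c1 + 3" _ m B] RIfF by simp
  let ?pre = "pre @ [Jz x (length pre + clen c1 + 3)] @ code (Suc (length pre)) c1 @
    [Const 0 0, Jz 0 (length pre + clen c1 + clen c2 + 3)]"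
  have l: "length ?pre = length pre + clen c1 + 3" by simp
  have 2: "reaches prog B (length ?pre, m) t (length ?pre + clen c2, m1)"
    using RIfF.prems by (intro RIfF.IH[of _ post]) (auto simp: eval_nat_numeral)
  show ?case using reaches_trans[OF 1] 2 unfolding l by (simp add: add_ac)
next
  case (RWhileF "is" m x c)
  have 1: "reaches prog B (length pre, m) (length is) (length pre + length is, exs is m)"
    using RWhileF reaches_block[of m B "is" pre] by simp
  have "reaches prog B (length (pre @ is), exs is m) 1
     (if exs is m x = 0 then length pre + length is + clen c + 3 else Suc (length (pre @ is)), exs is m)"
    using RWhileF exs_bounded by (intro reaches_Jz) auto
  then have 2: "reaches prog B (length pre + length is, exs is m) 1
     (length pre + clen (RWhile is x c), exs is m)"
    using RWhileF.hyps by (simp add: add_ac)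
  show ?case using reaches_trans[OF 1 2] by simp
next
  case (RWhileT "is" m x c t1 m1 t2 m2)
  let ?q = "length pre + length is + clen c + 3"
  have b: "\<And>a. exs is m a \<le> B" using RWhileT exs_bounded by blast
  have b1: "\<And>a. m1 a \<le> B" using RWhileT b rbig_bounded by blast
  have 1: "reaches prog B (length pre, m) (length is) (length pre + length is, exs is m)"
    using RWhileT reaches_block[of m B "is" pre] by simp
  have "reaches prog B (length (pre @ is), exs is m) 1
     (if exs is m x = 0 then ?q else Suc (length (pre @ is)), exs is m)"
    using RWhileT.prems b by (intro reaches_Jz) auto
  then have 2: "reaches prog B (length pre + length is, exs is m) 1 (Suc (length pre + length is), exs is m)"
    using RWhileT by simp
  have "reaches prog B (length (pre @ is @ [Jz x ?q]), exs is m) t1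
     (length (pre @ is @ [Jz x ?q]) + clen c, m1)"
    using RWhileT.prems b by (intro RWhileT.IH(1)) auto
  then have 3: "reaches prog B (Suc (length pre + length is), exs is m) t1
     (Suc (length pre + length is + clen c), m1)" by simp
  have "reaches prog B (length (pre @ is @ [Jz x ?q] @ code (length pre + length is + 1) c), m1) 2
     (length pre, m1(0 := 0))"
    using RWhileT.prems b1 by (intro reaches_goto) auto
  then have 4: "reaches prog B (Suc (length pre + length is + clen c), m1) 2 (length pre, m1(0 := 0))"
    by (simp add: add.assoc)
  have 5: "reaches prog B (length pre, m1(0 := 0)) t2 (length pre + clen (RWhile is x c), m2)"
    using RWhileT.prems b1 by (intro RWhileT.IH(2)) auto
  have "length is + (1 + (t1 + (2 + t2))) = length is + t1 + t2 + 3" by simp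
  then show ?case
    using reaches_trans[OF 1 reaches_trans[OF 2 reaches_trans[OF 3 reaches_trans[OF 4 5]]]]
    by (metis (no_types))
qed

section \<open>A language of arrays\<close>

text \<open>Every variable is an array; a scalar is an array of which only index 0 is used. Index \<open>i\<close> of
  variable \<open>k\<close> lives at address \<open>64 * (i + 1) + k\<close>, and the cells below 64 are scratch space.\<close>

type_synonym state = "nat \<Rightarrow> nat \<Rightarrow> nat"

datatype exp = Num nat | Rd nat exp | Plus exp exp | Minus exp exp | Mx exp exp

fun ev :: "exp \<Rightarrow> state \<Rightarrow> nat" where
  "ev (Num c) s = c"
| "ev (Rd k e) s = s k (ev e s)"
| "ev (Plus a b) s = ev a s + ev b s"
| "ev (Minus a b) s = ev a s - ev b s"
| "ev (Mx a b) s = max (ev a s) (ev b s)"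

datatype com = Skip | Wr nat exp exp | Seq com com (infixr ";;" 60) | If exp com com | While exp com

text \<open>Only assignments and guard tests take time. Evaluating an expression is free: the
  expressions of a fixed program have bounded code length, which the compilation charges to the
  constant factor.\<close>

inductive big :: "com \<Rightarrow> state \<Rightarrow> nat \<Rightarrow> state \<Rightarrow> bool" where
  Skip: "big Skip s 0 s"
| Wr: "big (Wr k i e) s 1 (s(k := (s k)(ev i s := ev e s)))"
| Seq: "big c1 s t1 s1 \<Longrightarrow> big c2 s1 t2 s2 \<Longrightarrow> big (c1 ;; c2) s (t1 + t2) s2"
| IfT: "ev e s \<noteq> 0 \<Longrightarrow> big c1 s t s1 \<Longrightarrow> big (If e c1 c2) s (t + 1) s1"
| IfF: "ev e s = 0 \<Longrightarrow> big c2 s t s1 \<Longrightarrow> big (If e c1 c2) s (t + 1) s1"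
| WhileF: "ev e s = 0 \<Longrightarrow> big (While e c) s 1 s"
| WhileT: "ev e s \<noteq> 0 \<Longrightarrow> big c s t1 s1 \<Longrightarrow> big (While e c) s1 t2 s2 \<Longrightarrow>
    big (While e c) s (t1 + t2 + 1) s2"

inductive_cases SkipE: "big Skip s t s'"
inductive_cases WrE: "big (Wr k i e) s t s'"
inductive_cases SeqE: "big (c1 ;; c2) s t s'"
inductive_cases IfE: "big (If e c1 c2) s t s'"

subsection \<open>Compilation\<close>

definition addr :: "nat \<Rightarrow> nat \<Rightarrow> nat" where
  "addr k i = 64 * (i + 1) + k"

lemma addr_eq_iff: "k < 64 \<Longrightarrow> l < 64 \<Longrightarrow> addr k i = addr l j \<longleftrightarrow> k = l \<and> i = j"
proof -
  assume "k < 64" "l < 64"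
  then have "addr k i mod 64 = k" "addr l j mod 64 = l" "addr k i div 64 = i + 1" "addr l j div 64 = j + 1"
    by (auto simp: addr_def mod_add_eq[symmetric])
  then show ?thesis by (metis add_right_cancel)
qed

lemma addr_ge: "64 \<le> addr k i"
  by (simp add: addr_def)

definition rep :: "mem \<Rightarrow> state \<Rightarrow> bool" where
  "rep m s \<longleftrightarrow> (\<forall>k<64. \<forall>i. m (addr k i) = s k i)"

lemma rep_zero: "rep m s \<Longrightarrow> rep (m(0 := 0)) s"
  by (simp add: rep_def addr_def)

text \<open>Six doublings multiply the index by 64; \<open>64 + k\<close> is the rest of
  \<open>addr k i\<close>.\<close>

definition adr :: "nat \<Rightarrow> nat \<Rightarrow> nat \<Rightarrow> instr list" where
  "adr k t u = [Add t t t, Add t t t, Add t t t, Add t t t, Add t t t, Add t t t,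
     Const u (64 + k), Add t t u]"

lemma exs_double: "exs (Add t t t # is) m = exs is (m(t := 2 * m t))"
  by (simp add: mult_2)

lemma fitss_double: "fitss B (Add t t t # is) m \<longleftrightarrow> 2 * m t \<le> B \<and> fitss B is (m(t := 2 * m t))"
  by (simp add: mult_2)

lemma exs_adr: "t \<noteq> u \<Longrightarrow> exs (adr k t u) m = m(t := addr k (m t), u := 64 + k)"
  unfolding adr_def exs_double by (simp add: addr_def fun_upd_twist add_ac)

lemma fitss_adr: "t \<noteq> u \<Longrightarrow> fitss B (adr k t u) m \<longleftrightarrow> addr k (m t) \<le> B"
  unfolding adr_def fitss_double by (auto simp: addr_def)

text \<open>Cell \<open>t\<close> is the top of a stack: the value ends up there and smaller cells
  stay intact. For \<open>Mx\<close>, truncated subtraction gives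
  \<open>a + (b - a) = max a b\<close>.\<close>

fun ce :: "exp \<Rightarrow> nat \<Rightarrow> instr list" where
  "ce (Num c) t = [Const t c]"
| "ce (Rd k e) t = ce e t @ adr k t (t + 1) @ [Load t t]"
| "ce (Plus a b) t = ce a t @ ce b (t + 1) @ [Add t t (t + 1)]"
| "ce (Minus a b) t = ce a t @ ce b (t + 1) @ [Sub t t (t + 1)]"
| "ce (Mx a b) t = ce a t @ ce b (t + 1) @ [Sub (t + 1) (t + 1) t, Add t t (t + 1)]"

text \<open>Bounds two quantities at once: the stack cells used from \<open>t\<close> on, and the
  number of cell-sized summands that can make up the value.\<close>

fun esize :: "exp \<Rightarrow> nat" where
  "esize (Num c) = 1"
| "esize (Rd k e) = esize e + 1"
| "esize (Plus a b) = esize a + esize b"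
| "esize (Minus a b) = esize a + esize b"
| "esize (Mx a b) = esize a + esize b"

lemma esize_pos: "1 \<le> esize e"
  by (induction e) auto

text \<open>The value bounds needed by the machine model come from a syntactic discipline: variables have
  levels, and a variable of level \<open>l\<close> is only assigned sums with at most one summand of level \<open>l\<close> and
  all others of smaller level. After time \<open>T\<close> the values of level \<open>l\<close> are then at most
  \<open>(K * T) ^ (l + 1)\<close> for a constant \<open>K\<close> of the program.\<close>

fun below :: "(nat \<Rightarrow> nat) \<Rightarrow> nat \<Rightarrow> exp \<Rightarrow> bool" where
  "below lev l (Num c) = True"
| "below lev l (Rd k e) = (lev k < l)"
| "below lev l (Plus a b) = (below lev l a \<and> below lev l b)"
| "below lev l (Minus a b) = below lev l a"
| "below lev l (Mx a b) = (below lev l a \<and> below lev l b)"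

fun upto_level :: "(nat \<Rightarrow> nat) \<Rightarrow> nat \<Rightarrow> exp \<Rightarrow> bool" where
  "upto_level lev l (Num c) = True"
| "upto_level lev l (Rd k e) = (lev k \<le> l)"
| "upto_level lev l (Plus a b) =
    (upto_level lev l a \<and> below lev l b \<or> below lev l a \<and> upto_level lev l b)"
| "upto_level lev l (Minus a b) = upto_level lev l a"
| "upto_level lev l (Mx a b) = (upto_level lev l a \<and> upto_level lev l b)"

fun wfe :: "nat \<Rightarrow> exp \<Rightarrow> bool" where
  "wfe K (Num c) = (c \<le> K)"
| "wfe K (Rd k e) = (k < 64 \<and> wfe K e)"
| "wfe K (Plus a b) = (wfe K a \<and> wfe K b)"
| "wfe K (Minus a b) = (wfe K a \<and> wfe K b)"
| "wfe K (Mx a b) = (wfe K a \<and> wfe K b)"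

text \<open>Level 0 is reserved for variables that are never written, so an assigned variable always
  has a level below its own. The limit 60 keeps the stacks, which start in cell 1 or 2, inside the
  scratch cells below 64.\<close>

fun wfc :: "(nat \<Rightarrow> nat) \<Rightarrow> nat \<Rightarrow> com \<Rightarrow> bool" where
  "wfc lev K Skip = True"
| "wfc lev K (Wr k i e) = (k < 64 \<and> wfe K i \<and> wfe K e \<and> 1 \<le> lev k \<and> upto_level lev (lev k) e
     \<and> esize i < 60 \<and> esize e < 60)"
| "wfc lev K (a ;; b) = (wfc lev K a \<and> wfc lev K b)"
| "wfc lev K (If e a b) = (wfe K e \<and> esize e < 60 \<and> wfc lev K a \<and> wfc lev K b)"
| "wfc lev K (While e c) = (wfe K e \<and> esize e < 60 \<and> wfc lev K c)"

fun cc :: "com \<Rightarrow> rcom" where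
  "cc Skip = Block []"
| "cc (Wr k i e) = Block (ce i 1 @ ce e 2 @ adr k 1 3 @ [Store 1 2])"
| "cc (a ;; b) = RSeq (cc a) (cc b)"
| "cc (If e a b) = RSeq (Block (ce e 1)) (RIf 1 (cc a) (cc b))"
| "cc (While e c) = RWhile (ce e 1) 1 (cc c)"

definition lbound :: "nat \<Rightarrow> nat \<Rightarrow> nat \<Rightarrow> nat" where
  "lbound K T l = (K * T) ^ (l + 1)"

definition bounded :: "(nat \<Rightarrow> nat) \<Rightarrow> nat \<Rightarrow> nat \<Rightarrow> state \<Rightarrow> bool" where
  "bounded lev K T s \<longleftrightarrow> (\<forall>k<64. \<forall>i. s k i \<le> lbound K T (lev k))"

section \<open>Growth of the values of each level\<close>

lemma lbound_mono: "1 \<le> K \<Longrightarrow> 1 \<le> T \<Longrightarrow> T \<le> T' \<Longrightarrow> l \<le> l' \<Longrightarrow> lbound K T l \<le> lbound K T' l'"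
  unfolding lbound_def
  by (rule le_trans[OF power_mono power_increasing]) auto

lemma lbound_ge: "1 \<le> K \<Longrightarrow> 1 \<le> T \<Longrightarrow> K \<le> lbound K T l"
proof -
  assume "1 \<le> K" "1 \<le> T"
  then have "K \<le> K * T" "1 \<le> K * T" by auto
  then show ?thesis unfolding lbound_def
    by (metis add.commute le_trans self_le_power plus_1_eq_Suc zero_less_Suc)
qed

text \<open>One more unit of time pays for \<open>K\<close> further summands of the level below:
  \<open>(K * T + K) * (K * T) ^ l\<close> is at most
  \<open>(K * (T + 1)) ^ (l + 1)\<close>.\<close>

lemma lbound_step:
  assumes "1 \<le> K" "1 \<le> T" "1 \<le> l"
  shows "lbound K T l + K * lbound K T (l - 1) \<le> lbound K (T + 1) l"
proof -
  have "lbound K T l + K * lbound K T (l - 1) = (K * T + K) * (K * T) ^ l"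
    using assms(3) by (simp add: lbound_def algebra_simps)
  also have "\<dots> \<le> (K * T + K) * (K * T + K) ^ l"
    by (intro mult_left_mono power_mono) auto
  finally show ?thesis by (simp add: lbound_def algebra_simps)
qed

lemma ev_below:
  assumes "1 \<le> K" "1 \<le> T" "bounded lev K T s" "wfe K e" "below lev l e"
  shows "ev e s \<le> esize e * lbound K T (l - 1)"
  using assms(4,5)
proof (induction e)
  case (Num c) then show ?case using lbound_ge[OF assms(1,2), of "l - 1"] by simp
next
  case (Rd k e)
  have "s k (ev e s) \<le> lbound K T (lev k)" using assms(3) Rd by (simp add: bounded_def)
  also have "\<dots> \<le> lbound K T (l - 1)" using assms Rd by (intro lbound_mono) auto
  finally show ?case by (simp add: trans_le_add1)
next
  case (Minus a b) then show ?case by (auto simp: algebra_simps)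
next
  case (Mx a b) then show ?case by (auto simp: algebra_simps)
qed (auto simp: algebra_simps)

lemma ev_upto_level:
  assumes "1 \<le> K" "1 \<le> T" "bounded lev K T s" "wfe K e" "upto_level lev l e"
  shows "ev e s \<le> lbound K T l + esize e * lbound K T (l - 1)"
  using assms(4,5)
proof (induction e)
  case (Num c) then show ?case using lbound_ge[OF assms(1,2), of l] by simp
next
  case (Rd k e)
  have "s k (ev e s) \<le> lbound K T (lev k)" using assms(3) Rd by (simp add: bounded_def)
  also have "\<dots> \<le> lbound K T l" using assms Rd by (intro lbound_mono) auto
  finally show ?case by (simp add: trans_le_add1)
next
  case (Plus a b)
  then show ?case
    using ev_below[OF assms(1-3), of a l] ev_below[OF assms(1-3), of b l]
    by (auto simp: algebra_simps)
next
  case (Minus a b) then show ?case by (auto simp: algebra_simps)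
next
  case (Mx a b) then show ?case by (auto simp: algebra_simps)
qed

section \<open>Correctness of compiled expressions and commands\<close>

lemma ev_le:
  assumes "\<forall>k<64. \<forall>i. s k i \<le> G" "K \<le> G" "wfe K e"
  shows "ev e s \<le> esize e * G"
  using assms(3)
proof (induction e)
  case (Rd k e) then show ?case using assms(1) by (simp add: trans_le_add1)
qed (use assms(2) in \<open>auto simp: algebra_simps\<close>)

text \<open>An index is built from fewer than 64 values and hence at most \<open>64 * G\<close>; its
  address is then at most \<open>64 * (64 * G) + 128\<close>. This is where the required size of
  \<open>B\<close> comes from.\<close>

lemma ce_correct:
  assumes "rep m s" "wfe K e" "t + esize e < 64" "1 \<le> G"
    "\<forall>k<64. \<forall>i. s k i \<le> G" "K \<le> G" "64 * (64 * G) + 128 \<le> B"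
  shows "exs (ce e t) m t = ev e s \<and> (\<forall>a. a < t \<or> 64 \<le> a \<longrightarrow> exs (ce e t) m a = m a) \<and>
    fitss B (ce e t) m"
  using assms(1-3)
proof (induction e arbitrary: t m)
  case (Num c)
  then show ?case using assms by auto
next
  case (Rd k e)
  let ?m = "exs (ce e t) m"
  have IH: "?m t = ev e s" "\<And>a. a < t \<or> 64 \<le> a \<Longrightarrow> ?m a = m a" "fitss B (ce e t) m"
    using Rd.IH[of m t] Rd.prems by auto
  have "ev e s \<le> esize e * G" using ev_le[OF assms(5,6)] Rd.prems by auto
  also have "\<dots> \<le> 64 * G" using Rd.prems by (intro mult_right_mono) auto
  finally have b: "addr k (ev e s) \<le> B" using assms(7) Rd.prems by (simp add: addr_def)
  have a: "addr k (ev e s) \<noteq> t" "addr k (ev e s) \<noteq> t + 1"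
    using addr_ge[of k "ev e s"] Rd.prems by auto
  have "?m (addr k (ev e s)) = s k (ev e s)"
    using IH(2) addr_ge[of k] Rd.prems by (auto simp: rep_def)
  then show ?case using IH b a Rd.prems by (auto simp: exs_append fitss_append exs_adr fitss_adr)
next
  case (Plus a b)
  let ?m = "exs (ce a t) m" let ?m' = "exs (ce b (t + 1)) ?m"
  have A: "?m t = ev a s" "\<And>x. x < t \<or> 64 \<le> x \<Longrightarrow> ?m x = m x" "fitss B (ce a t) m"
    using Plus.IH(1)[of m t] Plus.prems by auto
  have "rep ?m s" using Plus.prems A(2) addr_ge by (auto simp: rep_def)
  then have B: "?m' (t + 1) = ev b s" "\<And>x. x < t + 1 \<or> 64 \<le> x \<Longrightarrow> ?m' x = ?m x"
      "fitss B (ce b (t + 1)) ?m"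
    using Plus.IH(2)[of ?m "t + 1"] Plus.prems esize_pos[of a] by auto
  have "ev (Plus a b) s \<le> esize (Plus a b) * G" using ev_le[OF assms(5,6)] Plus.prems by blast
  also have "\<dots> \<le> 64 * G" using Plus.prems by (intro mult_right_mono) auto
  finally show ?case using A B assms(7) Plus.prems by (auto simp: exs_append fitss_append)
next
  case (Minus a b)
  let ?m = "exs (ce a t) m" let ?m' = "exs (ce b (t + 1)) ?m"
  have A: "?m t = ev a s" "\<And>x. x < t \<or> 64 \<le> x \<Longrightarrow> ?m x = m x" "fitss B (ce a t) m"
    using Minus.IH(1)[of m t] Minus.prems by auto
  have "rep ?m s" using Minus.prems A(2) addr_ge by (auto simp: rep_def)
  then have B: "?m' (t + 1) = ev b s" "\<And>x. x < t + 1 \<or> 64 \<le> x \<Longrightarrow> ?m' x = ?m x"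
      "fitss B (ce b (t + 1)) ?m"
    using Minus.IH(2)[of ?m "t + 1"] Minus.prems esize_pos[of a] by auto
  show ?case using A B Minus.prems by (auto simp: exs_append fitss_append)
next
  case (Mx a b)
  let ?m = "exs (ce a t) m" let ?m' = "exs (ce b (t + 1)) ?m"
  have A: "?m t = ev a s" "\<And>x. x < t \<or> 64 \<le> x \<Longrightarrow> ?m x = m x" "fitss B (ce a t) m"
    using Mx.IH(1)[of m t] Mx.prems by auto
  have "rep ?m s" using Mx.prems A(2) addr_ge by (auto simp: rep_def)
  then have B: "?m' (t + 1) = ev b s" "\<And>x. x < t + 1 \<or> 64 \<le> x \<Longrightarrow> ?m' x = ?m x"
      "fitss B (ce b (t + 1)) ?m"
    using Mx.IH(2)[of ?m "t + 1"] Mx.prems esize_pos[of a] by auto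
  have "ev (Mx a b) s \<le> esize (Mx a b) * G" using ev_le[OF assms(5,6)] Mx.prems by blast
  also have "\<dots> \<le> 64 * G" using Mx.prems by (intro mult_right_mono) auto
  finally show ?case using A B assms(7) Mx.prems esize_pos[of b] by (auto simp: exs_append fitss_append)
qed

definition bigbound :: "nat \<Rightarrow> nat \<Rightarrow> nat \<Rightarrow> nat" where
  "bigbound K T L = 64 * (64 * lbound K T L) + 128"

lemma cell_le_lbound:
  assumes "\<And>k. lev k \<le> L" "1 \<le> K" "1 \<le> T" "T \<le> T'" "bounded lev K T s"
  shows "\<forall>k<64. \<forall>i. s k i \<le> lbound K T' L"
proof (intro allI impI)
  fix k i assume "k < (64::nat)"
  then   have "s k i \<le> lbound K T (lev k)" using assms by (auto simp: bounded_def)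
  also have "\<dots> \<le> lbound K T' L" using assms by (intro lbound_mono) auto
  finally show "s k i \<le> lbound K T' L" .
qed

lemma ce_ok:
  assumes "\<And>k. lev k \<le> L" "1 \<le> K" "1 \<le> T" "T \<le> T'" "bounded lev K T s" "bigbound K T' L \<le> B"
    "rep m s" "wfe K e" "t + esize e < 64"
  shows "exs (ce e t) m t = ev e s" "fitss B (ce e t) m" "rep (exs (ce e t) m) s"
    "\<And>a. a < t \<Longrightarrow> exs (ce e t) m a = m a"
proof -
  have T': "1 \<le> T'" using assms(3,4) by simp
  have G: "1 \<le> lbound K T' L" "K \<le> lbound K T' L"
    using lbound_ge[OF assms(2) T', of L] assms(2) by auto
  note * = ce_correct[OF assms(7,8,9) G(1) cell_le_lbound[OF assms(1-5)] G(2)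
      assms(6)[unfolded bigbound_def]]
  show "exs (ce e t) m t = ev e s" "fitss B (ce e t) m"
    "\<And>a. a < t \<Longrightarrow> exs (ce e t) m a = m a" using * by auto
  show "rep (exs (ce e t) m) s" using * assms(7) addr_ge by (auto simp: rep_def)
qed

lemma bounded_mono:
  "bounded lev K T s \<Longrightarrow> 1 \<le> K \<Longrightarrow> 1 \<le> T \<Longrightarrow> T \<le> T' \<Longrightarrow> bounded lev K T' s"
  unfolding bounded_def using lbound_mono[of K T T'] by (meson le_refl le_trans)

text \<open>\<open>T\<close> is the time on the clock before the command. Level bounds grow with the
  clock, while \<open>B\<close> is fixed by a final time \<open>T'\<close> that no subcommand
  exceeds. A unit of source time is charged at most one pass through the compiled code plus the jump
  overhead of 3, hence the factor \<open>C\<close>.\<close>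

theorem cc_correct:
  assumes "big c s t s'" "\<And>k. lev k \<le> L" "60 \<le> K" "1 \<le> T" "wfc lev K c"
    "bounded lev K T s" "rep m s" "T + t \<le> T'" "bigbound K T' L \<le> B" "clen (cc c) + 3 \<le> C"
  shows "bounded lev K (T + t) s' \<and> (\<exists>t' m'. rbig B (cc c) m t' m' \<and> rep m' s' \<and> t' \<le> C * t)"
  using assms(1,4-8,10)
proof (induction arbitrary: T m rule: big.induct)
  case (Skip s)
  have "rbig B (Block []) m (length ([]::instr list)) (exs [] m)" by (rule rbig.Block) simp
  then show ?case using Skip by auto
next
  case (Wr k i e s)
  have K: "1 \<le> K" using assms(3) by simp
  have T: "T \<le> T'" using Wr by simp
  note b = assms(2) K Wr(1) T Wr(3) assms(9)
  let ?m1 = "exs (ce i 1) m" let ?m2 = "exs (ce e 2) ?m1"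
  have w: "wfe K i" "wfe K e" "1 + esize i < 64" "2 + esize e < 64" using Wr by auto
  note i = ce_ok[OF b Wr(4) w(1,3)]
  note e = ce_ok[OF b i(3) w(2,4)]
  have m2: "?m2 1 = ev i s" "?m2 2 = ev e s" using i e by auto
  have "ev i s \<le> esize i * lbound K T' L"
  proof (rule ev_le[OF _ _ w(1)])
    show "\<forall>k<64. \<forall>i. s k i \<le> lbound K T' L" by (rule cell_le_lbound[OF b(1-5)])
    show "K \<le> lbound K T' L" using lbound_ge K Wr(1) T by simp
  qed
  also have "\<dots> \<le> 64 * lbound K T' L" using w by (intro mult_right_mono) auto
  finally have a: "addr k (ev i s) \<le> B" using assms(9) Wr(2) by (simp add: addr_def bigbound_def)
  let ?is = "ce i 1 @ ce e 2 @ adr k 1 3 @ [Store 1 2]"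
  have "fitss B ?is m" using i e a m2 by (simp add: fitss_append exs_append fitss_adr)
  then have r: "rbig B (cc (Wr k i e)) m (length ?is) (exs ?is m)"
    using rbig.Block by (metis cc.simps(2))
  have "exs ?is m = ?m2(1 := addr k (ev i s), 3 := 64 + k, addr k (ev i s) := ev e s)"
    using m2 by (simp add: exs_append exs_adr)
  moreover have "rep \<dots> (s(k := (s k)(ev i s := ev e s)))"
    unfolding rep_def
  proof (intro allI impI)
    fix l j assume l: "l < (64::nat)"
    have "addr l j \<noteq> 1" "addr l j \<noteq> 3" using addr_ge[of l j] by auto
    moreover have "?m2 (addr l j) = s l j" using e(3) l by (simp add: rep_def)
    ultimately show "(?m2(1 := addr k (ev i s), 3 := 64 + k, addr k (ev i s) := ev e s)) (addr l j) =
      (s(k := (s k)(ev i s := ev e s))) l j"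
      using addr_eq_iff[OF l, of k j "ev i s"] Wr(2) by auto
  qed
  ultimately have rp: "rep (exs ?is m) (s(k := (s k)(ev i s := ev e s)))" by simp
  have "ev e s \<le> lbound K T (lev k) + esize e * lbound K T (lev k - 1)"
    using Wr w by (intro ev_upto_level[OF K Wr(1) Wr(3)]) auto
  also have "\<dots> \<le> lbound K T (lev k) + K * lbound K T (lev k - 1)"
    using Wr(2) assms(3) by (intro add_left_mono mult_right_mono) auto
  also have "\<dots> \<le> lbound K (T + 1) (lev k)" using Wr K by (intro lbound_step) auto
  finally have "bounded lev K (T + 1) (s(k := (s k)(ev i s := ev e s)))"
    using bounded_mono[OF Wr(3) K Wr(1), of "T + 1"] by (auto simp: bounded_def)
  moreover have "length ?is \<le> C * 1" using Wr(6) by simp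
  ultimately show ?case using r rp by blast
next
  case (Seq c1 s t1 s1 c2 t2 s2)
  have 1: "bounded lev K (T + t1) s1 \<and> (\<exists>t' m'. rbig B (cc c1) m t' m' \<and> rep m' s1 \<and> t' \<le> C * t1)"
    using Seq.prems by (intro Seq.IH(1)) auto
  then obtain t1' m1 where m1: "rbig B (cc c1) m t1' m1" "rep m1 s1" "t1' \<le> C * t1" by blast
  have 2: "bounded lev K (T + t1 + t2) s2 \<and> (\<exists>t' m'. rbig B (cc c2) m1 t' m' \<and> rep m' s2 \<and> t' \<le> C * t2)"
    using Seq.prems 1 m1 by (intro Seq.IH(2)) auto
  then obtain t2' m2 where m2: "rbig B (cc c2) m1 t2' m2" "rep m2 s2" "t2' \<le> C * t2" by blast
  have "rbig B (cc (c1 ;; c2)) m (t1' + t2') m2" using m1 m2 rbig.RSeq by simp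
  moreover have "t1' + t2' \<le> C * (t1 + t2)" using m1 m2 by (simp add: algebra_simps)
  ultimately show ?case using 2 m2 by (auto simp: add.assoc)
next
  case (IfT e s c1 t s1 c2)
  have K: "1 \<le> K" and T: "T \<le> T'" using assms(3) IfT.prems by auto
  have w: "wfe K e" "1 + esize e < 64" using IfT.prems by auto
  note e = ce_ok[OF assms(2) K IfT.prems(1) T IfT.prems(3) assms(9) IfT.prems(4) w]
  have 1: "bounded lev K (T + t) s1 \<and>
     (\<exists>t' m'. rbig B (cc c1) (exs (ce e 1) m) t' m' \<and> rep m' s1 \<and> t' \<le> C * t)"
    using IfT.prems e by (intro IfT.IH) auto
  then obtain t1 m1 where m1: "rbig B (cc c1) (exs (ce e 1) m) t1 m1" "rep m1 s1" "t1 \<le> C * t" by blast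
  have "rbig B (RIf 1 (cc c1) (cc c2)) (exs (ce e 1) m) (t1 + 3) (m1(0 := 0))"
    using m1 IfT.hyps e by (intro rbig.RIfT) auto
  then have "rbig B (cc (If e c1 c2)) m (length (ce e 1) + (t1 + 3)) (m1(0 := 0))"
    using rbig.RSeq[OF rbig.Block[OF e(2)]] by simp
  moreover have "rep (m1(0 := 0)) s1" using m1 by (intro rep_zero) auto
  moreover have "length (ce e 1) + (t1 + 3) \<le> C * (t + 1)" using m1 IfT.prems by simp
  moreover have "bounded lev K (T + (t + 1)) s1"
    using 1 bounded_mono[of lev K "T + t" s1 "T + (t + 1)"] K IfT.prems by simp
  ultimately show ?case by blast
next
  case (IfF e s c2 t s1 c1)
  have K: "1 \<le> K" and T: "T \<le> T'" using assms(3) IfF.prems by auto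
  have w: "wfe K e" "1 + esize e < 64" using IfF.prems by auto
  note e = ce_ok[OF assms(2) K IfF.prems(1) T IfF.prems(3) assms(9) IfF.prems(4) w]
  have 1: "bounded lev K (T + t) s1 \<and>
     (\<exists>t' m'. rbig B (cc c2) (exs (ce e 1) m) t' m' \<and> rep m' s1 \<and> t' \<le> C * t)"
    using IfF.prems e by (intro IfF.IH) auto
  then obtain t1 m1 where m1: "rbig B (cc c2) (exs (ce e 1) m) t1 m1" "rep m1 s1" "t1 \<le> C * t" by blast
  have "rbig B (RIf 1 (cc c1) (cc c2)) (exs (ce e 1) m) (t1 + 1) m1"
    using m1 IfF.hyps e by (intro rbig.RIfF) auto
  then have "rbig B (cc (If e c1 c2)) m (length (ce e 1) + (t1 + 1)) m1"
    using rbig.RSeq[OF rbig.Block[OF e(2)]] by fastforce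
  moreover have "length (ce e 1) + (t1 + 1) \<le> C * (t + 1)" using m1 IfF.prems by simp
  moreover have "bounded lev K (T + (t + 1)) s1"
    using 1 bounded_mono[of lev K "T + t" s1 "T + (t + 1)"] K IfF.prems by simp
  ultimately show ?case using m1(2) by blast
next
  case (WhileF e s c)
  have K: "1 \<le> K" and T: "T \<le> T'" using assms(3) WhileF.prems by auto
  have w: "wfe K e" "1 + esize e < 64" using WhileF.prems by auto
  note e = ce_ok[OF assms(2) K WhileF.prems(1) T WhileF.prems(3) assms(9) WhileF.prems(4) w]
  have "rbig B (cc (While e c)) m (length (ce e 1) + 1) (exs (ce e 1) m)"
    using WhileF.hyps e by (auto intro: rbig.RWhileF simp del: One_nat_def)
  moreover have "bounded lev K (T + 1) s"
    using bounded_mono[OF WhileF.prems(3) K WhileF.prems(1), of "T + 1"] by simp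
  moreover have "length (ce e 1) + 1 \<le> C * 1" using WhileF.prems by simp
  ultimately show ?case using e(3) by blast
next
  case (WhileT e s c t1 s1 t2 s2)
  have K: "1 \<le> K" and T: "T \<le> T'" using assms(3) WhileT.prems by auto
  have w: "wfe K e" "1 + esize e < 64" using WhileT.prems by auto
  note e = ce_ok[OF assms(2) K WhileT.prems(1) T WhileT.prems(3) assms(9) WhileT.prems(4) w]
  have 1: "bounded lev K (T + t1) s1 \<and>
     (\<exists>t' m'. rbig B (cc c) (exs (ce e 1) m) t' m' \<and> rep m' s1 \<and> t' \<le> C * t1)"
    using WhileT.prems e by (intro WhileT.IH(1)) auto
  then obtain u1 m1 where m1: "rbig B (cc c) (exs (ce e 1) m) u1 m1" "rep m1 s1" "u1 \<le> C * t1" by blast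
  have "bounded lev K (T + t1) s1" using 1 by simp
  then have b: "bounded lev K (T + t1 + 1) s1"
    using bounded_mono[of lev K "T + t1" s1 "T + t1 + 1"] K WhileT.prems by simp
  have r: "rep (m1(0 := 0)) s1" using m1 by (intro rep_zero) auto
  have 2: "bounded lev K (T + t1 + 1 + t2) s2 \<and>
     (\<exists>t' m'. rbig B (cc (While e c)) (m1(0 := 0)) t' m' \<and> rep m' s2 \<and> t' \<le> C * t2)"
    using WhileT.prems by (intro WhileT.IH(2)[OF _ _ b r]) auto
  then obtain u2 m2 where m2: "rbig B (cc (While e c)) (m1(0 := 0)) u2 m2" "rep m2 s2" "u2 \<le> C * t2"
    by blast
  have "rbig B (cc (While e c)) m (length (ce e 1) + u1 + u2 + 3) m2"
    using WhileT.hyps e m1 m2 by (auto intro!: rbig.RWhileT simp del: One_nat_def)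
  moreover have "length (ce e 1) + u1 + u2 + 3 \<le> C * (t1 + t2 + 1)"
    using m1 m2 WhileT.prems by (simp add: algebra_simps)
  ultimately show ?case using 2 m2(2) by (auto simp: add_ac)
qed

subsection \<open>Program logic\<close>

text \<open>Total correctness with the running time as an argument of the postcondition. For
  commands without loops the rules are equations, so the simplifier can execute straight-line code
  symbolically.\<close>

definition runs :: "com \<Rightarrow> state \<Rightarrow> (nat \<Rightarrow> state \<Rightarrow> bool) \<Rightarrow> bool" where
  "runs c s Q \<longleftrightarrow> (\<exists>t s'. big c s t s' \<and> Q t s')"

lemma runs_Skip [simp]: "runs Skip s Q = Q 0 s"
  by (auto simp: runs_def intro: big.intros elim: SkipE)

lemma runs_Wr [simp]: "runs (Wr k i e) s Q = Q 1 (s(k := (s k)(ev i s := ev e s)))"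
  by (auto simp: runs_def intro: big.Wr[simplified] elim: WrE)

lemma runs_Seq: "runs (c1 ;; c2) s Q = runs c1 s (\<lambda>t1 s1. runs c2 s1 (\<lambda>t2. Q (t1 + t2)))"
  by (auto simp: runs_def elim!: SeqE; meson big.Seq)

lemma runs_If [simp]:
  "runs (If e c1 c2) s Q = (if ev e s \<noteq> 0 then runs c1 s (\<lambda>t. Q (t + 1)) else runs c2 s (\<lambda>t. Q (t + 1)))"
  by (force simp: runs_def intro: big.IfT[simplified] big.IfF[simplified] elim!: IfE)

fun mods :: "com \<Rightarrow> nat set" where
  "mods Skip = {}"
| "mods (Wr k i e) = {k}"
| "mods (a ;; b) = mods a \<union> mods b"
| "mods (If e a b) = mods a \<union> mods b"
| "mods (While e c) = mods c"

lemma big_frame: "big c s t s' \<Longrightarrow> k \<notin> mods c \<Longrightarrow> s' k = s k"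
  by (induction rule: big.induct) auto

text \<open>The frame condition is handed over along with the old postcondition, so specifications
  need to mention only what a command changes.\<close>

lemma runs_mono:
  assumes "runs c s P" "\<And>t s'. P t s' \<Longrightarrow> \<forall>k. k \<notin> mods c \<longrightarrow> s' k = s k \<Longrightarrow> Q t s'"
  shows "runs c s Q"
  using assms big_frame unfolding runs_def by blast

lemma runs_SeqI:
  assumes "runs c1 s P"
    "\<And>t1 s1. P t1 s1 \<Longrightarrow> \<forall>k. k \<notin> mods c1 \<longrightarrow> s1 k = s k \<Longrightarrow> runs c2 s1 (\<lambda>t2. Q (t1 + t2))"
  shows "runs (c1 ;; c2) s Q"
  unfolding runs_Seq using assms by (rule runs_mono)

text \<open>\<open>r\<close> is a potential that bounds the remaining time except for the last guard
  test. A round of cost \<open>t\<close> and its test must lower it by \<open>t + 1\<close>, which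
  also yields termination.\<close>

lemma runs_While:
  assumes "I r s"
    and step: "\<And>r1 s1. I r1 s1 \<Longrightarrow> \<forall>k. k \<notin> mods c \<longrightarrow> s1 k = s k \<Longrightarrow> ev e s1 \<noteq> 0 \<Longrightarrow>
      runs c s1 (\<lambda>t s2. \<exists>r2. I r2 s2 \<and> t + 1 + r2 \<le> r1)"
    and fin: "\<And>r1 t s1. I r1 s1 \<Longrightarrow> \<forall>k. k \<notin> mods c \<longrightarrow> s1 k = s k \<Longrightarrow> ev e s1 = 0 \<Longrightarrow>
      t + r1 \<le> r + 1 \<Longrightarrow> Q t s1"
  shows "runs (While e c) s Q"
proof -
  have "\<exists>t s' r'. big (While e c) s1 t s' \<and> I r' s' \<and> ev e s' = 0 \<and> t + r' \<le> r1 + 1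
      \<and> (\<forall>k. k \<notin> mods c \<longrightarrow> s' k = s k)"
    if "I r1 s1" "\<forall>k. k \<notin> mods c \<longrightarrow> s1 k = s k" for r1 s1
    using that
  proof (induction r1 arbitrary: s1 rule: less_induct)
    case (less r1)
    show ?case
    proof (cases "ev e s1 = 0")
      case True
      then show ?thesis using less.prems big.WhileF[of e s1 c] by force
    next
      case False
      obtain t s2 r2 where t: "big c s1 t s2" "I r2 s2" "t + 1 + r2 \<le> r1"
        using step[OF less.prems False] by (auto simp: runs_def)
      then have "\<forall>k. k \<notin> mods c \<longrightarrow> s2 k = s k" using less.prems big_frame by metis
      moreover have "r2 < r1" using t by simp
      ultimately obtain t' s' r' where t': "big (While e c) s2 t' s'" "I r' s'" "ev e s' = 0"
        "t' + r' \<le> r2 + 1" "\<forall>k. k \<notin> mods c \<longrightarrow> s' k = s k"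
        using less.IH t by blast
      have "big (While e c) s1 (t + t' + 1) s'" using big.WhileT False t t' by blast
      moreover have "t + t' + 1 + r' \<le> r1 + 1" using t t' by simp
      ultimately show ?thesis using t' by blast
    qed
  qed
  from this[OF assms(1)] show ?thesis using fin unfolding runs_def by (metis add.commute)
qed

section \<open>Graphs\<close>

lemma adjE_sym: "adjE E u v \<longleftrightarrow> adjE E v u"
  by (auto simp: adjE_def)

lemma walk_single [simp]: "walk E [x]"
  by (simp add: walk_def)

lemma walk_Cons: "walk E (x # y # xs) \<longleftrightarrow> adjE E x y \<and> walk E (y # xs)"
proof -
  have "(\<forall>i. Suc i < length (x # y # xs) \<longrightarrow> adjE E ((x # y # xs) ! i) ((x # y # xs) ! Suc i)) \<longleftrightarrow>
    adjE E x y \<and> (\<forall>i. Suc i < length (y # xs) \<longrightarrow> adjE E ((y # xs) ! i) ((y # xs) ! Suc i))"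
    (is "?L \<longleftrightarrow> ?R")
  proof
    assume L: ?L
    show ?R
    proof (intro conjI allI impI)
      show "adjE E x y" using L[rule_format, of 0] by simp
      fix i assume "Suc i < length (y # xs)"
      then show "adjE E ((y # xs) ! i) ((y # xs) ! Suc i)" using L[rule_format, of "Suc i"] by simp
    qed
  next
    assume R: ?R
    show ?L
    proof (intro allI impI)
      fix i assume "Suc i < length (x # y # xs)"
      then show "adjE E ((x # y # xs) ! i) ((x # y # xs) ! Suc i)" using R by (cases i) auto
    qed
  qed
  then show ?thesis by (simp add: walk_def)
qed

subsection \<open>The number of edges of a forest\<close>

lemma walk_mono: "walk E xs \<Longrightarrow> E \<subseteq> E' \<Longrightarrow> walk E' xs"
  by (auto simp: walk_def adjE_def)

lemma has_cycle_mono: "has_cycle E \<Longrightarrow> E \<subseteq> E' \<Longrightarrow> has_cycle E'"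
  unfolding has_cycle_def by (meson walk_mono adjE_def subsetD)

lemma walk_take: "walk E xs \<Longrightarrow> 0 < k \<Longrightarrow> walk E (take k xs)"
  by (auto simp: walk_def)

text \<open>On a longest path, the first vertex has a neighbour other than its successor. By
  maximality this neighbour lies on the path and closes a cycle.\<close>

lemma has_cycle_min_degree_2:
  assumes fin: "finite V" and ne: "V \<noteq> {}"
    and E: "\<And>u v. adjE E u v \<Longrightarrow> u \<in> V \<and> v \<in> V \<and> u \<noteq> v"
    and deg: "\<And>v. v \<in> V \<Longrightarrow> \<exists>a b. a \<noteq> b \<and> adjE E v a \<and> adjE E v b"
  shows "has_cycle E"
proof -
  define P where "P = (\<lambda>xs. walk E xs \<and> distinct xs \<and> set xs \<subseteq> V)"
  obtain v0 where "v0 \<in> V" using ne by blast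
  then have "P [v0]" by (simp add: P_def)
  moreover have "\<forall>xs. P xs \<longrightarrow> length xs < Suc (card V)"
    unfolding P_def using fin by (metis card_mono distinct_card le_imp_less_Suc)
  ultimately obtain xs where xs: "P xs" "\<forall>ys. P ys \<longrightarrow> length ys \<le> length xs"
    using ex_has_greatest_nat[of P "[v0]" length "Suc (card V)"] by (metis less_imp_le)
  then have "xs \<noteq> []" by (auto simp: P_def walk_def)
  then obtain x zs where x: "xs = x # zs" by (cases xs) auto
  then have "x \<in> V" using xs by (auto simp: P_def)
  then obtain a b where "a \<noteq> b" "adjE E x a" "adjE E x b" using deg by blast
  then obtain y where y: "adjE E x y" "zs = [] \<or> y \<noteq> hd zs" by metis
  have "y \<in> set xs"
  proof (rule ccontr)
    assume "y \<notin> set xs"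
    then have "P (y # xs)" using xs y E x by (auto simp: P_def walk_Cons adjE_sym)
    then show False using xs(2) by fastforce
  qed
  then obtain i where i: "i < length xs" "xs ! i = y" by (meson in_set_conv_nth)
  \<comment> \<open>Position 0 is excluded by irreflexivity and position 1 by the choice of
    \<open>y\<close>, so the cycle has at least three vertices.\<close>
  have "i \<noteq> 0" using i y E x by (metis nth_Cons_0)
  moreover have "i \<noteq> 1" using i y x by (cases zs) auto
  ultimately have i2: "2 \<le> i" by simp
  let ?c = "take (Suc i) xs"
  have "?c \<noteq> []" "length ?c = Suc i" using i x by auto
  then have "last ?c = y" using i by (simp add: last_conv_nth)
  moreover have "hd ?c = x" using x by simp
  moreover have "walk E ?c" "distinct ?c" using xs walk_take by (auto simp: P_def)
  ultimately show ?thesis unfolding has_cycle_def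
    using i2 \<open>length ?c = Suc i\<close> y(1) adjE_sym by (metis Suc_le_mono numeral_3_eq_3 numeral_2_eq_2)
qed

text \<open>Removing a vertex with at most one incident edge preserves
  \<open>card V \<le> card E\<close>; if there is none, all degrees are at least 2. Each edge is
  stored in one direction only, so that \<open>card E\<close> counts undirected edges.\<close>

lemma has_cycle_if_many_edges:
  assumes "finite V" "V \<noteq> {}" "finite E"
    "\<And>u v. (u, v) \<in> E \<Longrightarrow> u \<in> V \<and> v \<in> V \<and> u \<noteq> v \<and> (v, u) \<notin> E"
    "card V \<le> card E"
  shows "has_cycle E"
  using assms
proof (induction "card V" arbitrary: V E)
  case 0 then show ?case by simp
next
  case (Suc k)
  let ?inc = "\<lambda>v. {e \<in> E. fst e = v \<or> snd e = v}"
  show ?case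
  proof (cases "\<exists>v\<in>V. card (?inc v) \<le> 1")
    case True
    then obtain v where v: "v \<in> V" "card (?inc v) \<le> 1" by blast
    let ?E = "E - ?inc v" and ?V = "V - {v}"
    have cV: "card ?V = k" using Suc.hyps(2) Suc.prems v by simp
    have "card ?E = card E - card (?inc v)" using Suc.prems by (intro card_Diff_subset) auto
    then have cE: "k \<le> card ?E" using Suc.prems v Suc.hyps(2) by simp
    show ?thesis
    proof (cases "?V = {}")
      case True
      then have "V = {v}" using v by blast
      then have "E = {}" using Suc.prems(4) by (metis ex_in_conv prod.collapse singletonD)
      then show ?thesis using Suc.prems by simp
    next
      case False
      have "has_cycle ?E"
      proof (rule Suc.hyps(1)[of ?V])
        show "\<And>u w. (u, w) \<in> ?E \<Longrightarrow> u \<in> ?V \<and> w \<in> ?V \<and> u \<noteq> w \<and> (w, u) \<notin> ?E"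
          using Suc.prems(4) by auto
      qed (use False Suc.prems cV cE in auto)
      then show ?thesis by (rule has_cycle_mono) auto
    qed
  next
    case False
    show ?thesis
    proof (rule has_cycle_min_degree_2[OF Suc.prems(1,2)])
      show "\<And>u v. adjE E u v \<Longrightarrow> u \<in> V \<and> v \<in> V \<and> u \<noteq> v" using Suc.prems(4) by (auto simp: adjE_def)
      fix v assume "v \<in> V"
      then have "\<not> card (?inc v) \<le> 1" using False by blast
      moreover have "finite (?inc v)" using Suc.prems(3) by simp
      ultimately have "\<not> (\<forall>e\<in>?inc v. \<forall>f\<in>?inc v. e = f)"
        by (simp only: card_le_Suc0_iff_eq One_nat_def not_False_eq_True)
      then obtain e f where ef: "e \<in> ?inc v" "f \<in> ?inc v" "e \<noteq> f" by blast
      define o' where "o' = (\<lambda>e. if fst e = v then snd e else fst e)"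
      obtain a b a' b' where ab: "e = (a, b)" "f = (a', b')" by fastforce
      have "adjE E v (o' e)" "adjE E v (o' f)" using ef unfolding ab by (auto simp: adjE_def o'_def)
      moreover have "o' e \<noteq> o' f"
      proof
        assume eq: "o' e = o' f"
        have "(a, b) \<in> E" "(a', b') \<in> E" "a = v \<or> b = v" "a' = v \<or> b' = v" using ef ab by auto
        then show False
          using eq ef(3) Suc.prems(4)[of a b] Suc.prems(4)[of a' b'] unfolding ab o'_def by auto
      qed
      ultimately show "\<exists>a b. a \<noteq> b \<and> adjE E v a \<and> adjE E v b" by blast
    qed
  qed
qed

text \<open>The edges left by an optimal deletion set form a forest on \<open>n\<close> vertices, so
  there are fewer than \<open>n\<close> of them. The trivial second bound later turns the time bound
  into a polynomial in the input size.\<close>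

lemma edges_le_feedback_edge_number:
  assumes "simple_graph n es" "1 \<le> n"
  shows "length es + 1 \<le> n + feedback_edge_number es" "feedback_edge_number es \<le> length es"
proof -
  have d: "distinct (map (\<lambda>(u, v). {u, v}) es)"
    and e: "\<And>u v. (u, v) \<in> set es \<Longrightarrow> u < n \<and> v < n \<and> u \<noteq> v"
    using assms(1) by (auto simp: simple_graph_def)
  have dist: "distinct es" using d by (simp add: distinct_map)
  have inj: "inj_on (\<lambda>(u, v). {u, v}) (set es)" using d by (simp add: distinct_map)
  have nrev: "(v, u) \<notin> set es" if "(u, v) \<in> set es" for u v
    using inj_onD[OF inj, of "(u, v)" "(v, u)"] that e[of u v] by (auto simp: insert_commute)
  have "acyclic_graph (set es - set es)"
  proof -
    have "\<not> adjE {} u v" for u v by (simp add: adjE_def)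
    then show ?thesis by (auto simp: acyclic_graph_def has_cycle_def)
  qed
  then have ex: "\<exists>F. F \<subseteq> set es \<and> card F = length es \<and> acyclic_graph (set es - F)"
    using distinct_card[OF dist] by blast
  then show "feedback_edge_number es \<le> length es"
    unfolding feedback_edge_number_def by (rule Least_le)
  have "\<exists>F. F \<subseteq> set es \<and> card F = feedback_edge_number es \<and> acyclic_graph (set es - F)"
    unfolding feedback_edge_number_def using ex by (rule LeastI)
  then obtain F where F: "F \<subseteq> set es" "card F = feedback_edge_number es" "acyclic_graph (set es - F)"
    by blast
  have "card (set es - F) < card {..<n}"
  proof (rule ccontr)
    assume "\<not> ?thesis"
    then have "has_cycle (set es - F)"
      using assms(2) e nrev by (intro has_cycle_if_many_edges[of "{..<n}"]) (auto simp: lessThan_empty_iff)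
    then show False using F by (simp add: acyclic_graph_def)
  qed
  moreover have "card (set es - F) = length es - card F"
    using F distinct_card[OF dist] by (metis card_Diff_subset finite_set finite_subset)
  ultimately show "length es + 1 \<le> n + feedback_edge_number es" using F by simp
qed

subsection \<open>Distances\<close>

text \<open>Fixing the length of the walk replaces lists by induction on numbers in the arguments
  about distances.\<close>

definition reach :: "(nat \<times> nat) set \<Rightarrow> nat \<Rightarrow> nat \<Rightarrow> nat \<Rightarrow> bool" where
  "reach E l u v \<longleftrightarrow> (\<exists>xs. walk E xs \<and> hd xs = u \<and> last xs = v \<and> length xs = Suc l)"

lemma reach_0 [simp]: "reach E 0 u v \<longleftrightarrow> u = v"
proof
  assume "u = v"
  then have "walk E [u] \<and> hd [u] = u \<and> last [u] = v \<and> length [u] = Suc 0" by simp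
  then show "reach E 0 u v" unfolding reach_def by blast
qed (auto simp: reach_def length_Suc_conv)

lemma reach_Suc: "reach E (Suc l) u v \<longleftrightarrow> (\<exists>h. adjE E u h \<and> reach E l h v)"
proof
  assume "reach E (Suc l) u v"
  then obtain xs where xs: "walk E xs" "hd xs = u" "last xs = v" "length xs = Suc (Suc l)"
    by (auto simp: reach_def)
  then obtain h zs where z: "xs = u # h # zs" by (auto simp: length_Suc_conv)
  then have "adjE E u h" "reach E l h v" using xs by (auto simp: reach_def walk_Cons)
  then show "\<exists>h. adjE E u h \<and> reach E l h v" by blast
next
  assume "\<exists>h. adjE E u h \<and> reach E l h v"
  then obtain h xs where h: "adjE E u h" "walk E xs" "hd xs = h" "last xs = v" "length xs = Suc l"
    by (auto simp: reach_def)
  then obtain zs where "xs = h # zs" by (cases xs) auto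
  then have "walk E (u # xs) \<and> hd (u # xs) = u \<and> last (u # xs) = v \<and> length (u # xs) = Suc (Suc l)"
    using h by (simp add: walk_Cons)
  then show "reach E (Suc l) u v" unfolding reach_def by blast
qed

lemma reach_trans: "reach E k u v \<Longrightarrow> reach E l v w \<Longrightarrow> reach E (k + l) u w"
  by (induction k arbitrary: u) (auto simp: reach_Suc)

lemma reach_sym: "reach E l u v \<Longrightarrow> reach E l v u"
proof (induction l arbitrary: u)
  case (Suc l)
  then obtain h where "adjE E u h" "reach E l h v" by (auto simp: reach_Suc)
  then have "reach E l v h" "reach E 1 h u" using Suc.IH by (auto simp: reach_Suc adjE_sym)
  then show ?case using reach_trans by fastforce
qed simp

lemma dist_alt: "dist E u v = (LEAST l. reach E l u v)"
  by (simp add: dist_def reach_def)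

locale cgraph =
  fixes n :: nat and es :: "(nat \<times> nat) list"
  assumes simple: "simple_graph n es" and conn: "connected_graph n es" and n_pos: "1 \<le> n"
begin

abbreviation adj :: "nat \<Rightarrow> nat \<Rightarrow> bool" where "adj \<equiv> adjE (set es)"

abbreviation d :: "nat \<Rightarrow> nat \<Rightarrow> nat" where "d \<equiv> dist (set es)"

lemma adj_sym: "adj u v \<Longrightarrow> adj v u"
  by (auto simp: adjE_def)

lemma adjD: "adj u v \<Longrightarrow> u < n \<and> v < n \<and> u \<noteq> v"
  using simple by (auto simp: adjE_def simple_graph_def)

lemma reach_ex: "u < n \<Longrightarrow> v < n \<Longrightarrow> \<exists>l. reach (set es) l u v"
proof -
  assume "u < n" "v < n"
  then obtain xs where "walk (set es) xs" "hd xs = u" "last xs = v"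
    using conn by (auto simp: connected_graph_def)
  then show ?thesis unfolding reach_def
    by (metis walk_def length_0_conv not0_implies_Suc)
qed

lemma reach_d: "u < n \<Longrightarrow> v < n \<Longrightarrow> reach (set es) (d u v) u v"
  unfolding dist_alt using reach_ex by (metis LeastI_ex)

lemma d_le: "reach (set es) l u v \<Longrightarrow> d u v \<le> l"
  unfolding dist_alt by (rule Least_le)

lemma d_self [simp]: "d u u = 0"
  using d_le[of 0 u u] by simp

lemma d_eq_0: "u < n \<Longrightarrow> v < n \<Longrightarrow> d u v = 0 \<longleftrightarrow> u = v"
  using reach_d[of u v] by auto

lemma d_sym: "u < n \<Longrightarrow> v < n \<Longrightarrow> d u v = d v u"
  using reach_d reach_sym d_le by (metis le_antisym)

lemma d_triangle: "u < n \<Longrightarrow> v < n \<Longrightarrow> w < n \<Longrightarrow> d u w \<le> d u v + d v w"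
  using reach_d reach_trans d_le by metis

lemma d_adj: "adj u v \<Longrightarrow> d u v = 1"
proof -
  assume a: "adj u v"
  then have "d u v \<le> 1" by (intro d_le) (auto simp: reach_Suc)
  moreover have "d u v \<noteq> 0" using d_eq_0 a adjD by blast
  ultimately show ?thesis by simp
qed

lemma d_step: "adj u h \<Longrightarrow> v < n \<Longrightarrow> d u v \<le> Suc (d h v)"
  using d_triangle[of u h v] d_adj adjD by fastforce

lemma d_pred: "u < n \<Longrightarrow> v < n \<Longrightarrow> u \<noteq> v \<Longrightarrow> \<exists>h. adj u h \<and> d u v = Suc (d h v)"
proof -
  assume a: "u < n" "v < n" "u \<noteq> v"
  then have "d u v \<noteq> 0" using d_eq_0 by blast
  then obtain l where l: "d u v = Suc l" using not0_implies_Suc by blast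
  then obtain h where h: "adj u h" "reach (set es) l h v" using reach_d[OF a(1,2)] by (auto simp: reach_Suc)
  then have "d h v \<le> l" using d_le by blast
  then show ?thesis using l h d_step[OF h(1) a(2)] by auto
qed

lemma closed_set_UNIV:
  assumes "x \<in> S" "x < n" "\<And>u v. u \<in> S \<Longrightarrow> adj u v \<Longrightarrow> v \<in> S" "v < n"
  shows "v \<in> S"
proof -
  have "reach (set es) l u v \<Longrightarrow> u \<in> S \<Longrightarrow> v \<in> S" for l u
    by (induction l arbitrary: u) (auto simp: reach_Suc assms(3))
  then show ?thesis using reach_d[OF assms(2,4)] assms(1) by blast
qed

text \<open>A label grows by at most 1 along an edge, which bounds \<open>f v\<close> from above.
  Descending from \<open>v\<close> to \<open>src\<close> through predecessors whose labels drop by 1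
  gives the other inequality.\<close>

lemma distance_labels:
  assumes "src < n" "f src = 1"
    and up: "\<And>x y. adj x y \<Longrightarrow> f y \<le> Suc (f x)"
    and down: "\<And>v. v < n \<Longrightarrow> v \<noteq> src \<Longrightarrow> \<exists>x. adj x v \<and> f v = Suc (f x)"
    and v: "v < n"
  shows "f v = Suc (d src v)"
proof -
  have "reach (set es) l u w \<Longrightarrow> f w \<le> f u + l" for l u w
  proof (induction l arbitrary: u)
    case (Suc l)
    then obtain h where "adj u h" "reach (set es) l h w" by (auto simp: reach_Suc)
    then show ?case using Suc.IH[of h] up[of u h] by simp
  qed simp
  from this[OF reach_d[OF assms(1) v]] have 1: "f v \<le> Suc (d src v)" using assms(2) by simp
  have "k = f v \<Longrightarrow> v < n \<Longrightarrow> Suc (d src v) \<le> f v" for k v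
  proof (induction k arbitrary: v rule: less_induct)
    case (less k)
    show ?case
    proof (cases "v = src")
      case False
      then obtain x where x: "adj x v" "f v = Suc (f x)" using down less.prems by blast
      then have "Suc (d src x) \<le> f x" using less adjD by auto
      moreover have "d v src \<le> Suc (d x src)" using d_step adj_sym x assms(1) by blast
      ultimately show ?thesis using x d_sym assms(1) adjD by (metis Suc_le_mono le_trans)
    qed (use assms in simp)
  qed
  then show ?thesis using 1 v by (simp add: le_antisym)
qed

lemma finite_dists: "finite {d u v | u v. u < n \<and> v < n}"
proof -
  have "{d u v | u v. u < n \<and> v < n} = (\<lambda>(u, v). d u v) ` ({..<n} \<times> {..<n})" by auto
  then show ?thesis by simp
qed

abbreviation diam :: nat where "diam \<equiv> diameter n es"

lemma d_le_diam: "u < n \<Longrightarrow> v < n \<Longrightarrow> d u v \<le> diam"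
  unfolding diameter_def using finite_dists by (intro Max_ge) auto

lemma diam_le: "(\<And>u v. u < n \<Longrightarrow> v < n \<Longrightarrow> d u v \<le> x) \<Longrightarrow> diam \<le> x"
  unfolding diameter_def using n_pos finite_dists
  by (subst Max_le_iff) (auto intro!: exI[of _ "0::nat"])

definition nb :: "nat \<Rightarrow> nat set" where
  "nb v = {u. adj v u}"

lemma finite_nb [simp]: "finite (nb v)"
  by (rule finite_subset[of _ "{..<n}"]) (auto simp: nb_def dest: adjD)

subsection \<open>Pruning leaves\<close>

text \<open>\<open>H\<close> is an isometric subgraph: iterating the first step, two of its vertices
  are joined inside \<open>H\<close> by a shortest path of the whole graph. The one-step form is
  what inductions on the distance use.\<close>

definition isom :: "nat set \<Rightarrow> bool" where
  "isom H \<longleftrightarrow> (\<forall>u\<in>H. \<forall>v\<in>H. u \<noteq> v \<longrightarrow> (\<exists>h\<in>H. adj u h \<and> d u v = Suc (d h v)))"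

text \<open>\<open>w v\<close> is the height of the trees already pruned at \<open>v\<close>; the diameter is the maximum of \<open>best\<close>
  and the weighted distances within \<open>H\<close>.\<close>

definition weighted_core :: "nat set \<Rightarrow> (nat \<Rightarrow> nat) \<Rightarrow> nat \<Rightarrow> bool" where
  "weighted_core H w best \<longleftrightarrow> H \<subseteq> {..<n} \<and> isom H \<and> best \<le> diam \<and> (\<forall>u\<in>H. w u \<le> diam) \<and>
     (\<forall>u\<in>H. \<forall>v\<in>H. u \<noteq> v \<longrightarrow> w u + w v + d u v \<le> diam) \<and>
     (\<forall>x. best \<le> x \<longrightarrow> (\<forall>u\<in>H. \<forall>v\<in>H. u \<noteq> v \<longrightarrow> w u + w v + d u v \<le> x) \<longrightarrow> diam \<le> x)"

lemma weighted_core_init: "weighted_core {..<n} (\<lambda>_. 0) 0"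
proof -
  have "isom {..<n}" unfolding isom_def using d_pred adjD by (metis lessThan_iff)
  moreover have "diam \<le> x" if "\<forall>u\<in>{..<n}. \<forall>v\<in>{..<n}. u \<noteq> v \<longrightarrow> d u v \<le> x" for x
    using that by (intro diam_le) (metis d_self lessThan_iff le0)
  ultimately show ?thesis by (simp add: weighted_core_def d_le_diam)
qed

lemma weighted_core_cong:
  "weighted_core H w b \<Longrightarrow> (\<And>v. v \<in> H \<Longrightarrow> w v = w' v) \<Longrightarrow> weighted_core H w' b"
  unfolding weighted_core_def by (simp cong: ball_cong)

lemma leaf_dist:
  assumes "isom H" "l \<in> H" "v \<in> H" "v \<noteq> l" "nb l \<inter> H = {p}"
  shows "d l v = Suc (d p v)"
  using assms unfolding isom_def nb_def by (metis Int_iff mem_Collect_eq singletonD)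

text \<open>A shortest path does not step from another vertex into the leaf \<open>l\<close> and on
  to a third: the step would start at \<open>p\<close>, the only core neighbour, and the path would
  have to return to \<open>p\<close>.\<close>

lemma isom_prune:
  assumes "isom H" "H \<subseteq> {..<n}" "l \<in> H" "nb l \<inter> H = {p}"
  shows "isom (H - {l})"
  unfolding isom_def
proof (intro ballI impI)
  fix u v assume u: "u \<in> H - {l}" "v \<in> H - {l}" "u \<noteq> v"
  then obtain h where h: "h \<in> H" "adj u h" "d u v = Suc (d h v)" using assms(1) by (auto simp: isom_def)
  have "h \<noteq> l"
  proof
    assume "h = l"
    then have "u = p" using assms(4) h u adj_sym by (auto simp: nb_def)
    moreover have "d l v = Suc (d p v)" using leaf_dist assms u by blast
    ultimately show False using h \<open>h = l\<close> by simp
  qed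
  then show "\<exists>h\<in>H - {l}. adj u h \<and> d u v = Suc (d h v)" using h by blast
qed

text \<open>The pair of \<open>l\<close> and \<open>p\<close> is recorded in the best value. For any
  other \<open>v\<close> the way from \<open>l\<close> leads through \<open>p\<close>, so
  \<open>w l + d l v = (w l + 1) + d p v\<close>, and the new weight of \<open>p\<close> takes
  over.\<close>

lemma weighted_core_prune:
  assumes c: "weighted_core H w b" and l: "l \<in> H" and p: "nb l \<inter> H = {p}"
  shows "weighted_core (H - {l}) (w(p := max (w p) (w l + 1))) (max b (w l + w p + 1))"
    (is "weighted_core ?H ?w ?b")
proof -
  have H: "H \<subseteq> {..<n}" "isom H" "b \<le> diam" "\<forall>u\<in>H. w u \<le> diam"
    and W: "\<And>u v. u \<in> H \<Longrightarrow> v \<in> H \<Longrightarrow> u \<noteq> v \<Longrightarrow> w u + w v + d u v \<le> diam"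
    and D: "\<And>x. b \<le> x \<Longrightarrow> (\<forall>u\<in>H. \<forall>v\<in>H. u \<noteq> v \<longrightarrow> w u + w v + d u v \<le> x) \<Longrightarrow> diam \<le> x"
    using c by (auto simp: weighted_core_def)
  have pH: "p \<in> H" "adj l p" "p \<noteq> l" using p adjD by (auto simp: nb_def)
  have lp: "w l + w p + 1 \<le> diam" using W[OF l pH(1)] pH d_adj by auto
  have lt: "\<And>u. u \<in> H \<Longrightarrow> u < n" using H by auto
  have W': "w l + 1 + w v + d p v \<le> diam" if "v \<in> H" "v \<noteq> l" for v
    using W[OF l that(1)] leaf_dist[OF H(2) l that p] that by simp
  have "?w u + ?w v + d u v \<le> diam" if "u \<in> ?H" "v \<in> ?H" "u \<noteq> v" for u v
    using W[of u v] W'[of v] W'[of u] that d_sym[of u v] lt by (auto simp: max_def)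
  moreover have "diam \<le> x" if x: "?b \<le> x" "\<forall>u\<in>?H. \<forall>v\<in>?H. u \<noteq> v \<longrightarrow> ?w u + ?w v + d u v \<le> x" for x
  proof (rule D)
    show "b \<le> x" using x by simp
    have *: "w l + w v + d l v \<le> x" if v: "v \<in> H" "v \<noteq> l" for v
    proof (cases "v = p")
      case True then show ?thesis using x d_adj pH by simp
    next
      case False
      then have "?w p + ?w v + d p v \<le> x" using x(2) v pH by (metis Diff_iff singletonD)
      then show ?thesis using leaf_dist[OF H(2) l v p] False by simp
    qed
    show "\<forall>u\<in>H. \<forall>v\<in>H. u \<noteq> v \<longrightarrow> w u + w v + d u v \<le> x"
    proof (intro ballI impI)
      fix u v assume uv: "u \<in> H" "v \<in> H" "u \<noteq> v"
      show "w u + w v + d u v \<le> x"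
      proof (cases "u = l \<or> v = l")
        case True
        then show ?thesis using *[of u] *[of v] uv d_sym[of u v] lt by (auto simp: add_ac)
      next
        case False
        then have "?w u + ?w v + d u v \<le> x" using x(2) uv by simp
        moreover have "w u \<le> ?w u" "w v \<le> ?w v" by auto
        ultimately show ?thesis by linarith
      qed
    qed
  qed
  ultimately show ?thesis unfolding weighted_core_def
    using H lp isom_prune[OF H(2,1) l p] by auto
qed

subsection \<open>Chains of vertices of degree two\<close>

text \<open>Walking along the chain from either end gives both upper bounds. For the lower bound, a
  shortest path from an inner vertex to \<open>u\<close> starts with a neighbour on the chain, since
  an inner vertex has no others in \<open>H\<close>; induction on the distance follows it until an
  end is met.\<close>

lemma chain_dist:
  assumes H: "isom H" "H \<subseteq> {..<n}" and u: "u \<in> H"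
    and v: "\<And>i. lo \<le> i \<Longrightarrow> i \<le> hi \<Longrightarrow> v i \<in> H"
    and nbv: "\<And>i. lo < i \<Longrightarrow> i < hi \<Longrightarrow> nb (v i) \<inter> H = {v (i - 1), v (i + 1)}"
    and nu: "\<And>i. lo < i \<Longrightarrow> i < hi \<Longrightarrow> v i \<noteq> u"
    and j: "lo \<le> j" "j \<le> hi" and lohi: "lo < hi"
    and steps: "\<And>i. lo \<le> i \<Longrightarrow> i < hi \<Longrightarrow> adj (v i) (v (i + 1))"
  shows "d u (v j) = min (d u (v lo) + (j - lo)) (d u (v hi) + (hi - j))"
proof -
  have lt: "u < n" "\<And>i. lo \<le> i \<Longrightarrow> i \<le> hi \<Longrightarrow> v i < n" using H u v by auto
  have a: "d (v (lo + k)) u \<le> d (v lo) u + k" if "lo + k \<le> hi" for k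
    using that
  proof (induction k)
    case (Suc k)
    have "adj (v (lo + Suc k)) (v (lo + k))" using steps[of "lo + k"] Suc adj_sym by simp
    then show ?case using d_step[of _ _ u] lt Suc by fastforce
  qed simp
  have b: "d (v (hi - k)) u \<le> d (v hi) u + k" if "lo + k \<le> hi" for k
    using that
  proof (induction k)
    case (Suc k)
    have "Suc (hi - Suc k) = hi - k" using Suc.prems by simp
    then have "adj (v (hi - Suc k)) (v (hi - k))" using steps[of "hi - Suc k"] Suc by simp
    then show ?case using d_step[of _ _ u] lt Suc by fastforce
  qed simp
  have "k = d (v j) u \<Longrightarrow> lo \<le> j \<Longrightarrow> j \<le> hi \<Longrightarrow>
      min (d (v lo) u + (j - lo)) (d (v hi) u + (hi - j)) \<le> d (v j) u" for k j
  proof (induction k arbitrary: j rule: less_induct)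
    case (less k)
    show ?case
    proof (cases "j = lo \<or> j = hi")
      case False
      then have j: "lo < j" "j < hi" using less.prems by auto
      then obtain h where h: "h \<in> H" "adj (v j) h" "d (v j) u = Suc (d h u)"
        using H(1) u v[of j] nu[of j] unfolding isom_def by (metis less_imp_le)
      then have "h \<in> {v (j - 1), v (j + 1)}" using nbv[OF j] by (auto simp: nb_def)
      then consider "h = v (j - 1)" | "h = v (j + 1)" by blast
      then show ?thesis
      proof cases
        case 1
        then have "min (d (v lo) u + (j - 1 - lo)) (d (v hi) u + (hi - (j - 1))) \<le> d (v (j - 1)) u"
          using less.prems h j by (intro less.IH[of "d h u"]) auto
        then show ?thesis using h(3) j unfolding 1 by linarith
      next
        case 2
        then have "min (d (v lo) u + (j + 1 - lo)) (d (v hi) u + (hi - (j + 1))) \<le> d (v (j + 1)) u"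
          using less.prems h j by (intro less.IH[of "d h u"]) auto
        then show ?thesis using h(3) j unfolding 2 by linarith
      qed
    qed auto
  qed
  from this[OF refl j] have "min (d (v lo) u + (j - lo)) (d (v hi) u + (hi - j)) \<le> d (v j) u" .
  moreover have "d (v j) u \<le> d (v lo) u + (j - lo)" using a[of "j - lo"] j by simp
  moreover have "d (v j) u \<le> d (v hi) u + (hi - j)" using b[of "hi - j"] j by simp
  ultimately have "d (v j) u = min (d (v lo) u + (j - lo)) (d (v hi) u + (hi - j))" by simp
  then show ?thesis using d_sym lt j lohi by (metis le_refl less_imp_le)
qed

text \<open>The two ends may coincide, for instance when the core is a cycle with a single special
  vertex. Injectivity is therefore demanded of the inner positions only.\<close>

definition chain :: "nat set \<Rightarrow> (nat \<Rightarrow> nat) \<Rightarrow> nat \<Rightarrow> nat \<Rightarrow> bool" where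
  "chain H v lo hi \<longleftrightarrow> lo < hi \<and> (\<forall>i. lo \<le> i \<and> i \<le> hi \<longrightarrow> v i \<in> H) \<and>
     (\<forall>i. lo < i \<and> i < hi \<longrightarrow> nb (v i) \<inter> H = {v (i - 1), v (i + 1)}) \<and>
     (\<forall>i. lo \<le> i \<and> i < hi \<longrightarrow> adj (v i) (v (i + 1))) \<and> inj_on v {lo<..<hi} \<and>
     v lo \<notin> v ` {lo<..<hi} \<and> v hi \<notin> v ` {lo<..<hi}"

lemma chain_sub:
  assumes "chain H v lo hi" "lo \<le> lo'" "lo' < hi'" "hi' \<le> hi"
  shows "chain H v lo' hi'"
proof -
  have *: "v i \<notin> v ` {lo'<..<hi'}" if "i = lo' \<or> i = hi'" for i
  proof
    assume "v i \<in> v ` {lo'<..<hi'}"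
    then obtain j where j: "v i = v j" "lo' < j" "j < hi'" by auto
    then have j': "j \<in> {lo<..<hi}" "i \<noteq> j" using assms that by auto
    show False
    proof (cases "i \<in> {lo<..<hi}")
      case True
      then show False using assms(1) j' j(1) unfolding chain_def inj_on_def by blast
    next
      case False
      then have "i = lo \<or> i = hi" using that assms by auto
      then show False using assms(1) j' j(1) unfolding chain_def by (metis imageI)
    qed
  qed
  have "inj_on v {lo'<..<hi'}"
    using assms by (auto simp: chain_def intro: inj_on_subset[of v "{lo<..<hi}"])
  then show ?thesis using assms * by (auto simp: chain_def)
qed

lemma chain_dist_outside:
  assumes "isom H" "H \<subseteq> {..<n}" "chain H v lo hi" "u \<in> H" "u \<notin> v ` {lo<..<hi}" "lo \<le> j" "j \<le> hi"
  shows "d u (v j) = min (d u (v lo) + (j - lo)) (d u (v hi) + (hi - j))"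
  using assms by (intro chain_dist) (auto simp: chain_def)

text \<open>In the subchain from \<open>lo\<close> to \<open>j\<close> the vertex \<open>v j\<close>
  is an end and hence not inner, so \<open>chain_dist_outside\<close> applies to it. The way through
  \<open>v lo\<close> is estimated by applying the same lemma to \<open>v lo\<close> and the whole
  chain.\<close>

lemma chain_dist_inside:
  assumes "isom H" "H \<subseteq> {..<n}" "chain H v lo hi" "lo < i" "i < j" "j < hi"
  shows "min (j - i) ((i - lo) + (hi - j)) \<le> d (v i) (v j)"
proof -
  have lt: "v k < n" if "lo \<le> k" "k \<le> hi" for k using assms(2,3) that by (auto simp: chain_def)
  have c: "chain H v lo j" using chain_sub[OF assms(3), of lo j] assms by simp
  have "d (v j) (v i) = min (d (v j) (v lo) + (i - lo)) (d (v j) (v j) + (j - i))"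
    using assms c by (intro chain_dist_outside[OF assms(1,2) c]) (auto simp: chain_def)
  moreover have "d (v lo) (v j) = min (d (v lo) (v lo) + (j - lo)) (d (v lo) (v hi) + (hi - j))"
    using assms by (intro chain_dist_outside[OF assms(1-3)]) (auto simp: chain_def)
  moreover have "d (v lo) (v j) = d (v j) (v lo)" "d (v i) (v j) = d (v j) (v i)"
    using d_sym lt assms by auto
  moreover have "d (v lo) (v lo) = 0" "d (v j) (v j) = 0" by auto
  ultimately show ?thesis using assms(4-6) by linarith
qed

text \<open>The way around both ends has length at least \<open>i + (L - j)\<close>. In the first
  half \<open>L - j\<close> already exceeds \<open>j\<close>, in the second half \<open>i\<close>
  exceeds \<open>j - i\<close>, so the way along the chain is never longer.\<close>

lemma chain_half_dist:
  assumes H: "isom H" "H \<subseteq> {..<n}" "chain H v 0 L"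
    and ij: "lo < i" "i < j" "j < hi" and lohi: "lo = 0 \<and> hi = L div 2 \<or> lo = L div 2 \<and> hi = L"
  shows "d (v i) (v j) = j - i"
proof (rule le_antisym)
  have "min (j - i) ((i - 0) + (L - j)) \<le> d (v i) (v j)"
    using assms by (intro chain_dist_inside) auto
  moreover have "j - i \<le> (i - 0) + (L - j)" using ij lohi by auto
  ultimately show "j - i \<le> d (v i) (v j)" by linarith
  have c: "chain H v 0 j" using chain_sub[OF H(3), of 0 j] ij lohi by auto
  have "d (v j) (v i) = min (d (v j) (v 0) + (i - 0)) (d (v j) (v j) + (j - i))"
    using ij c by (intro chain_dist_outside[OF H(1,2) c]) (auto simp: chain_def)
  moreover have "v i \<in> H" "v j \<in> H" using c ij by (auto simp: chain_def)
  then have "v i < n" "v j < n" using H(2) by auto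
  ultimately show "d (v i) (v j) \<le> j - i" using d_sym by simp
qed

subsection \<open>Half-edges\<close>

text \<open>A half-edge is the address of an input cell that holds an endpoint of an edge; the other endpoint is in
  the partner cell, whose address differs in the last bit.\<close>

definition HE :: "nat set" where "HE = {2..<2 * length es + 2}"

definition src :: "nat \<Rightarrow> nat" where "src = input_mem n es"

definition dst :: "nat \<Rightarrow> nat" where "dst a = (if even a then src (a + 1) else src (a - 1))"

lemma src_even: "i < length es \<Longrightarrow> src (2 * i + 2) = fst (es ! i)"
  by (simp add: src_def input_mem_def)

lemma src_odd: "i < length es \<Longrightarrow> src (2 * i + 3) = snd (es ! i)"
proof -
  assume "i < length es"
  moreover have "2 * i + 3 - 2 = 2 * i + 1" "(2 * i + 1) div 2 = i" "odd (2 * i + 3)" by auto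
  ultimately show ?thesis unfolding src_def input_mem_def by simp
qed

lemma dst_even: "i < length es \<Longrightarrow> dst (2 * i + 2) = snd (es ! i)"
proof -
  assume "i < length es"
  moreover have "2 * i + 2 + 1 = 2 * i + 3" "even (2 * i + 2)" by auto
  ultimately show ?thesis using src_odd[of i] by (simp only: dst_def if_True)
qed

lemma dst_odd: "i < length es \<Longrightarrow> dst (2 * i + 3) = fst (es ! i)"
proof -
  assume "i < length es"
  moreover have "2 * i + 3 - 1 = 2 * i + 2" "odd (2 * i + 3)" by auto
  ultimately show ?thesis using src_even[of i] by (simp only: dst_def if_False)
qed

lemma HE_cases:
  assumes "a \<in> HE"
  obtains i where "i < length es" "a = 2 * i + 2" "src a = fst (es ! i)" "dst a = snd (es ! i)"
  | i where "i < length es" "a = 2 * i + 3" "src a = snd (es ! i)" "dst a = fst (es ! i)"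
proof (cases "even a")
  case True
  then obtain j where j: "a = 2 * j" by blast
  then have "a = 2 * (j - 1) + 2" "j - 1 < length es" using assms by (auto simp: HE_def)
  moreover then have "src a = fst (es ! (j - 1))" "dst a = snd (es ! (j - 1))"
    using src_even[of "j - 1"] dst_even[of "j - 1"] by auto
  ultimately show ?thesis using that(1) by blast
next
  case False
  then obtain j where j: "a = 2 * j + 1" using oddE by blast
  then have *: "a = 2 * (j - 1) + 3" "j - 1 < length es" using assms by (auto simp: HE_def)
  then have "src a = snd (es ! (j - 1))" "dst a = fst (es ! (j - 1))"
    using src_odd[of "j - 1"] dst_odd[of "j - 1"] by auto
  then show ?thesis using that(2) * by blast
qed

lemma half_edges: "u = src a \<and> v = dst a \<and> a \<in> HE \<Longrightarrow> adj u v"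
  by (elim conjE, erule HE_cases) (auto simp: adjE_def)

lemma adj_half_edge: "adj u v \<Longrightarrow> \<exists>a\<in>HE. src a = u \<and> dst a = v"
proof -
  assume "adj u v"
  then consider "(u, v) \<in> set es" | "(v, u) \<in> set es" by (auto simp: adjE_def)
  then show ?thesis
  proof cases
    case 1
    then obtain i where "i < length es" "es ! i = (u, v)" by (meson in_set_conv_nth)
    then show ?thesis using src_even[of i] dst_even[of i]
      by (intro bexI[of _ "2 * i + 2"]) (auto simp: HE_def)
  next
    case 2
    then obtain i where "i < length es" "es ! i = (v, u)" by (meson in_set_conv_nth)
    then show ?thesis using src_odd[of i] dst_odd[of i]
      by (intro bexI[of _ "2 * i + 3"]) (auto simp: HE_def)
  qed
qed

lemma half_edge_inj:
  assumes "a \<in> HE" "b \<in> HE" "src a = src b" "dst a = dst b"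
  shows "a = b"
proof -
  have d: "distinct (map (\<lambda>(u, v). {u, v}) es)" using simple by (simp add: simple_graph_def)
  have e: "fst (es ! i) \<noteq> snd (es ! i)" if "i < length es" for i
    using simple nth_mem[OF that] by (auto simp: simple_graph_def case_prod_beta)
  have *: "i = j" if "i < length es" "j < length es" "{fst (es ! i), snd (es ! i)} = {fst (es ! j), snd (es ! j)}" for i j
    using nth_eq_iff_index_eq[OF d, of i j] that by (simp add: case_prod_beta)
  obtain i where i: "i < length es"
    "a = 2 * i + 2 \<and> src a = fst (es ! i) \<and> dst a = snd (es ! i) \<or>
     a = 2 * i + 3 \<and> src a = snd (es ! i) \<and> dst a = fst (es ! i)"
    using HE_cases[OF assms(1)] by metis
  obtain j where j: "j < length es"
    "b = 2 * j + 2 \<and> src b = fst (es ! j) \<and> dst b = snd (es ! j) \<or>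
     b = 2 * j + 3 \<and> src b = snd (es ! j) \<and> dst b = fst (es ! j)"
    using HE_cases[OF assms(2)] by metis
  have "i = j" using i j assms(3,4) by (intro *) auto
  then show ?thesis using i j e[of i] assms(3,4) by auto
qed

lemma src_lt: "a \<in> HE \<Longrightarrow> src a < n"
  using half_edges[of "src a" a "dst a"] adjD by blast

lemma dst_lt: "a \<in> HE \<Longrightarrow> dst a < n"
  using half_edges[of "src a" a "dst a"] adjD by blast

lemma nb_half_edges: "nb v = dst ` {a \<in> HE. src a = v}"
  using adj_half_edge half_edges by (fastforce simp: nb_def)

lemma inj_on_dst: "inj_on dst {a \<in> HE. src a = v}"
  using half_edge_inj by (auto simp: inj_on_def)

lemma card_nb: "card (nb v) = card {a \<in> HE. src a = v}"
  unfolding nb_half_edges using inj_on_dst by (rule card_image)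

lemma sum_nb: "\<Sum> (nb v) = (\<Sum>a | a \<in> HE \<and> src a = v. dst a)"
  unfolding nb_half_edges using inj_on_dst by (subst sum.reindex) auto

lemma card_half_edges_from:
  assumes "S \<subseteq> {..<n}"
  shows "card {a \<in> HE. src a \<in> S} = (\<Sum>v\<in>S. card (nb v))"
proof -
  have "finite S" using assms finite_subset by blast
  have "{a \<in> HE. src a \<in> S} = (\<Union>v\<in>S. {a \<in> HE. src a = v})" by auto
  also have "card \<dots> = (\<Sum>v\<in>S. card {a \<in> HE. src a = v})"
    using \<open>finite S\<close> by (intro card_UN_disjoint) (auto simp: HE_def)
  finally show ?thesis by (simp add: card_nb)
qed

lemma sum_card_nb: "(\<Sum>v<n. card (nb v)) = 2 * length es"
proof -
  have "{a \<in> HE. src a \<in> {..<n}} = HE" using src_lt by auto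
  then show ?thesis using card_half_edges_from[of "{..<n}"] by (simp add: HE_def)
qed

text \<open>Applied to the special vertices, this bounds the number of half-edges from which a chain
  can start.\<close>

lemma card_half_edges_within:
  assumes "S \<subseteq> {..<n}"
  shows "card {a \<in> HE. src a \<in> S \<and> dst a \<in> H} = (\<Sum>v\<in>S. card (nb v \<inter> H))"
proof -
  have "finite S" using assms finite_subset by blast
  have "{a \<in> HE. src a \<in> S \<and> dst a \<in> H} = (\<Union>v\<in>S. {a \<in> HE. src a = v \<and> dst a \<in> H})" by auto
  also have "card \<dots> = (\<Sum>v\<in>S. card {a \<in> HE. src a = v \<and> dst a \<in> H})"
    using \<open>finite S\<close> by (intro card_UN_disjoint) (auto simp: HE_def)
  also have "\<dots> = (\<Sum>v\<in>S. card (nb v \<inter> H))"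
  proof (rule sum.cong[OF refl])
    fix v
    have "nb v \<inter> H = dst ` {a \<in> HE. src a = v \<and> dst a \<in> H}" unfolding nb_half_edges by auto
    moreover have "inj_on dst {a \<in> HE. src a = v \<and> dst a \<in> H}"
      using inj_on_dst[of v] by (rule inj_on_subset) auto
    ultimately show "card {a \<in> HE. src a = v \<and> dst a \<in> H} = card (nb v \<inter> H)"
      by (simp add: card_image)
  qed
  finally show ?thesis .
qed

end

section \<open>The program\<close>

abbreviation V :: "nat \<Rightarrow> exp" where "V k \<equiv> Rd k (Num 0)"

abbreviation asg :: "nat \<Rightarrow> exp \<Rightarrow> com" (infix "::=" 61) where "k ::= e \<equiv> Wr k (Num 0) e"

definition for_loop :: "nat \<Rightarrow> nat \<Rightarrow> com \<Rightarrow> com" where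
  "for_loop i b c = (i ::= Num 0) ;; While (Minus (V b) (V i)) (c ;; (i ::= Plus (V i) (Num 1)))"

lemma mods_for_loop [simp]: "mods (for_loop i b c) = insert i (mods c)"
  by (auto simp: for_loop_def)

text \<open>A round costs 2 beyond its body, for the guard and the increment; the leading 2 is the
  initialisation and the last guard. The bound \<open>T j\<close> may depend on the round, which
  permits amortised sums.\<close>

lemma runs_for_loop:
  assumes i: "i \<notin> mods c" "b \<notin> mods c" "i \<noteq> b" and N: "s b 0 = N"
    and init: "P 0 (s(i := (s i)(0 := 0)))"
    and step: "\<And>j s1. j < N \<Longrightarrow> P j s1 \<Longrightarrow> s1 i 0 = j \<Longrightarrow>
      \<forall>k. k \<noteq> i \<and> k \<notin> mods c \<longrightarrow> s1 k = s k \<Longrightarrow>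
      runs c s1 (\<lambda>t s2. t \<le> T j \<and> P (Suc j) (s2(i := (s2 i)(0 := Suc j))))"
    and fin: "\<And>t s'. P N s' \<Longrightarrow> \<forall>k. k \<noteq> i \<and> k \<notin> mods c \<longrightarrow> s' k = s k \<Longrightarrow>
      t \<le> 2 + (\<Sum>j<N. T j + 2) \<Longrightarrow> Q t s'"
  shows "runs (for_loop i b c) s Q"
  unfolding for_loop_def runs_Seq runs_Wr
proof (rule runs_While[where I = "\<lambda>r s1. \<exists>j\<le>N. s1 i 0 = j \<and> P j s1 \<and> r = (\<Sum>x=j..<N. T x + 2)"
      and r = "\<Sum>x=0..<N. T x + 2"])
  show "\<exists>j\<le>N. (s(i := (s i)(ev (Num 0) s := ev (Num 0) s))) i 0 = j \<and>
      P j (s(i := (s i)(ev (Num 0) s := ev (Num 0) s))) \<and> (\<Sum>x = 0..<N. T x + 2) = (\<Sum>x = j..<N. T x + 2)"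
    using init by (intro exI[of _ 0]) simp
next
  fix r1 s1
  assume inv: "\<exists>j\<le>N. s1 i 0 = j \<and> P j s1 \<and> r1 = (\<Sum>x=j..<N. T x + 2)"
    and fr: "\<forall>k. k \<notin> mods (c ;; (i ::= Plus (V i) (Num 1))) \<longrightarrow>
      s1 k = (s(i := (s i)(ev (Num 0) s := ev (Num 0) s))) k"
    and g: "ev (Minus (V b) (V i)) s1 \<noteq> 0"
  have fr': "\<forall>k. k \<noteq> i \<and> k \<notin> mods c \<longrightarrow> s1 k = s k" using fr by auto
  obtain j where j: "s1 i 0 = j" "P j s1" "r1 = (\<Sum>x=j..<N. T x + 2)" using inv by blast
  have "s1 b 0 = N" using fr' i N by simp
  then have "j < N" using g j by simp
  have "runs c s1 (\<lambda>t s2. t \<le> T j \<and> P (Suc j) (s2(i := (s2 i)(0 := Suc j))))"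
    using step[OF \<open>j < N\<close> j(2,1) fr'] .
  then show "runs (c ;; (i ::= Plus (V i) (Num 1))) s1
      (\<lambda>t s2. \<exists>r2. (\<exists>j\<le>N. s2 i 0 = j \<and> P j s2 \<and> r2 = (\<Sum>x=j..<N. T x + 2)) \<and> t + 1 + r2 \<le> r1)"
    unfolding runs_Seq runs_Wr
  proof (rule runs_mono)
    fix t s2 assume "t \<le> T j \<and> P (Suc j) (s2(i := (s2 i)(0 := Suc j)))"
      and "\<forall>k. k \<notin> mods c \<longrightarrow> s2 k = s1 k"
    moreover from this have "s2 i 0 = j" using i j by simp
    moreover have "r1 = T j + 2 + (\<Sum>x=Suc j..<N. T x + 2)"
      using j \<open>j < N\<close> by (simp add: sum.atLeast_Suc_lessThan)
    ultimately show "\<exists>r2. (\<exists>j\<le>N. (s2(i := (s2 i)(ev (Num 0) s2 := ev (Plus (V i) (Num 1)) s2))) i 0 = j \<and>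
        P j (s2(i := (s2 i)(ev (Num 0) s2 := ev (Plus (V i) (Num 1)) s2))) \<and> r2 = (\<Sum>x=j..<N. T x + 2)) \<and>
        t + 1 + 1 + r2 \<le> r1"
      using \<open>j < N\<close>
      by - (rule exI[of _ "\<Sum>x=Suc j..<N. T x + 2"], rule conjI, rule exI[of _ "Suc j"], auto)
  qed
next
  fix r1 t s1
  assume inv: "\<exists>j\<le>N. s1 i 0 = j \<and> P j s1 \<and> r1 = (\<Sum>x=j..<N. T x + 2)"
    and fr: "\<forall>k. k \<notin> mods (c ;; (i ::= Plus (V i) (Num 1))) \<longrightarrow>
      s1 k = (s(i := (s i)(ev (Num 0) s := ev (Num 0) s))) k"
    and g: "ev (Minus (V b) (V i)) s1 = 0"
    and t: "t + r1 \<le> (\<Sum>x=0..<N. T x + 2) + 1"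
  have fr': "\<forall>k. k \<noteq> i \<and> k \<notin> mods c \<longrightarrow> s1 k = s k" using fr by auto
  obtain j where j: "j \<le> N" "s1 i 0 = j" "P j s1" using inv by blast
  have "s1 b 0 = N" using fr' i N by simp
  then have "P N s1" using g j by simp
  then show "Q (1 + t) s1" using t fr' by (intro fin) (auto simp: atLeast0LessThan)
qed

text \<open>Variables: \<open>X\<close> holds the input; \<open>HEAD\<close> and \<open>NEXT\<close> link the half-edges with the same source;
  \<open>DEG\<close>, \<open>NBS\<close> and \<open>W\<close> hold the degree, the sum of the neighbours and the pruned height of a vertex,
  where only neighbours that are not pruned yet count. A vertex of degree one thus has \<open>NBS\<close> as its
  neighbour, and a vertex of degree two is passed by subtracting the previous vertex from \<open>NBS\<close>.\<close>

abbreviation (input) "vX \<equiv> 2 :: nat"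
abbreviation (input) "vDST \<equiv> 3 :: nat"
abbreviation (input) "vHEAD \<equiv> 4 :: nat"
abbreviation (input) "vNEXT \<equiv> 5 :: nat"
abbreviation (input) "vDEG \<equiv> 6 :: nat"
abbreviation (input) "vNBS \<equiv> 7 :: nat"
abbreviation (input) "vW \<equiv> 8 :: nat"
abbreviation (input) "vSPEC \<equiv> 9 :: nat"
abbreviation (input) "vVIS \<equiv> 10 :: nat"
abbreviation (input) "vD \<equiv> 11 :: nat"
abbreviation (input) "vDL \<equiv> 12 :: nat"
abbreviation (input) "vQ \<equiv> 13 :: nat"
abbreviation (input) "vCH \<equiv> 14 :: nat"
abbreviation (input) "vPRE \<equiv> 15 :: nat"
abbreviation (input) "vSUF \<equiv> 16 :: nat"
abbreviation (input) "vSEG \<equiv> 17 :: nat"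
abbreviation (input) "vN \<equiv> 18 :: nat"
abbreviation (input) "vE \<equiv> 19 :: nat"
abbreviation (input) "vI \<equiv> 20 :: nat"
abbreviation (input) "vJ \<equiv> 21 :: nat"
abbreviation (input) "vCUR \<equiv> 22 :: nat"
abbreviation (input) "vP \<equiv> 23 :: nat"
abbreviation (input) "vBEST \<equiv> 24 :: nat"
abbreviation (input) "vH \<equiv> 25 :: nat"
abbreviation (input) "vTL \<equiv> 26 :: nat"
abbreviation (input) "vPT \<equiv> 27 :: nat"
abbreviation (input) "vY \<equiv> 28 :: nat"
abbreviation (input) "vSRC \<equiv> 29 :: nat"
abbreviation (input) "vL \<equiv> 30 :: nat"
abbreviation (input) "vMID \<equiv> 31 :: nat"
abbreviation (input) "vLO \<equiv> 32 :: nat"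
abbreviation (input) "vHI \<equiv> 33 :: nat"
abbreviation (input) "vVAL \<equiv> 34 :: nat"
abbreviation (input) "vFOLD \<equiv> 35 :: nat"
abbreviation (input) "vLEN \<equiv> 36 :: nat"
abbreviation (input) "vFL \<equiv> 37 :: nat"
abbreviation (input) "vT \<equiv> 38 :: nat"
abbreviation (input) "vU \<equiv> 39 :: nat"

subsection \<open>Adjacency lists\<close>

text \<open>The arrays share addresses with the original place of the input, so apart from
  \<open>X\<close> nothing is assumed about their contents.\<close>

definition clear_prog :: com where
  "clear_prog =
    (vN ::= Rd vX (Num 0)) ;;
    (vE ::= Plus (Plus (Rd vX (Num 1)) (Rd vX (Num 1))) (Num 2)) ;;
    for_loop vI vN
      (Wr vHEAD (V vI) (Num 0) ;; Wr vDEG (V vI) (Num 0) ;; Wr vNBS (V vI) (Num 0) ;;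
       Wr vW (V vI) (Num 0) ;; Wr vSPEC (V vI) (Num 0) ;; Wr vVIS (V vI) (Num 0) ;;
       Wr vSEG (V vI) (Num 0))"

text \<open>Both half-edges of an edge are treated in one round, so that the parity of an address is
  never tested.\<close>

definition dst_prog :: com where
  "dst_prog =
    (vI ::= Num 2) ;;
    While (Minus (V vE) (V vI))
      (Wr vDST (V vI) (Rd vX (Plus (V vI) (Num 1))) ;;
       Wr vDST (Plus (V vI) (Num 1)) (Rd vX (V vI)) ;;
       (vI ::= Plus (V vI) (Num 2)))"

definition adj_body :: com where
  "adj_body =
    (vU ::= Rd vX (V vI)) ;;
    Wr vNEXT (V vI) (Rd vHEAD (V vU)) ;;
    Wr vHEAD (V vU) (V vI) ;;
    Wr vDEG (V vU) (Plus (Rd vDEG (V vU)) (Num 1)) ;;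
    Wr vNBS (V vU) (Plus (Rd vNBS (V vU)) (Rd vDST (V vI))) ;;
    (vI ::= Plus (V vI) (Num 1))"

definition adj_prog :: com where
  "adj_prog = (vI ::= Num 2) ;; While (Minus (V vE) (V vI)) adj_body"

context cgraph
begin

definition input_state :: "state \<Rightarrow> bool" where
  "input_state s \<longleftrightarrow> s vN 0 = n \<and> s vE 0 = 2 * length es + 2 \<and> (\<forall>a\<in>HE. s vX a = src a)"

text \<open>\<open>p\<close> is the largest half-edge below \<open>e\<close> with source
  \<open>v\<close>, or 0 if there is none; 0 can end a list since half-edges start at 2. Lists thus
  run through falling addresses, and one address describes how far a traversal has come.\<close>

definition last_from :: "nat \<Rightarrow> nat \<Rightarrow> nat \<Rightarrow> bool" where
  "last_from e v p \<longleftrightarrow> (p \<noteq> 0 \<longrightarrow> 2 \<le> p \<and> p < e \<and> src p = v) \<and>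
     (\<forall>b. p < b \<and> 2 \<le> b \<and> b < e \<longrightarrow> src b \<noteq> v)"

definition adj_state :: "state \<Rightarrow> bool" where
  "adj_state s \<longleftrightarrow> input_state s \<and>
     (\<forall>a\<in>HE. s vDST a = dst a \<and> last_from a (src a) (s vNEXT a)) \<and>
     (\<forall>v<n. last_from (2 * length es + 2) v (s vHEAD v))"

lemma adj_state_cong:
  "adj_state s \<Longrightarrow> s' vN = s vN \<Longrightarrow> s' vE = s vE \<Longrightarrow> s' vX = s vX \<Longrightarrow> s' vDST = s vDST \<Longrightarrow>
   s' vNEXT = s vNEXT \<Longrightarrow> s' vHEAD = s vHEAD \<Longrightarrow> adj_state s'"
  by (simp add: adj_state_def input_state_def)

lemma runs_clear_prog:
  assumes "\<forall>a<2 * length es + 2. s vX a = src a"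
  shows "runs clear_prog s (\<lambda>t s'. t \<le> 4 + 9 * n \<and> input_state s' \<and>
    (\<forall>v<n. s' vHEAD v = 0 \<and> s' vDEG v = 0 \<and> s' vNBS v = 0 \<and> s' vW v = 0 \<and> s' vSPEC v = 0 \<and>
      s' vVIS v = 0 \<and> s' vSEG v = 0))"
proof -
  have X: "s vX 0 = n" "s vX (Suc 0) = length es"
    using assms by (auto simp: src_def input_mem_def)
  show ?thesis
    unfolding clear_prog_def runs_Seq runs_Wr
  proof (rule runs_for_loop[where N = n and T = "\<lambda>_. 7" and P = "\<lambda>j s'. \<forall>v<j. s' vHEAD v = 0 \<and>
      s' vDEG v = 0 \<and> s' vNBS v = 0 \<and> s' vW v = 0 \<and> s' vSPEC v = 0 \<and> s' vVIS v = 0 \<and> s' vSEG v = 0"])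
  qed (use assms X in \<open>auto simp: runs_Seq less_Suc_eq input_state_def HE_def\<close>)
qed

lemma runs_dst_prog:
  assumes "input_state s"
  shows "runs dst_prog s (\<lambda>t s'. t \<le> 2 + 8 * length es \<and> (\<forall>a\<in>HE. s' vDST a = dst a))"
  unfolding dst_prog_def runs_Seq runs_Wr
proof (rule runs_While[where I = "\<lambda>r s'. \<exists>i\<le>length es. s' vI 0 = 2 * i + 2 \<and>
    (\<forall>a. 2 \<le> a \<and> a < 2 * i + 2 \<longrightarrow> s' vDST a = dst a) \<and> r = 4 * (length es - i)" and r = "4 * length es"],
    goal_cases)
  case 1
  then show ?case by (auto intro!: exI[of _ 0])
next
  case (2 r1 s1)
  then obtain i where i: "i \<le> length es" "s1 vI 0 = 2 * i + 2" "r1 = 4 * (length es - i)"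
    "\<forall>a. 2 \<le> a \<and> a < 2 * i + 2 \<longrightarrow> s1 vDST a = dst a" by blast
  have s1: "s1 vE 0 = 2 * length es + 2" "\<forall>a\<in>HE. s1 vX a = src a"
    using 2(2) assms by (auto simp: input_state_def)
  have lt: "i < length es" using 2(3) i s1 by simp
  then have "2 * i + 2 \<in> HE" "2 * i + 3 \<in> HE" by (auto simp: HE_def)
  then have X: "s1 vX (2 * i + 2) = fst (es ! i)" "s1 vX (2 * i + 3) = snd (es ! i)"
    using s1 src_even[OF lt] src_odd[OF lt] by auto
  show ?case unfolding runs_Seq runs_Wr
  proof (rule exI[of _ "4 * (length es - Suc i)"], rule conjI, rule exI[of _ "Suc i"], intro conjI allI impI, goal_cases)
    case (3 a)
    then have "a < 2 * i + 2 \<or> a = 2 * i + 2 \<or> a = 2 * i + 3" by auto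
    then show ?case using i X dst_even[OF lt] dst_odd[OF lt] 3 by (auto simp: eval_nat_numeral)
  qed (use lt i in auto)
next
  case (3 r1 t s1)
  have "s1 vE 0 = 2 * length es + 2" using 3(2) assms by (auto simp: input_state_def)
  then show ?case using 3 by (auto simp: HE_def)
qed

lemma last_from_Suc:
  "2 \<le> a \<Longrightarrow> last_from (Suc a) (src a) a"
  "last_from a v p \<Longrightarrow> src a \<noteq> v \<Longrightarrow> last_from (Suc a) v p"
  unfolding last_from_def by (auto simp: less_Suc_eq)

lemma runs_adj_prog:
  assumes "input_state s" "\<forall>a\<in>HE. s vDST a = dst a"
    "\<forall>v<n. s vHEAD v = 0 \<and> s vDEG v = 0 \<and> s vNBS v = 0"
  shows "runs adj_prog s (\<lambda>t s'. t \<le> 2 + 14 * length es \<and> adj_state s' \<and>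
    (\<forall>v<n. s' vDEG v = card (nb v) \<and> s' vNBS v = \<Sum> (nb v)))"
  unfolding adj_prog_def runs_Seq runs_Wr
proof (rule runs_While[where I = "\<lambda>r s'. \<exists>i. 2 \<le> i \<and> i \<le> 2 * length es + 2 \<and> s' vI 0 = i \<and>
    (\<forall>v<n. last_from i v (s' vHEAD v) \<and> s' vDEG v = card {a. 2 \<le> a \<and> a < i \<and> src a = v} \<and>
       s' vNBS v = (\<Sum>a | 2 \<le> a \<and> a < i \<and> src a = v. dst a)) \<and>
    (\<forall>a. 2 \<le> a \<and> a < i \<longrightarrow> last_from a (src a) (s' vNEXT a)) \<and>
    r = 7 * (2 * length es + 2 - i)" and r = "7 * (2 * length es)"],
    goal_cases)
  case 1
  have e: "{a::nat. 2 \<le> a \<and> a < 2 \<and> P a} = {}" for P by auto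
  show ?case using assms by (auto intro!: exI[of _ 2] simp: last_from_def e)
next
  case (2 r1 s1)
  then obtain i where i: "2 \<le> i" "i \<le> 2 * length es + 2" "s1 vI 0 = i"
    "r1 = 7 * (2 * length es + 2 - i)"
    "\<forall>v<n. last_from i v (s1 vHEAD v) \<and> s1 vDEG v = card {a. 2 \<le> a \<and> a < i \<and> src a = v} \<and>
       s1 vNBS v = (\<Sum>a | 2 \<le> a \<and> a < i \<and> src a = v. dst a)"
    "\<forall>a. 2 \<le> a \<and> a < i \<longrightarrow> last_from a (src a) (s1 vNEXT a)" by blast
  have s1: "s1 vE 0 = 2 * length es + 2" "\<forall>a\<in>HE. s1 vX a = src a" "\<forall>a\<in>HE. s1 vDST a = dst a"
    using 2(2) assms by (auto simp: input_state_def adj_body_def)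
  have lt: "i < 2 * length es + 2" using 2(3) i s1 by simp
  then have iHE: "i \<in> HE" using i by (simp add: HE_def)
  have src: "s1 vX i = src i" "s1 vDST i = dst i" "src i < n" using s1 src_lt iHE by auto
  have set: "{a. 2 \<le> a \<and> a < Suc i \<and> src a = v} =
      (if src i = v then insert i {a. 2 \<le> a \<and> a < i \<and> src a = v} else {a. 2 \<le> a \<and> a < i \<and> src a = v})" for v
    using i(1) by (auto simp: less_Suc_eq)
  have fin: "finite {a. 2 \<le> a \<and> a < i \<and> src a = v}" for v by simp
  have "runs adj_body s1 (\<lambda>t s2. t = 6 \<and> s2 vI 0 = Suc i \<and>
      s2 vHEAD = (s1 vHEAD)(src i := i) \<and> s2 vNEXT = (s1 vNEXT)(i := s1 vHEAD (src i)) \<and>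
      s2 vDEG = (s1 vDEG)(src i := Suc (s1 vDEG (src i))) \<and>
      s2 vNBS = (s1 vNBS)(src i := s1 vNBS (src i) + dst i))"
    by (simp add: adj_body_def runs_Seq i src)
  then show ?case
  proof (rule runs_mono, goal_cases)
    case (1 t s2)
    then have "\<forall>v<n. last_from (Suc i) v (s2 vHEAD v)"
      using i(5) last_from_Suc(1)[OF i(1)] last_from_Suc(2) by auto
    moreover have "\<forall>v<n. s2 vDEG v = card {a. 2 \<le> a \<and> a < Suc i \<and> src a = v} \<and>
       s2 vNBS v = (\<Sum>a | 2 \<le> a \<and> a < Suc i \<and> src a = v. dst a)"
      using 1 i(5) fin by (auto simp: set)
    moreover have "\<forall>a. 2 \<le> a \<and> a < Suc i \<longrightarrow> last_from a (src a) (s2 vNEXT a)"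
      using 1 i(5,6) src by (auto simp: less_Suc_eq)
    ultimately show ?case using 1 i(1,4) lt
      by - (rule exI[of _ "7 * (2 * length es + 2 - Suc i)"], rule conjI, rule exI[of _ "Suc i"], auto)
  qed
next
  case (3 r1 t s1)
  have s1: "s1 vE 0 = 2 * length es + 2" "input_state s1" "\<forall>a\<in>HE. s1 vDST a = dst a"
    using 3(2) assms by (auto simp: input_state_def adj_body_def)
  have s: "{a. 2 \<le> a \<and> a < 2 * length es + 2 \<and> src a = v} = {a \<in> HE. src a = v}" for v
    by (auto simp: HE_def)
  obtain i where i: "i = 2 * length es + 2"
    "\<forall>v<n. last_from i v (s1 vHEAD v) \<and> s1 vDEG v = card {a. 2 \<le> a \<and> a < i \<and> src a = v} \<and>
       s1 vNBS v = (\<Sum>a | 2 \<le> a \<and> a < i \<and> src a = v. dst a)"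
    "\<forall>a. 2 \<le> a \<and> a < i \<longrightarrow> last_from a (src a) (s1 vNEXT a)" using 3(1,3) s1 by auto
  have "\<forall>v<n. s1 vDEG v = card (nb v) \<and> s1 vNBS v = \<Sum> (nb v)"
    using i(2) unfolding i(1) s card_nb sum_nb by simp
  moreover have "adj_state s1" using i s1 by (auto simp: adj_state_def HE_def)
  ultimately show ?case using 3(4) by auto
qed

end

subsection \<open>Breadth-first search\<close>

text \<open>Labels are shifted by one, so that label 0 means unvisited.\<close>

definition bfs_body :: com where
  "bfs_body =
    If (V vPT)
      ((vY ::= Rd vDST (V vPT)) ;;
       If (Rd vD (V vY)) Skip
         (Wr vD (V vY) (Plus (Rd vD (Rd vQ (V vH))) (Num 1)) ;;
          Wr vQ (V vTL) (V vY) ;;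
          (vTL ::= Plus (V vTL) (Num 1))) ;;
       (vPT ::= Rd vNEXT (V vPT)))
      ((vH ::= Plus (V vH) (Num 1)) ;;
       (vPT ::= Rd vHEAD (Rd vQ (V vH))))"

definition bfs_start :: com where
  "bfs_start =
    Wr vD (V vSRC) (Num 1) ;; Wr vQ (Num 0) (V vSRC) ;; (vH ::= Num 0) ;; (vTL ::= Num 1) ;;
    (vPT ::= Rd vHEAD (V vSRC))"

definition bfs_prog :: com where
  "bfs_prog =
    for_loop vJ vN (Wr vD (V vJ) (Num 0)) ;; bfs_start ;; While (Minus (V vTL) (V vH)) bfs_body"

context cgraph
begin

text \<open>The visited vertices fill the queue in order of their labels, which from the head
  \<open>h\<close> on differ by at most 1. Positions below \<open>h\<close> are completely scanned.
  As lists run through falling addresses, the half-edges of the head above the pointer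
  \<open>p\<close> are those already scanned.\<close>

definition bfs_inv :: "nat \<Rightarrow> (nat \<Rightarrow> nat) \<Rightarrow> nat \<Rightarrow> nat \<Rightarrow> (nat \<Rightarrow> nat) \<Rightarrow> nat \<Rightarrow> bool" where
  "bfs_inv x q h te D p \<longleftrightarrow> h \<le> te \<and> 1 \<le> te \<and> inj_on q {..<te} \<and> q ` {..<te} = {v. v < n \<and> D v \<noteq> 0} \<and>
     q 0 = x \<and> D x = 1 \<and>
     (\<forall>v<n. D v \<noteq> 0 \<and> v \<noteq> x \<longrightarrow> (\<exists>y. adj y v \<and> D y \<noteq> 0 \<and> D v = Suc (D y))) \<and>
     (\<forall>i j. i \<le> j \<and> j < te \<longrightarrow> D (q i) \<le> D (q j)) \<and>
     (h < te \<longrightarrow> (\<forall>j<te. D (q j) \<le> Suc (D (q h)))) \<and>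
     (\<forall>i<h. \<forall>y. adj (q i) y \<longrightarrow> D y \<noteq> 0 \<and> D y \<le> Suc (D (q i))) \<and>
     (h < te \<longrightarrow> (p \<noteq> 0 \<longrightarrow> p \<in> HE \<and> src p = q h) \<and>
       (\<forall>a\<in>HE. src a = q h \<and> p < a \<longrightarrow> D (dst a) \<noteq> 0 \<and> D (dst a) \<le> Suc (D (q h))))"

section \<open>Preservation of the search invariant\<close>

lemma bfs_init:
  assumes "x < n" "q 0 = x" "D x = 1" "\<And>v. v < n \<Longrightarrow> v \<noteq> x \<Longrightarrow> D v = 0" "last_from (2 * length es + 2) x p"
  shows "bfs_inv x q 0 1 D p"
proof -
  have "{v. v < n \<and> D v \<noteq> 0} = {x}" using assms(1,3,4) by force
  moreover have "(p \<noteq> 0 \<longrightarrow> p \<in> HE \<and> src p = x) \<and>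
      (\<forall>a\<in>HE. src a = x \<and> p < a \<longrightarrow> D (dst a) \<noteq> 0 \<and> D (dst a) \<le> Suc (D x))"
    using assms(5) by (auto simp: last_from_def HE_def)
  moreover have "D v = 0 \<or> v = x" if "v < n" for v using assms(4) that by metis
  moreover have "{..<1::nat} = {0}" by auto
  ultimately show ?thesis unfolding bfs_inv_def using assms(2,3) by auto
qed

text \<open>The new label exceeds that of the head by 1 and is thus maximal in the queue, so
  appending the vertex keeps the queue sorted.\<close>

lemma bfs_visit_new:
  assumes inv: "bfs_inv x q h te D p" and h: "h < te" and p: "p \<noteq> 0" and D: "D (dst p) = 0"
    and p': "last_from p (q h) p'"
  shows "bfs_inv x (q(te := dst p)) h (Suc te) (D(dst p := Suc (D (q h)))) p'"
proof -
  let ?y = "dst p" and ?q = "q(te := dst p)" and ?D = "D(dst p := Suc (D (q h)))"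
  have I: "h \<le> te" "1 \<le> te" "inj_on q {..<te}" "q ` {..<te} = {v. v < n \<and> D v \<noteq> 0}" "q 0 = x" "D x = 1"
    "\<And>v. v < n \<Longrightarrow> D v \<noteq> 0 \<Longrightarrow> v \<noteq> x \<Longrightarrow> \<exists>y. adj y v \<and> D y \<noteq> 0 \<and> D v = Suc (D y)"
    "\<And>i j. i \<le> j \<Longrightarrow> j < te \<Longrightarrow> D (q i) \<le> D (q j)"
    "\<And>j. j < te \<Longrightarrow> D (q j) \<le> Suc (D (q h))"
    "\<And>i y. i < h \<Longrightarrow> adj (q i) y \<Longrightarrow> D y \<noteq> 0 \<and> D y \<le> Suc (D (q i))"
    "p \<in> HE" "src p = q h"
    "\<And>a. a \<in> HE \<Longrightarrow> src a = q h \<Longrightarrow> p < a \<Longrightarrow> D (dst a) \<noteq> 0 \<and> D (dst a) \<le> Suc (D (q h))"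
    using inv h p by (auto simp: bfs_inv_def)
  have vis: "D (q i) \<noteq> 0" "q i \<noteq> ?y" "?D (q i) = D (q i)" "?q i = q i" if "i < te" for i
  proof -
    have "q i \<in> q ` {..<te}" using that by simp
    then show 1: "D (q i) \<noteq> 0" using I(4) by simp
    then show "q i \<noteq> ?y" using D by auto
    then show "?D (q i) = D (q i)" by simp
    show "?q i = q i" using that by simp
  qed
  have y: "?y < n" "adj (q h) ?y"
    using dst_lt[OF I(11)] half_edges[of "q h" p ?y] I(11,12) by auto
  have q': "?q ` {..<Suc te} = {v. v < n \<and> ?D v \<noteq> 0}"
  proof -
    have "?q ` {..<Suc te} = insert ?y (?q ` {..<te})"
      by (simp only: lessThan_Suc image_insert fun_upd_same)
    also have "?q ` {..<te} = q ` {..<te}" by (intro image_cong) auto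
    finally show ?thesis using I(4) y by auto
  qed
  have inj: "inj_on ?q {..<Suc te}"
  proof -
    have "inj_on ?q {..<te}" using I(3) by (auto simp: inj_on_def)
    moreover have "?q te \<notin> ?q ` {..<te}" using vis by fastforce
    ultimately show ?thesis by (simp add: lessThan_Suc)
  qed
  have xy: "x \<noteq> ?y" using I(6) D by auto
  show ?thesis unfolding bfs_inv_def
  proof (intro conjI allI impI ballI)
    fix v assume v: "v < n" "?D v \<noteq> 0 \<and> v \<noteq> x"
    show "\<exists>y. adj y v \<and> ?D y \<noteq> 0 \<and> ?D v = Suc (?D y)"
    proof (cases "v = ?y")
      case True then show ?thesis using y vis[OF h] by (intro exI[of _ "q h"]) auto
    next
      case False
      then obtain z where z: "adj z v" "D z \<noteq> 0" "D v = Suc (D z)" using I(7)[of v] v by auto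
      then have "z \<noteq> ?y" using D by auto
      then show ?thesis using z False by (intro exI[of _ z]) auto
    qed
  next
    fix i j assume ij: "i \<le> j \<and> j < Suc te"
    show "?D (?q i) \<le> ?D (?q j)"
    proof (cases "j = te")
      case False
      then have "j < te" "i < te" using ij by auto
      then show ?thesis using vis(3,4) I(8) ij by metis
    next
      case True
      then show ?thesis using vis(3,4)[of i] I(9)[of i] ij by (cases "i = te") auto
    qed
  next
    fix j assume "j < Suc te"
    then show "?D (?q j) \<le> Suc (?D (?q h))"
      using vis(3,4)[of j] vis(3,4)[OF h] I(9)[of j] by (cases "j = te") auto
  next
    fix i y assume i: "i < h" "adj (?q i) y"
    then have "adj (q i) y" using vis h by auto
    then have "D y \<noteq> 0" "D y \<le> Suc (D (q i))" using I(10)[of i y] i by auto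
    moreover then have "?D y = D y" using D by auto
    ultimately show "?D y \<noteq> 0" "?D y \<le> Suc (?D (?q i))" using vis[of i] i h by auto
  next
    assume "p' \<noteq> 0"
    then show "p' \<in> HE" "src p' = ?q h" using p' I(11) vis(4)[OF h] by (auto simp: last_from_def HE_def)
  next
    fix a assume a: "a \<in> HE" "src a = ?q h \<and> p' < a"
    then have "src a = q h" using vis(4)[OF h] by simp
    \<comment> \<open>By \<open>last_from\<close> no half-edge of the head lies strictly between
      \<open>p'\<close> and \<open>p\<close>, so moving the pointer releases only \<open>p\<close>
      itself.\<close>
    then have "\<not> a < p" using p' a by (auto simp: last_from_def HE_def)
    then consider "a = p" | "p < a" by linarith
    then have "?D (dst a) \<noteq> 0 \<and> ?D (dst a) \<le> Suc (?D (?q h))"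
    proof cases
      case 1 then show ?thesis using vis[OF h] by auto
    next
      case 2 then show ?thesis using I(13)[OF a(1) \<open>src a = q h\<close>] vis[OF h] by auto
    qed
    then show "?D (dst a) \<noteq> 0" "?D (dst a) \<le> Suc (?D (?q h))" by auto
  qed (use I q' inj xy h in auto)
qed

lemma bfs_visit_old:
  assumes inv: "bfs_inv x q h te D p" and h: "h < te" and p: "p \<noteq> 0" and D: "D (dst p) \<noteq> 0"
    and p': "last_from p (q h) p'"
  shows "bfs_inv x q h te D p'"
proof -
  have I: "q ` {..<te} = {v. v < n \<and> D v \<noteq> 0}" "\<And>j. j < te \<Longrightarrow> D (q j) \<le> Suc (D (q h))"
    "p \<in> HE" "src p = q h"
    "\<And>a. a \<in> HE \<Longrightarrow> src a = q h \<Longrightarrow> p < a \<Longrightarrow> D (dst a) \<noteq> 0 \<and> D (dst a) \<le> Suc (D (q h))"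
    using inv h p by (auto simp: bfs_inv_def)
  have "dst p \<in> q ` {..<te}" using I(1,3) D dst_lt by simp
  then have Dp: "D (dst p) \<le> Suc (D (q h))" using I(2) by auto
  have "p' \<noteq> 0 \<longrightarrow> p' \<in> HE \<and> src p' = q h" using p' I(3) by (auto simp: last_from_def HE_def)
  moreover have "D (dst a) \<noteq> 0 \<and> D (dst a) \<le> Suc (D (q h))" if a: "a \<in> HE" "src a = q h" "p' < a" for a
  proof -
    have "\<not> a < p" using p' a by (auto simp: last_from_def HE_def)
    then consider "a = p" | "p < a" by linarith
    then show ?thesis by cases (use D Dp I(5) a in auto)
  qed
  ultimately show ?thesis using inv unfolding bfs_inv_def by auto
qed

lemma bfs_next:
  assumes inv: "bfs_inv x q h te D 0" and h: "h < te"
    and p': "Suc h < te \<Longrightarrow> last_from (2 * length es + 2) (q (Suc h)) p'"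
  shows "bfs_inv x q (Suc h) te D p'"
proof -
  have nbrs: "D y \<noteq> 0 \<and> D y \<le> Suc (D (q h))" if y: "adj (q h) y" for y
  proof -
    obtain a where "a \<in> HE" "src a = q h" "dst a = y" using adj_half_edge[OF y] by blast
    moreover then have "0 < a" by (simp add: HE_def)
    ultimately show ?thesis using inv h unfolding bfs_inv_def by blast
  qed
  have "D (q j) \<le> Suc (D (q (Suc h)))" if "Suc h < te" "j < te" for j
  proof -
    have "D (q h) \<le> D (q (Suc h))" using inv that unfolding bfs_inv_def by (meson le_SucI order_refl)
    moreover have "D (q j) \<le> Suc (D (q h))" using inv h that unfolding bfs_inv_def by blast
    ultimately show ?thesis by simp
  qed
  moreover have "\<forall>i<Suc h. \<forall>y. adj (q i) y \<longrightarrow> D y \<noteq> 0 \<and> D y \<le> Suc (D (q i))"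
    using nbrs inv unfolding bfs_inv_def by (metis less_Suc_eq)
  moreover have "(p' \<noteq> 0 \<longrightarrow> p' \<in> HE \<and> src p' = q (Suc h)) \<and>
      (\<forall>a\<in>HE. src a = q (Suc h) \<and> p' < a \<longrightarrow> D (dst a) \<noteq> 0 \<and> D (dst a) \<le> Suc (D (q (Suc h))))"
    if "Suc h < te" using p'[OF that] by (auto simp: last_from_def HE_def)
  ultimately show ?thesis using inv h unfolding bfs_inv_def by auto
qed

text \<open>With an exhausted queue the visited vertices are closed under adjacency, so by
  connectedness every vertex is visited, and the labels satisfy the local conditions of
  \<open>distance_labels\<close>.\<close>

lemma bfs_final:
  assumes inv: "bfs_inv x q te te D p" and x: "x < n" and v: "v < n"
  shows "D v = Suc (d x v)"
proof -
  have cl: "D z \<noteq> 0 \<and> D z \<le> Suc (D y)" if "y < n" "D y \<noteq> 0" "adj y z" for y z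
  proof -
    have "y \<in> q ` {..<te}" using inv that unfolding bfs_inv_def by blast
    then obtain i where "i < te" "y = q i" by auto
    then show ?thesis using inv that(3) unfolding bfs_inv_def by blast
  qed
  have Dx: "D x = 1" using inv by (simp add: bfs_inv_def)
  have all: "D v \<noteq> 0" if "v < n" for v
  proof -
    have "v \<in> {v. v < n \<and> D v \<noteq> 0}"
    proof (rule closed_set_UNIV[OF _ x _ that])
      show "x \<in> {v. v < n \<and> D v \<noteq> 0}" using x Dx by simp
      fix y z assume "y \<in> {v. v < n \<and> D v \<noteq> 0}" "adj y z"
      then show "z \<in> {v. v < n \<and> D v \<noteq> 0}" using cl[of y z] adjD[of y z] by blast
    qed
    then show ?thesis by simp
  qed
  show ?thesis
  proof (rule distance_labels[OF x _ _ _ v])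
    show "D x = 1" by (rule Dx)
    show "\<And>y z. adj y z \<Longrightarrow> D z \<le> Suc (D y)" using cl all adjD by blast
    have "\<forall>v<n. D v \<noteq> 0 \<and> v \<noteq> x \<longrightarrow> (\<exists>y. adj y v \<and> D y \<noteq> 0 \<and> D v = Suc (D y))"
      using inv unfolding bfs_inv_def by (elim conjE)
    then show "\<And>v. v < n \<Longrightarrow> v \<noteq> x \<Longrightarrow> \<exists>y. adj y v \<and> D v = Suc (D y)"
      using all by meson
  qed
qed

text \<open>The potential of the search is the number of these half-edges plus \<open>n - h\<close>:
  each round either scans a half-edge or advances the head of the queue.\<close>

definition unscanned :: "(nat \<Rightarrow> nat) \<Rightarrow> nat \<Rightarrow> nat \<Rightarrow> nat set" where
  "unscanned q h p = {a \<in> HE. src a \<notin> q ` {..<h} \<and> \<not> (src a = q h \<and> p < a)}"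

lemma finite_unscanned [simp]: "finite (unscanned q h p)"
  by (simp add: unscanned_def HE_def)

lemma unscanned_visit:
  assumes "bfs_inv x q h te D p" "h < te" "p \<noteq> 0" "p' < p" "\<And>i. i \<le> h \<Longrightarrow> q' i = q i"
  shows "Suc (card (unscanned q' h p')) \<le> card (unscanned q h p)"
proof -
  have im: "q' ` {..<h} = q ` {..<h}" using assms(5) by (intro image_cong) auto
  have "p \<in> HE" "src p = q h" using assms(1-3) by (auto simp: bfs_inv_def)
  moreover have "inj_on q {..<te}" using assms(1) by (simp add: bfs_inv_def)
  then have "q i \<noteq> q h" if "i < h" for i using assms(2) that inj_onD[of q "{..<te}" i h] by auto
  then have "q h \<notin> q ` {..<h}" by (metis imageE lessThan_iff)
  ultimately have p: "p \<in> unscanned q h p" by (simp add: unscanned_def)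
  have "unscanned q' h p' \<subseteq> unscanned q h p - {p}"
    using assms(4,5) im \<open>src p = q h\<close> by (auto simp: unscanned_def)
  then have "card (unscanned q' h p') \<le> card (unscanned q h p - {p})" by (intro card_mono) auto
  then show ?thesis using p card_Suc_Diff1[OF finite_unscanned p] by simp
qed

lemma unscanned_next: "card (unscanned q (Suc h) p') \<le> card (unscanned q h 0)"
  by (rule card_mono[OF finite_unscanned]) (auto simp: unscanned_def lessThan_Suc)

text \<open>The factor 8 is the cost 7 of the longest branch, which labels a new vertex, plus the
  loop test.\<close>

lemma runs_bfs_body:
  assumes adj: "adj_state s" and inv: "bfs_inv x (s vQ) (s vH 0) (s vTL 0) (s vD) (s vPT 0)"
    and h: "s vH 0 < s vTL 0"
  shows "runs bfs_body s (\<lambda>t s'. bfs_inv x (s' vQ) (s' vH 0) (s' vTL 0) (s' vD) (s' vPT 0) \<and>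
     t + 1 + 8 * (card (unscanned (s' vQ) (s' vH 0) (s' vPT 0)) + (n - s' vH 0))
       \<le> 8 * (card (unscanned (s vQ) (s vH 0) (s vPT 0)) + (n - s vH 0)))"
proof -
  let ?q = "s vQ" and ?h = "s vH 0" and ?te = "s vTL 0" and ?D = "s vD" and ?p = "s vPT 0"
  have st: "\<And>a. a \<in> HE \<Longrightarrow> s vDST a = dst a \<and> last_from a (src a) (s vNEXT a)"
    "\<And>v. v < n \<Longrightarrow> last_from (2 * length es + 2) v (s vHEAD v)"
    using adj by (auto simp: adj_state_def)
  have inj: "inj_on ?q {..<?te}" and im: "?q ` {..<?te} = {v. v < n \<and> ?D v \<noteq> 0}"
    using inv by (auto simp: bfs_inv_def)
  have "card (?q ` {..<?te}) \<le> card {..<n}" using im by (intro card_mono) auto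
  then have te: "?te \<le> n" using inj by (simp add: card_image)
  show ?thesis
  proof (cases "?p = 0")
    case False
    have p: "?p \<in> HE" "src ?p = ?q ?h" using inv h False by (auto simp: bfs_inv_def)
    have nx: "s vDST ?p = dst ?p" "last_from ?p (?q ?h) (s vNEXT ?p)" using st(1)[OF p(1)] p(2) by auto
    then have "s vNEXT ?p < ?p" using False by (auto simp: last_from_def)
    note uns = unscanned_visit[OF inv h False this]
    show ?thesis
    proof (cases "?D (dst ?p) = 0")
      case True
      have "Suc (card (unscanned (?q(?te := dst ?p)) ?h (s vNEXT ?p))) \<le> card (unscanned ?q ?h ?p)"
        using h by (intro uns) auto
      then show ?thesis
        using bfs_visit_new[OF inv h False True nx(2)] False True nx(1)
        by (simp add: bfs_body_def runs_Seq)
    next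
      case D: False
      have "Suc (card (unscanned ?q ?h (s vNEXT ?p))) \<le> card (unscanned ?q ?h ?p)"
        by (intro uns) auto
      then show ?thesis
        using bfs_visit_old[OF inv h False D nx(2)] False D nx(1)
        by (simp add: bfs_body_def runs_Seq)
    qed
  next
    case True
    have "bfs_inv x ?q (Suc ?h) ?te ?D (s vHEAD (?q (Suc ?h)))"
    proof (rule bfs_next)
      show "bfs_inv x ?q ?h ?te ?D 0" using inv True by simp
      assume "Suc ?h < ?te"
      then have "?q (Suc ?h) \<in> ?q ` {..<?te}" by simp
      then have "?q (Suc ?h) < n" using im by simp
      then show "last_from (2 * length es + 2) (?q (Suc ?h)) (s vHEAD (?q (Suc ?h)))" using st(2) by blast
    qed (use h in simp)
    then show ?thesis
      using True unscanned_next[of ?q ?h "s vHEAD (?q (Suc ?h))"] h te by (simp add: bfs_body_def runs_Seq)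
  qed
qed

end

context cgraph
begin

lemma runs_bfs_prog:
  assumes adj: "adj_state s" and x: "s vSRC 0 = x" "x < n"
  shows "runs bfs_prog s (\<lambda>t s'. t \<le> 10 + 11 * n + 16 * length es \<and> (\<forall>v<n. s' vD v = Suc (d x v)))"
  unfolding bfs_prog_def
proof (rule runs_SeqI[where P = "\<lambda>t s'. t \<le> 2 + 3 * n \<and> (\<forall>v<n. s' vD v = 0)"])
  have N: "s vN 0 = n" using adj by (simp add: adj_state_def input_state_def)
  show "runs (for_loop vJ vN (Wr vD (V vJ) (Num 0))) s (\<lambda>t s'. t \<le> 2 + 3 * n \<and> (\<forall>v<n. s' vD v = 0))"
    by (rule runs_for_loop[where N = n and T = "\<lambda>_. 1" and P = "\<lambda>j s'. \<forall>v<j. s' vD v = 0"])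
      (auto simp: N less_Suc_eq)
next
  fix t1 s1 assume t1: "t1 \<le> 2 + 3 * n \<and> (\<forall>v<n. s1 vD v = 0)"
    and fr: "\<forall>k. k \<notin> mods (for_loop vJ vN (Wr vD (V vJ) (Num 0))) \<longrightarrow> s1 k = s k"
  have adj1: "adj_state s1" by (rule adj_state_cong[OF adj]) (auto simp: fr)
  have x1: "s1 vSRC 0 = x" using x fr by simp
  show "runs (bfs_start ;; While (Minus (V vTL) (V vH)) bfs_body) s1
      (\<lambda>t2 s'. t1 + t2 \<le> 10 + 11 * n + 16 * length es \<and> (\<forall>v<n. s' vD v = Suc (d x v)))"
  proof (rule runs_SeqI[where P = "\<lambda>t s'. t = 5 \<and> bfs_inv x (s' vQ) (s' vH 0) (s' vTL 0) (s' vD) (s' vPT 0) \<and>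
      s' vH 0 = 0"])
    have "last_from (2 * length es + 2) x (s1 vHEAD x)" using adj1 x by (simp add: adj_state_def)
    then have "bfs_inv x ((s1 vQ)(0 := x)) 0 1 ((s1 vD)(x := 1)) (s1 vHEAD x)"
      using x t1 by (intro bfs_init) auto
    then show "runs bfs_start s1 (\<lambda>t s'. t = 5 \<and>
        bfs_inv x (s' vQ) (s' vH 0) (s' vTL 0) (s' vD) (s' vPT 0) \<and> s' vH 0 = 0)"
      using x1 by (simp add: bfs_start_def runs_Seq)
  next
    fix t2 :: nat and s2 assume t2: "t2 = 5 \<and> bfs_inv x (s2 vQ) (s2 vH 0) (s2 vTL 0) (s2 vD) (s2 vPT 0) \<and> s2 vH 0 = 0"
      and fr2: "\<forall>k. k \<notin> mods bfs_start \<longrightarrow> s2 k = s1 k"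
    have adj2: "adj_state s2"
      by (rule adj_state_cong[OF adj1]) (use fr2 in \<open>auto simp: bfs_start_def\<close>)
    show "runs (While (Minus (V vTL) (V vH)) bfs_body) s2
      (\<lambda>t3 s'. t1 + (t2 + t3) \<le> 10 + 11 * n + 16 * length es \<and> (\<forall>v<n. s' vD v = Suc (d x v)))"
    proof (rule runs_While[where I = "\<lambda>r s'. bfs_inv x (s' vQ) (s' vH 0) (s' vTL 0) (s' vD) (s' vPT 0) \<and>
        r = 8 * (card (unscanned (s' vQ) (s' vH 0) (s' vPT 0)) + (n - s' vH 0))" and
        r = "8 * (card (unscanned (s2 vQ) 0 (s2 vPT 0)) + n)"], goal_cases)
      case 1
      then show ?case using t2 by auto
    next
      case (2 r s3)
      have "adj_state s3"
        by (rule adj_state_cong[OF adj2]) (use 2(2) in \<open>auto simp: bfs_body_def\<close>)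
      then have "runs bfs_body s3 (\<lambda>t s'. bfs_inv x (s' vQ) (s' vH 0) (s' vTL 0) (s' vD) (s' vPT 0) \<and>
         t + 1 + 8 * (card (unscanned (s' vQ) (s' vH 0) (s' vPT 0)) + (n - s' vH 0)) \<le> r)"
        using 2(1,3) runs_bfs_body[of s3 x] by simp
      then show ?case by (rule runs_mono) blast
    next
      case (3 r t3 s3)
      have "s3 vH 0 = s3 vTL 0" using 3(1,3) by (simp add: bfs_inv_def)
      then have "\<forall>v<n. s3 vD v = Suc (d x v)" using 3(1) bfs_final x(2) by metis
      moreover have "card (unscanned (s2 vQ) 0 (s2 vPT 0)) \<le> card HE"
        by (intro card_mono) (auto simp: unscanned_def HE_def)
      then have "t3 \<le> 8 * (2 * length es + n) + 1" using 3(4) by (simp add: HE_def)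
      ultimately show ?case using t1 t2 by simp
    qed
  qed
qed

end

subsection \<open>Pruning\<close>

definition prune_step :: com where
  "prune_step =
    (vP ::= Rd vNBS (V vCUR)) ;;
    (vBEST ::= Mx (V vBEST) (Plus (Plus (Rd vW (V vCUR)) (Rd vW (V vP))) (Num 1))) ;;
    Wr vW (V vP) (Mx (Rd vW (V vP)) (Plus (Rd vW (V vCUR)) (Num 1))) ;;
    Wr vDEG (V vCUR) (Num 0) ;;
    Wr vDEG (V vP) (Minus (Rd vDEG (V vP)) (Num 1)) ;;
    Wr vNBS (V vP) (Minus (Rd vNBS (V vP)) (V vCUR)) ;;
    (vCUR ::= V vP)"

text \<open>For truncated subtraction \<open>x - 2 * (x - 1)\<close> is 1 at \<open>x = 1\<close>
  and 0 everywhere else, which makes it a guard for equality with 1.\<close>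

abbreviation is_one :: "exp \<Rightarrow> exp" where
  "is_one e \<equiv> Minus e (Plus (Minus e (Num 1)) (Minus e (Num 1)))"

text \<open>Pruning a leaf can create a new leaf only at its neighbour, which
  \<open>prune_step\<close> makes the current vertex. A single sweep of \<open>I\<close> therefore
  finds all leaves.\<close>

definition prune_body :: com where
  "prune_body =
    If (is_one (Rd vDEG (V vCUR))) prune_step ((vI ::= Plus (V vI) (Num 1)) ;; (vCUR ::= V vI))"

definition prune_prog :: com where
  "prune_prog =
    (vBEST ::= Num 0) ;; (vI ::= Num 0) ;; (vCUR ::= Num 0) ;; While (Minus (V vN) (V vI)) prune_body"

lemma is_one_iff: "x - ((x - 1) + (x - 1)) \<noteq> 0 \<longleftrightarrow> x = (1::nat)"
  by auto

context cgraph
begin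

lemma nb_prune:
  assumes l: "l \<in> H" and p: "nb l \<inter> H = {p}" and v: "v \<in> H - {l}"
  shows "nb v \<inter> (H - {l}) = (if v = p then nb p \<inter> H - {l} else nb v \<inter> H)"
proof (cases "v = p")
  case False
  then have "l \<notin> nb v" using p v adj_sym by (auto simp: nb_def)
  then show ?thesis using False by auto
qed auto

lemma leaf_in_nb: "l \<in> H \<Longrightarrow> nb l \<inter> H = {p} \<Longrightarrow> l \<in> nb p \<inter> H \<and> p \<in> H \<and> p \<noteq> l"
proof -
  assume "l \<in> H" "nb l \<inter> H = {p}"
  moreover then have "p \<in> nb l \<inter> H" by simp
  then have "adj l p" "p \<in> H" by (auto simp: nb_def)
  ultimately show ?thesis using adj_sym adjD[of l p] by (auto simp: nb_def)
qed

lemma degree_sum_prune: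
  assumes H: "H \<subseteq> {..<n}" and l: "l \<in> H" and p: "nb l \<inter> H = {p}"
  shows "(\<Sum>v\<in>H. card (nb v \<inter> H)) = (\<Sum>v\<in>H - {l}. card (nb v \<inter> (H - {l}))) + 2"
proof -
  have fin: "finite H" using H finite_subset by blast
  note lp = leaf_in_nb[OF l p]
  have pc: "card (nb p \<inter> H) = card (nb p \<inter> H - {l}) + 1"
    using lp by (simp add: card_Diff_singleton card_gt_0_iff) (metis Int_iff card_gt_0_iff empty_iff finite_Int finite_nb Suc_pred)
  have "(\<Sum>v\<in>H. card (nb v \<inter> H)) = 1 + (\<Sum>v\<in>H - {l}. card (nb v \<inter> H))"
    using sum.remove[OF fin l, of "\<lambda>v. card (nb v \<inter> H)"] p by simp
  also have "(\<Sum>v\<in>H - {l}. card (nb v \<inter> H)) =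
      card (nb p \<inter> H) + (\<Sum>v\<in>H - {l} - {p}. card (nb v \<inter> H))"
    using fin lp by (intro sum.remove) auto
  also have "(\<Sum>v\<in>H - {l} - {p}. card (nb v \<inter> H)) = (\<Sum>v\<in>H - {l} - {p}. card (nb v \<inter> (H - {l})))"
    by (intro sum.cong) (auto simp: nb_prune[OF l p])
  also have "card (nb p \<inter> H) + \<dots> = 1 + (card (nb p \<inter> (H - {l})) + \<dots>)"
    using nb_prune[OF l p, of p] lp pc by simp
  also have "card (nb p \<inter> (H - {l})) + (\<Sum>v\<in>H - {l} - {p}. card (nb v \<inter> (H - {l}))) =
      (\<Sum>v\<in>H - {l}. card (nb v \<inter> (H - {l})))"
    using fin lp by (intro sum.remove[symmetric]) auto
  finally show ?thesis by simp
qed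

definition degrees :: "nat set \<Rightarrow> state \<Rightarrow> bool" where
  "degrees H s \<longleftrightarrow> (\<forall>v<n. s vDEG v = (if v \<in> H then card (nb v \<inter> H) else 0)) \<and>
     (\<forall>v\<in>H. s vNBS v = \<Sum> (nb v \<inter> H))"

text \<open>Up to the sweep index only the current vertex may still be a leaf. The last line
  expresses that edges minus vertices stays constant under pruning; through it the feedback edge
  number controls the degrees of the core.\<close>

definition prune_inv :: "nat set \<Rightarrow> state \<Rightarrow> bool" where
  "prune_inv H s \<longleftrightarrow> weighted_core H (s vW) (s vBEST 0) \<and> H \<noteq> {} \<and> degrees H s \<and>
     s vI 0 \<le> n \<and> (s vI 0 < n \<longrightarrow> s vCUR 0 < n) \<and>
     (\<forall>v<n. v \<le> s vI 0 \<and> v \<noteq> s vCUR 0 \<longrightarrow> s vDEG v \<noteq> 1) \<and>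
     (\<Sum>v\<in>H. card (nb v \<inter> H)) + 2 * n = 2 * length es + 2 * card H"

lemma runs_prune_step:
  assumes inv: "prune_inv H s" and i: "s vI 0 < n" and one: "s vDEG (s vCUR 0) = 1"
  shows "runs prune_step s (\<lambda>t s'. t = 7 \<and> prune_inv (H - {s vCUR 0}) s' \<and> s' vI 0 = s vI 0)"
proof -
  define l where "l = s vCUR 0"
  define p where "p = s vNBS l"
  have I: "weighted_core H (s vW) (s vBEST 0)" "degrees H s" "l < n"
    "\<And>v. v < n \<Longrightarrow> v \<le> s vI 0 \<Longrightarrow> v \<noteq> l \<Longrightarrow> s vDEG v \<noteq> 1"
    "(\<Sum>v\<in>H. card (nb v \<inter> H)) + 2 * n = 2 * length es + 2 * card H"
    using inv i by (auto simp: prune_inv_def l_def)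
  have H: "H \<subseteq> {..<n}" using I(1) by (simp add: weighted_core_def)
  have l: "l \<in> H" "card (nb l \<inter> H) = 1"
    using I(2,3) one unfolding degrees_def l_def[symmetric] by (auto split: if_splits)
  then obtain q where "nb l \<inter> H = {q}" by (auto simp: card_1_singleton_iff)
  then have p: "nb l \<inter> H = {p}" using I(2) l(1) by (simp add: degrees_def p_def)
  note lp = leaf_in_nb[OF l(1) p]
  have run: "runs prune_step s (\<lambda>t s'. t = 7 \<and> s' vI 0 = s vI 0 \<and> s' vCUR 0 = p \<and>
      s' vBEST 0 = max (s vBEST 0) (s vW l + s vW p + 1) \<and>
      s' vW = (s vW)(p := max (s vW p) (s vW l + 1)) \<and>
      s' vDEG = (s vDEG)(l := 0, p := s vDEG p - 1) \<and> s' vNBS = (s vNBS)(p := s vNBS p - l))"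
    using lp by (simp add: prune_step_def runs_Seq l_def[symmetric] p_def[symmetric])
  show ?thesis
  proof (rule runs_mono[OF run])
    fix t s'
    assume s': "t = 7 \<and> s' vI 0 = s vI 0 \<and> s' vCUR 0 = p \<and>
      s' vBEST 0 = max (s vBEST 0) (s vW l + s vW p + 1) \<and>
      s' vW = (s vW)(p := max (s vW p) (s vW l + 1)) \<and>
      s' vDEG = (s vDEG)(l := 0, p := s vDEG p - 1) \<and> s' vNBS = (s vNBS)(p := s vNBS p - l)"
    have pn: "p < n" using lp H by auto
    have pc: "card (nb p \<inter> H - {l}) = card (nb p \<inter> H) - 1" using lp by (simp add: card_Diff_singleton)
    have ps: "\<Sum> (nb p \<inter> H - {l}) = \<Sum> (nb p \<inter> H) - l"
      using lp sum.remove[of "nb p \<inter> H" l "\<lambda>v. v"] by simp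
    have "degrees (H - {l}) s'"
      using I(2) s' lp pn pc ps nb_prune[OF l(1) p] by (auto simp: degrees_def)
    moreover have "weighted_core (H - {l}) (s' vW) (s' vBEST 0)"
      using weighted_core_prune[OF I(1) l(1) p] s' by simp
    moreover have "card H = card (H - {l}) + 1"
      using l(1) H by (metis Suc_eq_plus1 card_Suc_Diff1 finite_lessThan finite_subset)
    then have "(\<Sum>v\<in>H - {l}. card (nb v \<inter> (H - {l}))) + 2 * n = 2 * length es + 2 * card (H - {l})"
      using I(5) degree_sum_prune[OF H l(1) p] by simp
    moreover have "s' vDEG v \<noteq> 1" if "v < n" "v \<le> s vI 0" "v \<noteq> p" for v
      using I(4)[of v] s' that by auto
    ultimately show "t = 7 \<and> prune_inv (H - {s vCUR 0}) s' \<and> s' vI 0 = s vI 0"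
      using s' lp pn i by (auto simp: prune_inv_def l_def[symmetric])
  qed
qed

text \<open>The degree sum is demanded of a nonempty core only, because the last vertex of a tree is
  dropped without removing an edge.\<close>

definition core :: "nat set \<Rightarrow> (nat \<Rightarrow> nat) \<Rightarrow> nat \<Rightarrow> bool" where
  "core H w b \<longleftrightarrow> weighted_core H w b \<and> (\<forall>v\<in>H. 2 \<le> card (nb v \<inter> H)) \<and>
     (H \<noteq> {} \<longrightarrow> (\<Sum>v\<in>H. card (nb v \<inter> H)) + 2 * n = 2 * length es + 2 * card H)"

text \<open>If a single vertex is left, there are no pairs and the best value is already the
  diameter. This vertex has degree 0 in the array, so the state represents the empty core as well.
  Otherwise isometry gives each vertex a core neighbour, and with leaves excluded its degree is at
  least 2.\<close>

lemma core_if_prune_inv: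
  assumes inv: "prune_inv H s" and i: "s vI 0 = n" and cur: "s vCUR 0 = n"
  shows "\<exists>H'. core H' (s vW) (s vBEST 0) \<and> degrees H' s"
proof -
  have I: "weighted_core H (s vW) (s vBEST 0)" "H \<noteq> {}" "degrees H s"
    "\<And>v. v < n \<Longrightarrow> s vDEG v \<noteq> 1"
    "(\<Sum>v\<in>H. card (nb v \<inter> H)) + 2 * n = 2 * length es + 2 * card H"
    using inv i cur by (auto simp: prune_inv_def)
  have H: "H \<subseteq> {..<n}" "isom H" using I(1) by (auto simp: weighted_core_def)
  show ?thesis
  proof (cases "\<exists>v. H = {v}")
    case True
    then obtain v where v: "H = {v}" by blast
    have "core {} (s vW) (s vBEST 0)" using I(1) v by (auto simp: core_def weighted_core_def isom_def)
    moreover have "nb v \<inter> H = {}" using v adjD by (auto simp: nb_def)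
    then have "degrees {} s" using I(3) v by (auto simp: degrees_def)
    ultimately show ?thesis by blast
  next
    case False
    have "2 \<le> card (nb v \<inter> H)" if v: "v \<in> H" for v
    proof -
      obtain u where "u \<in> H" "u \<noteq> v" using False v by blast
      then obtain h where "h \<in> H" "adj v h" using H(2) v unfolding isom_def by metis
      then have "h \<in> nb v \<inter> H" by (simp add: nb_def)
      then have "card (nb v \<inter> H) \<noteq> 0" by (auto simp: card_eq_0_iff)
      moreover have "card (nb v \<inter> H) \<noteq> 1" using I(3) I(4)[of v] v H(1) by (auto simp: degrees_def)
      ultimately show ?thesis by linarith
    qed
    then have "core H (s vW) (s vBEST 0)" using I(1,5) by (simp add: core_def)
    then show ?thesis using I(3) by blast
  qed
qed

lemma runs_prune_prog:
  assumes N: "s vN 0 = n" and W: "\<forall>v<n. s vW v = 0"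
    and D: "\<forall>v<n. s vDEG v = card (nb v) \<and> s vNBS v = \<Sum> (nb v)"
  shows "runs prune_prog s (\<lambda>t s'. t \<le> 4 + 20 * n \<and> (\<exists>H. core H (s' vW) (s' vBEST 0) \<and> degrees H s'))"
proof -
  have sub: "nb v \<inter> {..<n} = nb v" for v using adjD by (auto simp: nb_def)
  let ?s = "s(vBEST := (s vBEST)(0 := 0), vI := (s vI)(0 := 0), vCUR := (s vCUR)(0 := 0))"
  have "weighted_core {..<n} (s vW) 0"
    by (rule weighted_core_cong[OF weighted_core_init]) (use W in auto)
  then have init: "prune_inv {..<n} ?s"
    using D n_pos sum_card_nb by (auto simp: prune_inv_def degrees_def sub lessThan_empty_iff)
  have "runs (While (Minus (V vN) (V vI)) prune_body) ?s
    (\<lambda>t s'. t \<le> 1 + 20 * n \<and> (\<exists>H. core H (s' vW) (s' vBEST 0) \<and> degrees H s'))"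
  \<comment> \<open>Each round either advances the sweep index or removes a vertex from
    \<open>H\<close>; the potential charges 10 for either.\<close>
  proof (rule runs_While[where I = "\<lambda>r s'. (\<exists>H. prune_inv H s' \<and> r = 10 * (n - s' vI 0 + card H)) \<and>
      (s' vI 0 = n \<longrightarrow> s' vCUR 0 = n)" and r = "20 * n"], goal_cases)
    case 1
    show ?case using init n_pos by (auto intro!: exI[of _ "{..<n}"])
  next
    case (2 r1 s1)
    then obtain H where H: "prune_inv H s1" "r1 = 10 * (n - s1 vI 0 + card H)" by blast
    have N1: "s1 vN 0 = n" using 2(2) N by (simp add: prune_body_def prune_step_def)
    then have i: "s1 vI 0 < n" using 2(3) by simp
    show ?case
    proof (cases "s1 vDEG (s1 vCUR 0) = 1")
      case True
      have "s1 vCUR 0 \<in> H" using H(1) i True by (auto simp: prune_inv_def degrees_def split: if_splits)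
      moreover have "finite H"
        using H(1) finite_subset by (auto simp: prune_inv_def weighted_core_def)
      ultimately have "card H = card (H - {s1 vCUR 0}) + 1"
        by (metis Suc_eq_plus1 card_Suc_Diff1)
      then have r: "9 + 10 * (n - s1 vI 0 + card (H - {s1 vCUR 0})) \<le> r1" using H(2) by simp
      have "runs prune_step s1 (\<lambda>t s2. \<exists>r2. ((\<exists>H. prune_inv H s2 \<and> r2 = 10 * (n - s2 vI 0 + card H)) \<and>
          (s2 vI 0 = n \<longrightarrow> s2 vCUR 0 = n)) \<and> t + 2 + r2 \<le> r1)"
      proof (rule runs_mono[OF runs_prune_step[OF H(1) i True]], goal_cases)
        case (1 t s2)
        then show ?case using r i
          by (intro exI[of _ "10 * (n - s2 vI 0 + card (H - {s1 vCUR 0}))"]) auto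
      qed
      then show ?thesis using True by (simp add: prune_body_def)
    next
      case False
      let ?s2 = "s1(vI := (s1 vI)(0 := Suc (s1 vI 0)), vCUR := (s1 vCUR)(0 := Suc (s1 vI 0)))"
      have "prune_inv H ?s2"
        using H(1) i False by (auto simp: prune_inv_def degrees_def le_Suc_eq)
      then have "\<exists>r2. ((\<exists>H. prune_inv H ?s2 \<and> r2 = 10 * (n - ?s2 vI 0 + card H)) \<and>
          (?s2 vI 0 = n \<longrightarrow> ?s2 vCUR 0 = n)) \<and> Suc (Suc (Suc (Suc r2))) \<le> r1"
        using H(2) i by (intro exI[of _ "10 * (n - Suc (s1 vI 0) + card H)"]) auto
      then show ?thesis using False is_one_iff[of "s1 vDEG (s1 vCUR 0)"]
        by (simp add: prune_body_def runs_Seq)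
    qed
  next
    case (3 r1 t s1)
    have N1: "s1 vN 0 = n" using 3(2) N by (simp add: prune_body_def prune_step_def)
    obtain H where H: "prune_inv H s1" using 3(1) by blast
    then have "s1 vI 0 = n" using 3(3) N1 by (simp add: prune_inv_def)
    then show ?case using core_if_prune_inv[OF H] 3(1,4) by auto
  qed
  then show ?thesis by (simp add: prune_prog_def runs_Seq)
qed

end

subsection \<open>Scanning from single vertices\<close>

text \<open>The first core vertex is made special as well, so that a core that is a cycle has a special vertex.\<close>

definition spec_prog :: com where
  "spec_prog =
    (vFL ::= Num 1) ;;
    for_loop vI vN
      (If (Rd vDEG (V vI))
         (If (Plus (V vFL) (Minus (Rd vDEG (V vI)) (Num 2)))
            (Wr vSPEC (V vI) (Num 1) ;; (vFL ::= Num 0)) Skip) Skip)"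

abbreviation neq :: "exp \<Rightarrow> exp \<Rightarrow> exp" where
  "neq a b \<equiv> Plus (Minus a b) (Minus b a)"

text \<open>Subtracting 1 undoes the shift of the search labels. The source itself is skipped, as a
  pair of equal vertices would count its weight twice.\<close>

definition scan_prog :: com where
  "scan_prog =
    bfs_prog ;;
    for_loop vJ vN
      (If (Rd vDEG (V vJ))
        (If (neq (V vJ) (V vSRC))
          (vBEST ::= Mx (V vBEST)
            (Minus (Plus (Plus (Rd vW (V vJ)) (Rd vW (V vSRC))) (Rd vD (V vJ))) (Num 1)))
          Skip) Skip)"

definition scan_specials :: com where
  "scan_specials = for_loop vI vN (If (Rd vSPEC (V vI)) ((vSRC ::= V vI) ;; scan_prog) Skip)"

text \<open>\<open>w\<close> and \<open>b0\<close> are the contents of \<open>W\<close> and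
  \<open>BEST\<close> at the end of pruning. From then on the weights stay fixed, while the best
  value keeps growing from \<open>b0\<close>.\<close>

locale pruned = cgraph +
  fixes H :: "nat set" and w :: "nat \<Rightarrow> nat" and b0 k :: nat
  assumes core: "core H w b0" and k: "length es + 1 \<le> n + k"
begin

abbreviation dg :: "nat \<Rightarrow> nat" where "dg v \<equiv> card (nb v \<inter> H)"

lemma H_sub: "H \<subseteq> {..<n}" and isom_H: "isom H" and b0_le: "b0 \<le> diam"
  and w_le: "u \<in> H \<Longrightarrow> w u \<le> diam"
  and W_le: "u \<in> H \<Longrightarrow> v \<in> H \<Longrightarrow> u \<noteq> v \<Longrightarrow> w u + w v + d u v \<le> diam"
  and dg_ge: "v \<in> H \<Longrightarrow> 2 \<le> dg v"
  using core by (auto simp: core_def weighted_core_def)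

lemma H_lt: "v \<in> H \<Longrightarrow> v < n"
  using H_sub by auto

lemma finite_H: "finite H"
  using H_sub finite_subset by blast

text \<open>Progress is measured by settled vertices: once every core vertex is covered, the best
  value is an upper bound for the diameter.\<close>

definition covered :: "nat \<Rightarrow> nat \<Rightarrow> bool" where
  "covered b x \<longleftrightarrow> (\<forall>u\<in>H. u \<noteq> x \<longrightarrow> w u + w x + d u x \<le> b)"

lemma covered_mono: "covered b x \<Longrightarrow> b \<le> b' \<Longrightarrow> covered b' x"
  by (force simp: covered_def)

lemma diam_eq_if_covered:
  assumes "b0 \<le> b" "b \<le> diam" "\<forall>x\<in>H. covered b x"
  shows "b = diam"
proof (rule le_antisym)
  have "\<forall>x. b0 \<le> x \<longrightarrow> (\<forall>u\<in>H. \<forall>v\<in>H. u \<noteq> v \<longrightarrow> w u + w v + d u v \<le> x) \<longrightarrow> diam \<le> x"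
    using core unfolding core_def weighted_core_def by (elim conjE)
  moreover have "\<forall>u\<in>H. \<forall>v\<in>H. u \<noteq> v \<longrightarrow> w u + w v + d u v \<le> b"
    using assms(3) unfolding covered_def by simp
  ultimately show "diam \<le> b" using assms(1) by simp
qed (rule assms)

definition core_state :: "state \<Rightarrow> bool" where
  "core_state s \<longleftrightarrow> adj_state s \<and> degrees H s \<and> (\<forall>v\<in>H. s vW v = w v)"

lemma core_state_cong:
  assumes "core_state s"
    "\<And>v. v \<in> {vN, vE, vX, vDST, vNEXT, vHEAD, vDEG, vNBS, vW} \<Longrightarrow> s' v = s v"
  shows "core_state s'"
proof -
  have e: "s' vN = s vN" "s' vE = s vE" "s' vX = s vX" "s' vDST = s vDST" "s' vNEXT = s vNEXT"
    "s' vHEAD = s vHEAD" "s' vDEG = s vDEG" "s' vNBS = s vNBS" "s' vW = s vW"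
    by (rule assms(2); simp)+
  have s: "adj_state s" "degrees H s" "\<forall>v\<in>H. s vW v = w v" using assms(1) by (simp_all add: core_state_def)
  have "adj_state s'" by (rule adj_state_cong[OF s(1) e(1-6)])
  then show ?thesis using s(2,3) by (simp add: core_state_def degrees_def e)
qed

lemma core_state_simps:
  assumes "core_state s"
  shows "s vN 0 = n" "v < n \<Longrightarrow> s vDEG v = 0 \<longleftrightarrow> v \<notin> H" "v \<in> H \<Longrightarrow> s vW v = w v"
    "v \<in> H \<Longrightarrow> s vDEG v = dg v"
proof -
  show "s vN 0 = n" "v \<in> H \<Longrightarrow> s vW v = w v"
    using assms by (auto simp: core_state_def adj_state_def input_state_def)
  show dg: "v \<in> H \<Longrightarrow> s vDEG v = dg v" for v
    using assms H_lt by (auto simp: core_state_def degrees_def)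
  show "v < n \<Longrightarrow> s vDEG v = 0 \<longleftrightarrow> v \<notin> H"
    using assms dg_ge[of v] by (auto simp: core_state_def degrees_def simp del: card_eq_0_iff card_0_eq)
qed

definition scan_time :: nat where
  "scan_time = 12 + 16 * n + 16 * length es"

text \<open>Soundness and monotonicity of updates as one transitive relation, so that the guarantees
  of consecutive program parts compose.\<close>

definition improves :: "nat \<Rightarrow> nat \<Rightarrow> bool" where
  "improves b b' \<longleftrightarrow> b \<le> b' \<and> (b \<le> diam \<longrightarrow> b' \<le> diam)"

lemma improves_trans: "improves a b \<Longrightarrow> improves b c \<Longrightarrow> improves a c"
  by (auto simp: improves_def)

lemma improves_refl: "improves a a"
  by (simp add: improves_def)

lemma runs_scan_prog:
  assumes st: "core_state s" and x: "s vSRC 0 = x" "x \<in> H"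
  shows "runs scan_prog s (\<lambda>t s'. t \<le> scan_time \<and> (\<forall>v<n. s' vD v = Suc (d x v)) \<and>
    improves (s vBEST 0) (s' vBEST 0) \<and> covered (s' vBEST 0) x)"
  unfolding scan_prog_def
proof (rule runs_SeqI)
  show "runs bfs_prog s (\<lambda>t s'. t \<le> 10 + 11 * n + 16 * length es \<and> (\<forall>v<n. s' vD v = Suc (d x v)))"
    using st x H_lt by (intro runs_bfs_prog) (auto simp: core_state_def)
next
  fix t1 s1 assume t1: "t1 \<le> 10 + 11 * n + 16 * length es \<and> (\<forall>v<n. s1 vD v = Suc (d x v))"
    and fr: "\<forall>k. k \<notin> mods bfs_prog \<longrightarrow> s1 k = s k"
  have fr': "s1 k = s k" if "k \<notin> {vJ, vD, vQ, vH, vTL, vPT, vY}" for k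
    using fr that by (auto simp: bfs_prog_def bfs_start_def bfs_body_def)
  have st1: "core_state s1" by (rule core_state_cong[OF st]) (auto simp: fr')
  have x1: "s1 vSRC 0 = x" using fr' x by simp
  have b1: "s1 vBEST 0 = s vBEST 0" using fr' by simp
  note S = core_state_simps[OF st1]
  show "runs (for_loop vJ vN
      (If (Rd vDEG (V vJ))
        (If (neq (V vJ) (V vSRC))
          (vBEST ::= Mx (V vBEST)
            (Minus (Plus (Plus (Rd vW (V vJ)) (Rd vW (V vSRC))) (Rd vD (V vJ))) (Num 1)))
          Skip) Skip)) s1
     (\<lambda>t2 s'. t1 + t2 \<le> scan_time \<and> (\<forall>v<n. s' vD v = Suc (d x v)) \<and>
       improves (s vBEST 0) (s' vBEST 0) \<and> covered (s' vBEST 0) x)"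
  proof (rule runs_for_loop[where N = n and T = "\<lambda>_. 3" and P = "\<lambda>j s'. improves (s vBEST 0) (s' vBEST 0) \<and>
      (\<forall>u\<in>H. u < j \<and> u \<noteq> x \<longrightarrow> w u + w x + d u x \<le> s' vBEST 0)"], goal_cases)
    case 5
    then show ?case using b1 by (simp add: improves_refl)
  next
    case (6 j s2)
    have e: "s2 vDEG = s1 vDEG" "s2 vW = s1 vW" "s2 vD = s1 vD" "s2 vSRC = s1 vSRC" using 6(4) by auto
    have deg: "s2 vDEG j = 0 \<longleftrightarrow> j \<notin> H" using S(2)[OF 6(1)] e by simp
    show ?case
    proof (cases "j \<in> H \<and> j \<noteq> x")
      case True
      then have jx: "j - x + (x - j) \<noteq> 0" by simp
      have sym: "d x j = d j x" using d_sym H_lt 6(1) x(2) by simp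
      have val: "s2 vW j + s2 vW (s2 vSRC 0) + s2 vD j - 1 = w j + w x + d j x"
        using e x1 S(3) True x(2) t1 6(1) sym by simp
      have le: "w j + w x + d j x \<le> diam" using W_le True x(2) by simp
      have run: "runs (If (Rd vDEG (V vJ)) (If (neq (V vJ) (V vSRC))
          (vBEST ::= Mx (V vBEST)
            (Minus (Plus (Plus (Rd vW (V vJ)) (Rd vW (V vSRC))) (Rd vD (V vJ))) (Num 1)))
          Skip) Skip) s2 (\<lambda>t s3. t = 3 \<and> s3 vBEST 0 = max (s2 vBEST 0) (w j + w x + d j x))"
        using deg True 6(3) e(4) x1 val by simp
      show ?thesis
        by (rule runs_mono[OF run]) (use 6(2) le in \<open>auto simp: improves_def less_Suc_eq\<close>)
    next
      case False
      then show ?thesis using 6(2,3) deg e(4) x1 by (auto simp: less_Suc_eq)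
    qed
  next
    case (7 t s2)
    then have "covered (s2 vBEST 0) x" using H_lt by (auto simp: covered_def)
    then show ?case using 7 t1 by (auto simp: scan_time_def)
  qed (use S x1 in auto)
qed

subsection \<open>Special vertices\<close>

definition specials :: "nat set \<Rightarrow> state \<Rightarrow> bool" where
  "specials SP s \<longleftrightarrow> SP \<subseteq> H \<and> (H \<noteq> {} \<longrightarrow> SP \<noteq> {}) \<and> (\<forall>v\<in>H - SP. dg v = 2) \<and>
     (\<Sum>v\<in>SP. dg v) \<le> 6 * k \<and> (\<forall>v<n. s vSPEC v \<noteq> 0 \<longleftrightarrow> v \<in> SP)"

text \<open>The core has \<open>(\<Sum>v\<in>H. dg v - 2) + 2 \<le> 2 * k\<close>. A degree of at
  least 3 is at most three times its excess over 2, and the extra vertex \<open>x\<close> adds at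
  most 2, which gives \<open>3 * (2 * k - 2) + 2\<close>.\<close>

lemma special_degree_sum:
  assumes x: "x \<in> H" and SP: "SP = {v \<in> H. v = x \<or> 3 \<le> dg v}"
  shows "(\<Sum>v\<in>SP. dg v) \<le> 6 * k"
proof -
  have "(\<Sum>v\<in>H. dg v) + 2 * n = 2 * length es + 2 * card H" using core x by (auto simp: core_def)
  moreover have "(\<Sum>v\<in>H. dg v) = (\<Sum>v\<in>H. (dg v - 2) + 2)"
    using dg_ge by (intro sum.cong[OF refl]) (metis le_add_diff_inverse2)
  moreover have "(\<Sum>v\<in>H. (dg v - 2) + 2) = (\<Sum>v\<in>H. dg v - 2) + 2 * card H"
    by (simp only: sum.distrib) simp
  ultimately have 1: "(\<Sum>v\<in>H. dg v - 2) + 2 \<le> 2 * k" using k by simp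
  have "(\<Sum>v\<in>SP. dg v) \<le> (\<Sum>v\<in>SP. 3 * (dg v - 2) + (if v = x then 2 else 0))"
  proof (rule sum_mono)
    fix v assume "v \<in> SP"
    then show "dg v \<le> 3 * (dg v - 2) + (if v = x then 2 else 0)"
      using SP dg_ge[of v] by auto
  qed
  also have "\<dots> \<le> (\<Sum>v\<in>H. 3 * (dg v - 2) + (if v = x then 2 else 0))"
    using SP finite_H by (intro sum_mono2) auto
  also have "\<dots> = 3 * (\<Sum>v\<in>H. dg v - 2) + 2"
    using x finite_H by (simp add: sum.distrib sum_distrib_left)
  finally show ?thesis using 1 by simp
qed

lemma runs_spec_prog:
  assumes st: "core_state s" and sp: "\<forall>v<n. s vSPEC v = 0"
  shows "runs spec_prog s (\<lambda>t s'. t \<le> 3 + 6 * n \<and> (\<exists>SP. specials SP s'))"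
proof -
  let ?s = "s(vFL := (s vFL)(0 := 1))"
  note S = core_state_simps[OF st]
  \<comment> \<open>The flag stays nonzero until the first core vertex is met; that vertex is the
    witness \<open>x\<close> from then on.\<close>
  define P where "P = (\<lambda>j (s' :: state). (s' vFL 0 \<noteq> 0 \<and> (\<forall>v<n. s' vSPEC v = 0) \<and> (\<forall>v<j. v \<notin> H)) \<or>
     (s' vFL 0 = 0 \<and> (\<exists>x\<in>H. x < j \<and> (\<forall>v<n. s' vSPEC v \<noteq> 0 \<longleftrightarrow> v < j \<and> v \<in> H \<and> (v = x \<or> 3 \<le> dg v)))))"
  have "runs (for_loop vI vN
      (If (Rd vDEG (V vI))
         (If (Plus (V vFL) (Minus (Rd vDEG (V vI)) (Num 2)))
            (Wr vSPEC (V vI) (Num 1) ;; (vFL ::= Num 0)) Skip) Skip)) ?s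
      (\<lambda>t s'. t \<le> 2 + 6 * n \<and> (\<exists>SP. specials SP s'))"
  proof (rule runs_for_loop[where N = n and T = "\<lambda>_. 4" and P = P], goal_cases)
    case 5
    then show ?case using sp by (simp add: P_def)
  next
    case (6 j s1)
    have e: "s1 vDEG = s vDEG" using 6(4) by auto
    show ?case
    proof (cases "j \<in> H")
      case False
      then have "P (Suc j) (s1(vI := (s1 vI)(0 := Suc j)))"
        using 6(2) by (auto simp: P_def less_Suc_eq)
      then show ?thesis using 6(1,3) e S(2) False by simp
    next
      case True
      then have deg: "s1 vDEG j = dg j" "s1 vDEG j \<noteq> 0" using e S(2)[OF 6(1)] S(4) by auto
      show ?thesis
      proof (cases "s1 vFL 0 + (s1 vDEG j - 2) = 0")
        case True
        then have fl: "s1 vFL 0 = 0" "\<not> 3 \<le> dg j" using deg by auto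
        then obtain x where x: "x \<in> H" "x < j"
          "\<forall>v<n. s1 vSPEC v \<noteq> 0 \<longleftrightarrow> v < j \<and> v \<in> H \<and> (v = x \<or> 3 \<le> dg v)" using 6(2) by (auto simp: P_def)
        have "\<forall>v<n. s1 vSPEC v \<noteq> 0 \<longleftrightarrow> v < Suc j \<and> v \<in> H \<and> (v = x \<or> 3 \<le> dg v)"
          using x fl by (metis less_Suc_eq less_irrefl)
        then have "P (Suc j) (s1(vI := (s1 vI)(0 := Suc j)))"
          using fl x by (auto simp: P_def intro!: bexI[of _ x])
        then show ?thesis using 6(3) deg True by simp
      next
        case False
        let ?s2 = "s1(vSPEC := (s1 vSPEC)(j := 1), vFL := (s1 vFL)(0 := 0), vI := (s1 vI)(0 := Suc j))"
        have "P (Suc j) ?s2"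
        proof (cases "s1 vFL 0 = 0")
          case True
          then obtain x where x: "x \<in> H" "x < j"
            "\<forall>v<n. s1 vSPEC v \<noteq> 0 \<longleftrightarrow> v < j \<and> v \<in> H \<and> (v = x \<or> 3 \<le> dg v)" using 6(2) by (auto simp: P_def)
          have "3 \<le> dg j" using False True deg by simp
          then have "\<forall>v<n. ?s2 vSPEC v \<noteq> 0 \<longleftrightarrow> v < Suc j \<and> v \<in> H \<and> (v = x \<or> 3 \<le> dg v)"
            using x \<open>j \<in> H\<close> by (auto simp: less_Suc_eq)
          then show ?thesis using x by (auto simp: P_def intro!: bexI[of _ x])
        next
          case fl: False
          then have "\<forall>v<n. s1 vSPEC v = 0" "\<forall>v<j. v \<notin> H" using 6(2) by (auto simp: P_def)
          then have "\<forall>v<n. ?s2 vSPEC v \<noteq> 0 \<longleftrightarrow> v < Suc j \<and> v \<in> H \<and> (v = j \<or> 3 \<le> dg v)"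
            using \<open>j \<in> H\<close> by (auto simp: less_Suc_eq)
          then show ?thesis using \<open>j \<in> H\<close> by (auto simp: P_def intro!: bexI[of _ j])
        qed
        moreover have "runs (If (Rd vDEG (V vI))
         (If (Plus (V vFL) (Minus (Rd vDEG (V vI)) (Num 2)))
            (Wr vSPEC (V vI) (Num 1) ;; (vFL ::= Num 0)) Skip) Skip) s1
            (\<lambda>t s2. t = 4 \<and> s2 = s1(vSPEC := (s1 vSPEC)(j := 1), vFL := (s1 vFL)(0 := 0)))"
          using False deg 6(3) by (auto simp: runs_Seq)
        ultimately show ?thesis by - (erule runs_mono, auto)
      qed
    qed
  next
    case (7 t s1)
    have "\<exists>SP. specials SP s1"
    proof (cases "s1 vFL 0 = 0")
      case True
      then obtain x where x: "x \<in> H"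
        "\<forall>v<n. s1 vSPEC v \<noteq> 0 \<longleftrightarrow> v \<in> H \<and> (v = x \<or> 3 \<le> dg v)" using 7(1) by (auto simp: P_def)
      let ?SP = "{v \<in> H. v = x \<or> 3 \<le> dg v}"
      have "specials ?SP s1"
        using x special_degree_sum[OF x(1) refl] dg_ge by (fastforce simp: specials_def)
      then show ?thesis by blast
    next
      case False
      then have "specials {} s1" using 7(1) H_sub by (auto simp: P_def specials_def)
      then show ?thesis by blast
    qed
    then show ?case using 7(3) by simp
  qed (use S in auto)
  then have "runs (for_loop vI vN
      (If (Rd vDEG (V vI))
         (If (Plus (V vFL) (Minus (Rd vDEG (V vI)) (Num 2)))
            (Wr vSPEC (V vI) (Num 1) ;; (vFL ::= Num 0)) Skip) Skip)) ?s
      (\<lambda>t s'. 1 + t \<le> 3 + 6 * n \<and> (\<exists>SP. specials SP s'))"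
    by (rule runs_mono) auto
  then show ?thesis unfolding spec_prog_def runs_Seq runs_Wr ev.simps .
qed

lemma specials_card: "specials SP s \<Longrightarrow> card SP \<le> min n (6 * k)"
proof -
  assume sp: "specials SP s"
  then have n: "card SP \<le> card {..<n}" using H_sub by (intro card_mono) (auto simp: specials_def)
  have "card SP = (\<Sum>v\<in>SP. 1)" by simp
  also have "\<dots> \<le> (\<Sum>v\<in>SP. dg v)"
    using sp dg_ge by (intro sum_mono) (force simp: specials_def)
  finally have "card SP \<le> 6 * k" using sp unfolding specials_def by linarith
  then show ?thesis using n by simp
qed

lemma runs_scan_specials:
  assumes st: "core_state s" and sp: "specials SP s"
  shows "runs scan_specials s (\<lambda>t s'. t \<le> 2 + 3 * n + card SP * (scan_time + 1) \<and>
    improves (s vBEST 0) (s' vBEST 0) \<and> (\<forall>x\<in>SP. covered (s' vBEST 0) x))"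
  unfolding scan_specials_def
\<comment> \<open>The cost of a round depends on whether its vertex is special, so the sum contains
  \<open>scan_time\<close> only \<open>card SP\<close> times.\<close>
proof (rule runs_for_loop[where N = n and T = "\<lambda>j. 1 + (if j \<in> SP then scan_time + 1 else 0)" and
    P = "\<lambda>j s'. improves (s vBEST 0) (s' vBEST 0) \<and> (\<forall>x\<in>SP. x < j \<longrightarrow> covered (s' vBEST 0) x)"], goal_cases)
  case 1 then show ?case by (auto simp: scan_prog_def bfs_prog_def bfs_start_def bfs_body_def)
next
  case 2 then show ?case by (auto simp: scan_prog_def bfs_prog_def bfs_start_def bfs_body_def)
next
  case 4 then show ?case using core_state_simps[OF st] by simp
next
  case 5 then show ?case by (simp add: improves_refl)
next
  case (6 j s1)
  have fr: "s1 k = s k" if "k \<notin> {vI, vSRC, vJ, vD, vQ, vH, vTL, vPT, vY, vBEST}" for k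
    using 6(4) that by (auto simp: scan_prog_def bfs_prog_def bfs_start_def bfs_body_def)
  have spj: "s1 vSPEC j \<noteq> 0 \<longleftrightarrow> j \<in> SP" using sp 6(1) fr by (auto simp: specials_def)
  show ?case
  proof (cases "j \<in> SP")
    case False
    then show ?thesis using spj 6(2,3) by (auto simp: less_Suc_eq)
  next
    case True
    let ?s1 = "s1(vSRC := (s1 vSRC)(0 := j))"
    have "core_state ?s1" by (rule core_state_cong[OF st]) (auto simp: fr)
    moreover have "j \<in> H" using True sp by (auto simp: specials_def)
    ultimately have run: "runs scan_prog ?s1 (\<lambda>t s'. t \<le> scan_time \<and> (\<forall>v<n. s' vD v = Suc (d j v)) \<and>
        improves (?s1 vBEST 0) (s' vBEST 0) \<and> covered (s' vBEST 0) j)"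
      by (intro runs_scan_prog) auto
    have "runs scan_prog ?s1 (\<lambda>t s2. Suc (Suc t) \<le> 1 + (scan_time + 1) \<and>
        improves (s vBEST 0) (s2 vBEST 0) \<and> (\<forall>x\<in>SP. x < Suc j \<longrightarrow> covered (s2 vBEST 0) x))"
    proof (rule runs_mono[OF run])
      fix t s2 assume a: "t \<le> scan_time \<and> (\<forall>v<n. s2 vD v = Suc (d j v)) \<and>
        improves (?s1 vBEST 0) (s2 vBEST 0) \<and> covered (s2 vBEST 0) j"
      then have i: "improves (s1 vBEST 0) (s2 vBEST 0)" by simp
      then have "improves (s vBEST 0) (s2 vBEST 0)" using 6(2) improves_trans by blast
      moreover have "\<forall>x\<in>SP. x < Suc j \<longrightarrow> covered (s2 vBEST 0) x"
        using 6(2) a i covered_mono unfolding improves_def less_Suc_eq by blast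
      ultimately show "Suc (Suc t) \<le> 1 + (scan_time + 1) \<and>
        improves (s vBEST 0) (s2 vBEST 0) \<and> (\<forall>x\<in>SP. x < Suc j \<longrightarrow> covered (s2 vBEST 0) x)"
        using a by simp
    qed
    then show ?thesis using True spj 6(3) by (simp add: runs_Seq)
  qed
next
  case (7 t s1)
  have SP: "SP \<subseteq> {..<n}" using sp H_sub by (auto simp: specials_def)
  have "(\<Sum>j<n. 1 + (if j \<in> SP then scan_time + 1 else 0) + 2) =
      (\<Sum>j<n. 3 + (if j \<in> SP then scan_time + 1 else 0))"
    by (intro sum.cong) auto
  also have "\<dots> = 3 * n + (\<Sum>j<n. if j \<in> SP then scan_time + 1 else 0)"
    by (simp only: sum.distrib) simp
  also have "(\<Sum>j<n. if j \<in> SP then scan_time + 1 else 0) = (\<Sum>j\<in>SP. scan_time + 1)"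
    using SP by (intro sum.mono_neutral_cong_right) auto
  finally have "t \<le> 2 + 3 * n + card SP * (scan_time + 1)" using 7(3) by simp
  then show ?case using 7(1) SP by auto
qed auto

end

subsection \<open>Half chains\<close>

text \<open>\<open>PRE\<close> and \<open>SUF\<close> are indexed by twice the position on the chain, because the threshold is half of the
  computed number \<open>T\<close> and the machine cannot halve. \<open>FOLD\<close> is the maximal weighted distance from the
  current position to the earlier inner vertices.\<close>

definition fold_init :: com where
  "fold_init =
    (vLEN ::= Minus (V vHI) (V vLO)) ;; (vVAL ::= Num 0) ;; (vFOLD ::= Num 0) ;;
    Wr vPRE (Num 0) (Num 0) ;; Wr vPRE (Num 1) (Num 0) ;; (vJ ::= Num 1)"

definition fold_body :: com where
  "fold_body =
    (vU ::= Rd vCH (Plus (V vLO) (V vJ))) ;;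
    (vVAL ::= Mx (V vVAL) (Plus (V vJ) (Rd vW (V vU)))) ;;
    Wr vPRE (Plus (V vJ) (V vJ)) (V vVAL) ;;
    Wr vPRE (Plus (Plus (V vJ) (V vJ)) (Num 1)) (V vVAL) ;;
    (vBEST ::= Mx (V vBEST) (Plus (V vFOLD) (Rd vW (V vU)))) ;;
    (vFOLD ::= Plus (Mx (V vFOLD) (Rd vW (V vU))) (Num 1)) ;;
    Wr vSEG (V vU) (Num 1) ;;
    (vJ ::= Plus (V vJ) (Num 1))"

definition suffix_init :: com where
  "suffix_init =
    Wr vPRE (Plus (V vLEN) (V vLEN)) (V vVAL) ;;
    (vVAL ::= Num 0) ;; Wr vSUF (Plus (V vLEN) (V vLEN)) (Num 0) ;; (vJ ::= V vLEN)"

definition suffix_body :: com where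
  "suffix_body =
    (vJ ::= Minus (V vJ) (Num 1)) ;;
    Wr vSUF (Plus (Plus (V vJ) (V vJ)) (Num 1)) (V vVAL) ;;
    Wr vSUF (Plus (V vJ) (V vJ)) (V vVAL) ;;
    (vVAL ::= Mx (V vVAL)
      (Plus (Minus (V vLEN) (V vJ)) (Rd vW (Rd vCH (Plus (V vLO) (V vJ))))))"

text \<open>With distances \<open>a\<close> and \<open>b\<close> from a vertex to the lower and
  upper end, position \<open>j\<close> is reached through the lower end iff
  \<open>a + j \<le> b + (len - j)\<close>, that is, iff \<open>2 * j\<close> is at most
  \<open>len + b - a\<close>. The label shifts cancel in this threshold but not in the candidates,
  where 1 is subtracted. Inner vertices of the half are skipped, and their marks in
  \<open>SEG\<close> are reset in passing.\<close>

definition outside_body :: com where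
  "outside_body =
    If (Rd vDEG (V vJ))
      (If (Rd vSEG (V vJ))
        (Wr vSEG (V vJ) (Num 0))
        ((vT ::= Minus (Plus (V vLEN) (Rd vD (V vJ))) (Rd vDL (V vJ))) ;;
         (vBEST ::= Mx (V vBEST)
            (Minus (Plus (Plus (Rd vW (V vJ)) (Rd vDL (V vJ))) (Rd vPRE (V vT))) (Num 1))) ;;
         (vBEST ::= Mx (V vBEST)
            (Minus (Plus (Plus (Rd vW (V vJ)) (Rd vD (V vJ))) (Rd vSUF (V vT))) (Num 1)))))
      Skip"

definition ends_prog :: com where
  "ends_prog =
    (vSRC ::= Rd vCH (V vLO)) ;; scan_prog ;;
    for_loop vJ vN (Wr vDL (V vJ) (Rd vD (V vJ))) ;;
    (vSRC ::= Rd vCH (V vHI)) ;; scan_prog"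

definition seg_prog :: com where
  "seg_prog =
    ends_prog ;;
    fold_init ;; While (Minus (V vLEN) (V vJ)) fold_body ;;
    suffix_init ;; While (V vJ) suffix_body ;;
    for_loop vJ vN outside_body"

text \<open>The value 0 stands for the maximum of an empty set. A nonzero value is attained, which
  is how a computed candidate is traced back to an actual vertex.\<close>

definition is_max :: "nat set \<Rightarrow> nat \<Rightarrow> bool" where
  "is_max S p \<longleftrightarrow> (\<forall>x\<in>S. x \<le> p) \<and> (p = 0 \<or> p \<in> S)"

lemma is_max_empty: "is_max {} 0"
  by (simp add: is_max_def)

lemma is_max_insert: "is_max S p \<Longrightarrow> is_max (insert a S) (max p a)"
  by (auto simp: is_max_def max_def)

lemma is_max_Suc_image: "is_max S p \<Longrightarrow> is_max (Suc ` insert a S) (Suc (max p a))"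
  by (auto simp: is_max_def max_def)

text \<open>Weighted distances to the lower end for the positions up to the threshold
  \<open>x\<close>, counted in half positions. Beyond the threshold, \<open>suffix_vals\<close>
  measures from the upper end.\<close>

definition prefix_vals :: "(nat \<Rightarrow> nat) \<Rightarrow> nat \<Rightarrow> nat \<Rightarrow> nat set" where
  "prefix_vals f len x = (\<lambda>j. j + f j) ` {j. 0 < j \<and> j < len \<and> 2 * j \<le> x}"

definition suffix_vals :: "(nat \<Rightarrow> nat) \<Rightarrow> nat \<Rightarrow> nat \<Rightarrow> nat set" where
  "suffix_vals f len x = (\<lambda>j. len - j + f j) ` {j. 0 < j \<and> j < len \<and> x < 2 * j}"

definition fold_vals :: "(nat \<Rightarrow> nat) \<Rightarrow> nat \<Rightarrow> nat set" where
  "fold_vals f J = (\<lambda>i. f i + (J - i)) ` {i. 0 < i \<and> i < J}"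

section \<open>Recurrences for the prefix, suffix and fold maxima\<close>

lemma prefix_vals_0: "x < 2 \<Longrightarrow> prefix_vals f len x = {}"
  by (auto simp: prefix_vals_def)

lemma prefix_vals_step:
  assumes "0 < J" "J < len" "x = 2 * J \<or> x = Suc (2 * J)"
  shows "prefix_vals f len x = insert (J + f J) (prefix_vals f len (2 * J - 1))"
proof -
  have "{j. 0 < j \<and> j < len \<and> 2 * j \<le> x} = insert J {j. 0 < j \<and> j < len \<and> 2 * j \<le> 2 * J - 1}"
    using assms by auto
  then show ?thesis by (simp add: prefix_vals_def)
qed

text \<open>The threshold may be as large as \<open>2 * len\<close>, one index beyond those filled
  by the forward sweep; the entry there repeats the last one.\<close>

lemma prefix_vals_end: "prefix_vals f len (2 * len) = prefix_vals f len (2 * len - 1)"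
proof -
  have "{j. 0 < j \<and> j < len \<and> 2 * j \<le> 2 * len} = {j. 0 < j \<and> j < len \<and> 2 * j \<le> 2 * len - 1}"
    by auto
  then show ?thesis by (simp add: prefix_vals_def)
qed

lemma suffix_vals_end: "2 * len - 2 \<le> x \<Longrightarrow> suffix_vals f len x = {}"
  by (auto simp: suffix_vals_def)

lemma suffix_vals_odd: "suffix_vals f len (Suc (2 * J)) = suffix_vals f len (2 * J)"
proof -
  have "{j. 0 < j \<and> j < len \<and> Suc (2 * J) < 2 * j} = {j. 0 < j \<and> j < len \<and> 2 * J < 2 * j}"
    by auto
  then show ?thesis by (simp add: suffix_vals_def)
qed

lemma suffix_vals_step:
  assumes "0 < J" "J < len"
  shows "suffix_vals f len (2 * J - 2) = insert (len - J + f J) (suffix_vals f len (2 * J))"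
proof -
  have "{j. 0 < j \<and> j < len \<and> 2 * J - 2 < 2 * j} = insert J {j. 0 < j \<and> j < len \<and> 2 * J < 2 * j}"
    using assms by auto
  then show ?thesis by (simp add: suffix_vals_def)
qed

lemma fold_vals_Suc: "0 < J \<Longrightarrow> fold_vals f (Suc J) = Suc ` insert (f J) (fold_vals f J)"
proof -
  assume "0 < J"
  then have "{i. 0 < i \<and> i < Suc J} = insert J {i. 0 < i \<and> i < J}" by auto
  then have "fold_vals f (Suc J) = insert (Suc (f J)) ((\<lambda>i. f i + (Suc J - i)) ` {i. 0 < i \<and> i < J})"
    by (simp add: fold_vals_def)
  also have "(\<lambda>i. f i + (Suc J - i)) ` {i. 0 < i \<and> i < J} = (\<lambda>i. Suc (f i + (J - i))) ` {i. 0 < i \<and> i < J}"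
    by (intro image_cong) auto
  finally show ?thesis by (simp add: fold_vals_def image_image)
qed

lemma fold_vals_1: "fold_vals f (Suc 0) = {}"
  by (auto simp: fold_vals_def)

context pruned
begin

text \<open>Making the distance along the half part of the notion lets both halves be treated by the
  same program and proof.\<close>

definition half_chain :: "(nat \<Rightarrow> nat) \<Rightarrow> nat \<Rightarrow> nat \<Rightarrow> bool" where
  "half_chain c lo hi \<longleftrightarrow> chain H c lo hi \<and>
     (\<forall>i j. lo < i \<and> i < j \<and> j < hi \<longrightarrow> d (c i) (c j) = j - i)"

lemma half_chain_len: "half_chain c lo hi \<Longrightarrow> hi - lo \<le> n + 1"
proof -
  assume h: "half_chain c lo hi"
  have "card {lo<..<hi} = card (c ` {lo<..<hi})"
    using h by (intro card_image[symmetric]) (simp add: half_chain_def chain_def)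
  moreover have "c ` {lo<..<hi} \<subseteq> H" using h by (auto simp: half_chain_def chain_def)
  then have "card (c ` {lo<..<hi}) \<le> card {..<n}" using H_sub by (intro card_mono) auto
  ultimately show ?thesis by simp
qed

section \<open>Processing one half of a chain\<close>

lemma runs_ends_prog:
  assumes st: "core_state s" and lo: "s vCH (s vLO 0) = a" "a \<in> H" and hi: "s vCH (s vHI 0) = b" "b \<in> H"
  shows "runs ends_prog s (\<lambda>t s'. t \<le> 2 * scan_time + 4 + 3 * n \<and>
    (\<forall>v<n. s' vDL v = Suc (d a v) \<and> s' vD v = Suc (d b v)) \<and>
    improves (s vBEST 0) (s' vBEST 0) \<and> covered (s' vBEST 0) a \<and> covered (s' vBEST 0) b)"
proof -
  let ?s = "s(vSRC := (s vSRC)(0 := a))"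
  have "core_state ?s" by (rule core_state_cong[OF st]) auto
  then have 1: "runs scan_prog ?s (\<lambda>t s'. t \<le> scan_time \<and> (\<forall>v<n. s' vD v = Suc (d a v)) \<and>
      improves (?s vBEST 0) (s' vBEST 0) \<and> covered (s' vBEST 0) a)"
    using lo by (intro runs_scan_prog) auto
  have "runs (scan_prog ;;
    for_loop vJ vN (Wr vDL (V vJ) (Rd vD (V vJ))) ;;
    (vSRC ::= Rd vCH (V vHI)) ;; scan_prog) ?s (\<lambda>t s'. Suc t \<le> 2 * scan_time + 4 + 3 * n \<and>
    (\<forall>v<n. s' vDL v = Suc (d a v) \<and> s' vD v = Suc (d b v)) \<and>
    improves (s vBEST 0) (s' vBEST 0) \<and> covered (s' vBEST 0) a \<and> covered (s' vBEST 0) b)"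
  proof (rule runs_SeqI[OF 1])
    fix t1 s1 assume a1: "t1 \<le> scan_time \<and> (\<forall>v<n. s1 vD v = Suc (d a v)) \<and>
      improves (?s vBEST 0) (s1 vBEST 0) \<and> covered (s1 vBEST 0) a"
      and fr: "\<forall>k. k \<notin> mods scan_prog \<longrightarrow> s1 k = ?s k"
    have fr1: "s1 k = s k" if "k \<notin> {vSRC, vJ, vD, vQ, vH, vTL, vPT, vY, vBEST}" for k
      using fr that by (auto simp: scan_prog_def bfs_prog_def bfs_start_def bfs_body_def)
    have st1: "core_state s1" by (rule core_state_cong[OF st]) (auto simp: fr1)
    have N1: "s1 vN 0 = n" using core_state_simps[OF st1] by simp
    show "runs (for_loop vJ vN (Wr vDL (V vJ) (Rd vD (V vJ))) ;; (vSRC ::= Rd vCH (V vHI)) ;; scan_prog) s1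
      (\<lambda>t2 s'. Suc (t1 + t2) \<le> 2 * scan_time + 4 + 3 * n \<and>
      (\<forall>v<n. s' vDL v = Suc (d a v) \<and> s' vD v = Suc (d b v)) \<and>
      improves (s vBEST 0) (s' vBEST 0) \<and> covered (s' vBEST 0) a \<and> covered (s' vBEST 0) b)"
    proof (rule runs_SeqI)
      show "runs (for_loop vJ vN (Wr vDL (V vJ) (Rd vD (V vJ)))) s1
         (\<lambda>t s'. t \<le> 2 + 3 * n \<and> (\<forall>v<n. s' vDL v = s1 vD v))"
        by (rule runs_for_loop[where N = n and T = "\<lambda>_. 1" and P = "\<lambda>j s'. \<forall>v<j. s' vDL v = s1 vD v"])
          (auto simp: N1 less_Suc_eq)
    next
      fix t2 s2 assume a2: "t2 \<le> 2 + 3 * n \<and> (\<forall>v<n. s2 vDL v = s1 vD v)"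
        and fr: "\<forall>k. k \<notin> mods (for_loop vJ vN (Wr vDL (V vJ) (Rd vD (V vJ)))) \<longrightarrow> s2 k = s1 k"
      have fr2: "s2 k = s1 k" if "k \<notin> {vJ, vDL}" for k using fr that by auto
      let ?s2 = "s2(vSRC := (s2 vSRC)(0 := b))"
      have "core_state ?s2" by (rule core_state_cong[OF st1]) (auto simp: fr2)
      then have 2: "runs scan_prog ?s2 (\<lambda>t s'. t \<le> scan_time \<and> (\<forall>v<n. s' vD v = Suc (d b v)) \<and>
          improves (?s2 vBEST 0) (s' vBEST 0) \<and> covered (s' vBEST 0) b)"
        using hi by (intro runs_scan_prog) auto
      have b: "s2 vCH (s2 vHI 0) = b" using hi fr1 fr2 by simp
      have "runs scan_prog ?s2
        (\<lambda>t3 s'. Suc (t1 + (t2 + Suc t3)) \<le> 2 * scan_time + 4 + 3 * n \<and>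
        (\<forall>v<n. s' vDL v = Suc (d a v) \<and> s' vD v = Suc (d b v)) \<and>
        improves (s vBEST 0) (s' vBEST 0) \<and> covered (s' vBEST 0) a \<and> covered (s' vBEST 0) b)"
      proof (rule runs_mono[OF 2])
        fix t3 s3 assume a3: "t3 \<le> scan_time \<and> (\<forall>v<n. s3 vD v = Suc (d b v)) \<and>
          improves (?s2 vBEST 0) (s3 vBEST 0) \<and> covered (s3 vBEST 0) b"
          and fr: "\<forall>k. k \<notin> mods scan_prog \<longrightarrow> s3 k = ?s2 k"
        have "s3 vDL = s2 vDL"
          using fr by (auto simp: scan_prog_def bfs_prog_def bfs_start_def bfs_body_def)
        moreover have i: "improves (s1 vBEST 0) (s3 vBEST 0)" using a3 fr2 by simp
        moreover have "improves (s vBEST 0) (s1 vBEST 0)" using a1 by simp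
        moreover have "covered (s3 vBEST 0) a"
          using a1 i covered_mono by (auto simp: improves_def)
        ultimately show "Suc (t1 + (t2 + Suc t3)) \<le> 2 * scan_time + 4 + 3 * n \<and>
          (\<forall>v<n. s3 vDL v = Suc (d a v) \<and> s3 vD v = Suc (d b v)) \<and>
          improves (s vBEST 0) (s3 vBEST 0) \<and> covered (s3 vBEST 0) a \<and> covered (s3 vBEST 0) b"
          using a1 a2 a3 improves_trans by auto
      qed
      then show "runs ((vSRC ::= Rd vCH (V vHI)) ;; scan_prog) s2
        (\<lambda>t3 s'. Suc (t1 + (t2 + t3)) \<le> 2 * scan_time + 4 + 3 * n \<and>
        (\<forall>v<n. s' vDL v = Suc (d a v) \<and> s' vD v = Suc (d b v)) \<and>
        improves (s vBEST 0) (s' vBEST 0) \<and> covered (s' vBEST 0) a \<and> covered (s' vBEST 0) b)"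
        using b by (simp add: runs_Seq)
    qed
  qed
  then show ?thesis using lo by (simp add: ends_prog_def runs_Seq)
qed

definition fold_inv :: "nat \<Rightarrow> (nat \<Rightarrow> nat) \<Rightarrow> nat \<Rightarrow> nat \<Rightarrow> nat \<Rightarrow> state \<Rightarrow> bool" where
  "fold_inv b c lo len J s \<longleftrightarrow> 1 \<le> J \<and> J \<le> len \<and>
     is_max (prefix_vals (\<lambda>j. w (c (lo + j))) len (2 * J - 1)) (s vVAL 0) \<and>
     (\<forall>x<2 * J. is_max (prefix_vals (\<lambda>j. w (c (lo + j))) len x) (s vPRE x)) \<and>
     is_max (fold_vals (\<lambda>j. w (c (lo + j))) J) (s vFOLD 0) \<and>
     improves b (s vBEST 0) \<and>
     (\<forall>i j. 0 < i \<and> i < j \<and> j < J \<longrightarrow> w (c (lo + i)) + w (c (lo + j)) + (j - i) \<le> s vBEST 0) \<and>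
     (\<forall>u<n. s vSEG u \<noteq> 0 \<longleftrightarrow> u \<in> (\<lambda>j. c (lo + j)) ` {0<..<J})"

lemma fold_inv_init:
  assumes "1 \<le> len" "s vVAL 0 = 0" "s vFOLD 0 = 0" "s vPRE 0 = 0" "s vPRE 1 = 0" "\<forall>u<n. s vSEG u = 0"
    "improves b (s vBEST 0)"
  shows "fold_inv b c lo len 1 s"
proof -
  have "is_max (prefix_vals (\<lambda>j. w (c (lo + j))) len x) (s vPRE x)" if "x < 2" for x
    using assms that by (cases x) (auto simp: prefix_vals_0 is_max_empty less_Suc_eq)
  then show ?thesis using assms
    by (auto simp: fold_inv_def prefix_vals_0 fold_vals_1 is_max_empty)
qed

lemma fold_inv_step:
  assumes inv: "fold_inv b c lo len J s" and J: "J < len" and hc: "half_chain c lo (lo + len)"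
    and u: "u = c (lo + J)"
    and s': "s' vVAL 0 = max (s vVAL 0) (J + w u)"
      "s' vPRE = (s vPRE)(2 * J := s' vVAL 0, Suc (2 * J) := s' vVAL 0)"
      "s' vBEST 0 = max (s vBEST 0) (s vFOLD 0 + w u)"
      "s' vFOLD 0 = Suc (max (s vFOLD 0) (w u))"
      "s' vSEG = (s vSEG)(u := 1)"
  shows "fold_inv b c lo len (Suc J) s'"
proof -
  let ?f = "\<lambda>j. w (c (lo + j))"
  have I: "1 \<le> J" "is_max (prefix_vals ?f len (2 * J - 1)) (s vVAL 0)"
    "\<And>x. x < 2 * J \<Longrightarrow> is_max (prefix_vals ?f len x) (s vPRE x)"
    "is_max (fold_vals ?f J) (s vFOLD 0)" "improves b (s vBEST 0)"
    "\<And>i j. 0 < i \<Longrightarrow> i < j \<Longrightarrow> j < J \<Longrightarrow> ?f i + ?f j + (j - i) \<le> s vBEST 0"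
    "\<And>u. u < n \<Longrightarrow> s vSEG u \<noteq> 0 \<longleftrightarrow> u \<in> (\<lambda>j. c (lo + j)) ` {0<..<J}"
    using inv by (auto simp: fold_inv_def)
  have v: "is_max (prefix_vals ?f len x) (s' vVAL 0)" if "x = 2 * J \<or> x = Suc (2 * J)" for x
    using prefix_vals_step[OF _ J that, of ?f] is_max_insert[OF I(2), of "J + w u"] I(1) s'(1) u by simp
  have pre: "is_max (prefix_vals ?f len x) (s' vPRE x)" if "x < 2 * Suc J" for x
  proof -
    have "x < 2 * J \<or> x = 2 * J \<or> x = Suc (2 * J)" using that by auto
    then show ?thesis using v I(3) s'(2) by auto
  qed
  have fold: "is_max (fold_vals ?f (Suc J)) (s' vFOLD 0)"
    using fold_vals_Suc[of J ?f] is_max_Suc_image[OF I(4), of "w u"] I(1) s'(4) u by simp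
  have uH: "u \<in> H" using hc J u by (auto simp: half_chain_def chain_def)
  \<comment> \<open>A nonzero fold value stems from an earlier inner vertex at distance
    \<open>J - i\<close>, hence from a genuine pair. A zero value leaves only the weight of
    \<open>u\<close>, which is at most the diameter as well.\<close>
  have "s vFOLD 0 + w u \<le> diam"
  proof (cases "s vFOLD 0 = 0")
    case True then show ?thesis using w_le uH by simp
  next
    case False
    then obtain i where i: "0 < i" "i < J" "s vFOLD 0 = ?f i + (J - i)"
      using I(4) by (auto simp: is_max_def fold_vals_def)
    have "d (c (lo + i)) u = J - i" using hc i J u unfolding half_chain_def by auto
    moreover have "c (lo + i) \<in> H" using hc i J by (auto simp: half_chain_def chain_def)
    moreover have "c (lo + i) \<noteq> u"
    proof
      assume "c (lo + i) = u"
      moreover have "inj_on c {lo<..<lo + len}" using hc by (simp add: half_chain_def chain_def)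
      ultimately have "lo + i = lo + J" using u i J inj_onD[of c "{lo<..<lo + len}" "lo + i" "lo + J"] by simp
      then show False using i by simp
    qed
    ultimately show ?thesis using W_le[of "c (lo + i)" u] uH i by simp
  qed
  then have imp: "improves b (s' vBEST 0)" using I(5) s'(3) by (auto simp: improves_def)
  have pairs: "?f i + ?f j + (j - i) \<le> s' vBEST 0" if ij: "0 < i" "i < j" "j < Suc J" for i j
  proof (cases "j = J")
    case True
    then have "?f i + (J - i) \<in> fold_vals ?f J" using ij by (auto simp: fold_vals_def)
    then have "?f i + (J - i) \<le> s vFOLD 0" using I(4) by (auto simp: is_max_def)
    then show ?thesis using s'(3) u True by simp
  next
    case False
    then show ?thesis using I(6)[of i j] ij s'(3) by simp
  qed
  have "{0<..<Suc J} = insert J {0<..<J}" using I(1) by auto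
  then have seg: "s' vSEG x \<noteq> 0 \<longleftrightarrow> x \<in> (\<lambda>j. c (lo + j)) ` {0<..<Suc J}" if "x < n" for x
    using I(7)[OF that] s'(5) u by auto
  have "2 * Suc J - 1 = Suc (2 * J)" by simp
  then show ?thesis unfolding fold_inv_def
    using J v[of "Suc (2 * J)"] pre fold imp pairs seg by auto
qed

lemma runs_fold_loop:
  assumes st: "core_state s" and hc: "half_chain c lo (lo + len)" and e: "s vCH = c" "s vLO 0 = lo"
    "s vLEN 0 = len" "s vJ 0 = 1" and inv: "fold_inv b c lo len 1 s"
  shows "runs (While (Minus (V vLEN) (V vJ)) fold_body) s
    (\<lambda>t s'. t \<le> 1 + 9 * len \<and> fold_inv b c lo len len s')"
proof (rule runs_While[where I = "\<lambda>r s'. \<exists>J. s' vJ 0 = J \<and> fold_inv b c lo len J s' \<and> r = 9 * (len - J)"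
    and r = "9 * (len - 1)"], goal_cases)
  case 1
  then show ?case using inv e by auto
next
  case (2 r s1)
  have fr: "s1 k = s k" if "k \<notin> {vU, vVAL, vPRE, vBEST, vFOLD, vSEG, vJ}" for k
    using 2(2) that by (auto simp: fold_body_def)
  obtain J where J: "s1 vJ 0 = J" "fold_inv b c lo len J s1" "r = 9 * (len - J)" using 2(1) by blast
  have lt: "J < len" using 2(3) J fr e by simp
  define u where "u = c (lo + J)"
  have uH: "u \<in> H" using hc lt by (auto simp: half_chain_def chain_def u_def)
  have Wu: "s1 vW u = w u" using fr core_state_simps(3)[OF st uH] by simp
  have run: "runs fold_body s1 (\<lambda>t s'. t = 8 \<and> s' vJ 0 = Suc J \<and> s' vVAL 0 = max (s1 vVAL 0) (J + w u) \<and>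
      s' vPRE = (s1 vPRE)(2 * J := s' vVAL 0, Suc (2 * J) := s' vVAL 0) \<and>
      s' vBEST 0 = max (s1 vBEST 0) (s1 vFOLD 0 + w u) \<and>
      s' vFOLD 0 = Suc (max (s1 vFOLD 0) (w u)) \<and> s' vSEG = (s1 vSEG)(u := 1))"
    using J(1) fr e Wu by (simp add: fold_body_def runs_Seq u_def[symmetric] mult_2)
  show ?case
  proof (rule runs_mono[OF run], goal_cases)
    case (1 t s2)
    then have "fold_inv b c lo len (Suc J) s2"
      using fold_inv_step[OF J(2) lt hc u_def, of s2] by simp
    then show ?case using 1 J lt by (intro exI[of _ "9 * (len - Suc J)"]) auto
  qed
next
  case (3 r t s1)
  have fr: "s1 k = s k" if "k \<notin> {vU, vVAL, vPRE, vBEST, vFOLD, vSEG, vJ}" for k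
    using 3(2) that by (auto simp: fold_body_def)
  obtain J where J: "s1 vJ 0 = J" "fold_inv b c lo len J s1" using 3(1) by blast
  then have "J = len" using 3(3) fr e by (simp add: fold_inv_def)
  then show ?case using J 3(4) by simp
qed

lemma runs_suffix_loop:
  assumes st: "core_state s" and hc: "half_chain c lo (lo + len)" and e: "s vCH = c" "s vLO 0 = lo"
    "s vLEN 0 = len" "s vJ 0 = len" "s vVAL 0 = 0" "s vSUF (2 * len) = 0"
  shows "runs (While (V vJ) suffix_body) s
    (\<lambda>t s'. t \<le> 1 + 5 * len \<and>
       (\<forall>x\<le>2 * len. is_max (suffix_vals (\<lambda>j. w (c (lo + j))) len x) (s' vSUF x)))"
\<comment> \<open>\<open>VAL\<close> already accounts for the positions from \<open>J\<close> on,
  which is threshold \<open>2 * J - 2\<close>. The last round also folds in position 0, an end of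
  the half; no entry is written afterwards, hence the guard \<open>0 < J\<close>.\<close>
proof (rule runs_While[where I = "\<lambda>r s'. \<exists>J\<le>len. s' vJ 0 = J \<and>
    (\<forall>x\<le>2 * len. 2 * J \<le> x \<longrightarrow> is_max (suffix_vals (\<lambda>j. w (c (lo + j))) len x) (s' vSUF x)) \<and>
    (0 < J \<longrightarrow> is_max (suffix_vals (\<lambda>j. w (c (lo + j))) len (2 * J - 2)) (s' vVAL 0)) \<and> r = 5 * J"
    and r = "5 * len"], goal_cases)
  case 1
  then show ?case using e suffix_vals_end[of len "2 * len"] suffix_vals_end[of len "2 * len - 2"]
    by (intro exI[of _ len]) (auto simp: is_max_empty le_antisym)
next
  case (2 r s1)
  let ?f = "\<lambda>j. w (c (lo + j))"
  have fr: "s1 k = s k" if "k \<notin> {vVAL, vSUF, vJ}" for k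
    using 2(2) that by (auto simp: suffix_body_def)
  obtain J where J0: "J \<le> len \<and> s1 vJ 0 = J \<and>
    (\<forall>x\<le>2 * len. 2 * J \<le> x \<longrightarrow> is_max (suffix_vals ?f len x) (s1 vSUF x)) \<and>
    (0 < J \<longrightarrow> is_max (suffix_vals ?f len (2 * J - 2)) (s1 vVAL 0)) \<and> r = 5 * J"
    using 2(1) by (elim exE)
  then have J: "J \<le> len" "s1 vJ 0 = J"
    "\<And>x. x \<le> 2 * len \<Longrightarrow> 2 * J \<le> x \<Longrightarrow> is_max (suffix_vals ?f len x) (s1 vSUF x)"
    "0 < J \<Longrightarrow> is_max (suffix_vals ?f len (2 * J - 2)) (s1 vVAL 0)" "r = 5 * J"
    by simp_all
  obtain K where K: "J = Suc K" using 2(3) J(2) by (cases J) auto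
  have M: "is_max (suffix_vals ?f len (2 * K)) (s1 vVAL 0)" using J(4) K by simp
  have uH: "c (lo + K) \<in> H" using hc J(1) K by (auto simp: half_chain_def chain_def)
  have Wu: "s1 vW (c (lo + K)) = w (c (lo + K))" using fr core_state_simps(3)[OF st uH] by simp
  have run: "runs suffix_body s1 (\<lambda>t s'. t = 4 \<and> s' vJ 0 = K \<and>
      s' vSUF = (s1 vSUF)(Suc (2 * K) := s1 vVAL 0, 2 * K := s1 vVAL 0) \<and>
      s' vVAL 0 = max (s1 vVAL 0) (len - K + w (c (lo + K))))"
    using J(2) K fr e Wu by (simp add: suffix_body_def runs_Seq mult_2)
  show ?case
  proof (rule runs_mono[OF run], goal_cases)
    case (1 t s2)
    have "is_max (suffix_vals ?f len x) (s2 vSUF x)" if "x \<le> 2 * len" "2 * K \<le> x" for x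
    proof -
      have "x = 2 * K \<or> x = Suc (2 * K) \<or> 2 * J \<le> x" using that K by auto
      then show ?thesis using 1 M suffix_vals_odd[of ?f len K] J(3)[OF that(1)] K by auto
    qed
    moreover have "is_max (suffix_vals ?f len (2 * K - 2)) (s2 vVAL 0)" if "0 < K"
      using suffix_vals_step[OF that, of len ?f] is_max_insert[OF M, of "len - K + w (c (lo + K))"] 1 J(1) K
      by simp
    ultimately show ?case using 1 J(1,5) K
      by - (rule exI[of _ "5 * K"], rule conjI, rule exI[of _ K], auto)
  qed
next
  case (3 r t s1)
  then show ?case by auto
qed

lemma runs_outside_loop:
  assumes st: "core_state s" and hc: "half_chain c lo (lo + len)" and len: "s vLEN 0 = len"
    and D: "\<forall>v<n. s vDL v = Suc (d (c lo) v) \<and> s vD v = Suc (d (c (lo + len)) v)"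
    and pre: "\<forall>x\<le>2 * len. is_max (prefix_vals (\<lambda>j. w (c (lo + j))) len x) (s vPRE x)"
    and suf: "\<forall>x\<le>2 * len. is_max (suffix_vals (\<lambda>j. w (c (lo + j))) len x) (s vSUF x)"
    and seg: "\<forall>u<n. s vSEG u \<noteq> 0 \<longleftrightarrow> u \<in> (\<lambda>j. c (lo + j)) ` {0<..<len}"
  shows "runs (for_loop vJ vN outside_body) s (\<lambda>t s'. t \<le> 2 + 7 * n \<and>
    improves (s vBEST 0) (s' vBEST 0) \<and> (\<forall>u<n. s' vSEG u = 0) \<and>
    (\<forall>u\<in>H. u \<notin> (\<lambda>j. c (lo + j)) ` {0<..<len} \<longrightarrow>
       (\<forall>j. 0 < j \<and> j < len \<longrightarrow> w u + w (c (lo + j)) + d u (c (lo + j)) \<le> s' vBEST 0)))"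
proof -
  let ?f = "\<lambda>j. w (c (lo + j))" and ?in = "(\<lambda>j. c (lo + j)) ` {0<..<len}"
  note S = core_state_simps[OF st]
  have ch: "chain H c lo (lo + len)" using hc by (simp add: half_chain_def)
  have cH: "c (lo + j) \<in> H" if "j \<le> len" for j using ch that by (auto simp: chain_def)
  have inH: "?in \<subseteq> H" using cH by auto
  have shift: "?in = c ` {lo<..<lo + len}"
  proof -
    have "(\<lambda>j. lo + j) ` {0<..<len} = {lo<..<lo + len}"
    proof (intro set_eqI iffI)
      fix x assume "x \<in> {lo<..<lo + len}"
      then show "x \<in> (\<lambda>j. lo + j) ` {0<..<len}" by (intro image_eqI[of _ _ "x - lo"]) auto
    qed auto
    then show ?thesis by (metis image_image)
  qed
  \<comment> \<open>Both candidates are taken without comparing the ways. The threshold ensures that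
    each measures true distances, so neither overshoots the diameter, and every position belongs to
    one of them.\<close>
  have key: "\<exists>A B. s vW u + s vDL u + s vPRE (len + s vD u - s vDL u) - 1 = A \<and>
      s vW u + s vD u + s vSUF (len + s vD u - s vDL u) - 1 = B \<and> A \<le> diam \<and> B \<le> diam \<and>
      (\<forall>j. 0 < j \<and> j < len \<longrightarrow> w u + ?f j + d u (c (lo + j)) \<le> max A B)"
    if u: "u \<in> H" "u \<notin> ?in" for u
  proof -
    define a where "a = d u (c lo)"
    define b where "b = d u (c (lo + len))"
    have un: "u < n" using H_lt u by simp
    have cn: "c lo < n" "c (lo + len) < n" using cH[of 0] cH[of len] H_lt by auto
    have Du: "s vDL u = Suc a" "s vD u = Suc b"
      using D un d_sym[OF un] cn by (auto simp: a_def b_def)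
    have dist: "d u (c (lo + j)) = min (a + j) (b + (len - j))" if "j \<le> len" for j
      using chain_dist_outside[OF isom_H H_sub ch u(1), of "lo + j"] u(2) that
      unfolding shift a_def b_def by simp
    have ab: "b \<le> a + len" "a \<le> b + len" using dist[of len] dist[of 0] by (auto simp: a_def b_def)
    define T where "T = len + b - a"
    have T: "len + s vD u - s vDL u = T" "T \<le> 2 * len" using Du ab by (auto simp: T_def)
    have P: "is_max (prefix_vals ?f len T) (s vPRE T)" and Q: "is_max (suffix_vals ?f len T) (s vSUF T)"
      using pre suf T by auto
    \<comment> \<open>If no position lies on one side of the threshold, the candidate degenerates to
      the weight of \<open>u\<close> plus its distance to an end, which this bound covers even when
      \<open>u\<close> is that end.\<close>
    have end_le: "w u + d u x \<le> diam" if "x \<in> H" for x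
      using W_le[OF u(1) that] w_le[OF u(1)] by (cases "u = x") auto
    have "w u + a + s vPRE T \<le> diam"
    proof (cases "s vPRE T = 0")
      case True then show ?thesis using end_le[of "c lo"] cH[of 0] by (simp add: a_def)
    next
      case False
      then obtain j where j: "0 < j" "j < len" "2 * j \<le> T" "s vPRE T = j + ?f j"
        using P by (auto simp: is_max_def prefix_vals_def)
      then have "d u (c (lo + j)) = a + j" using dist[of j] ab by (auto simp: T_def)
      moreover have "u \<noteq> c (lo + j)" using u(2) j by auto
      ultimately show ?thesis using W_le[OF u(1) cH[of j]] j by simp
    qed
    moreover have "w u + b + s vSUF T \<le> diam"
    proof (cases "s vSUF T = 0")
      case True then show ?thesis using end_le[of "c (lo + len)"] cH[of len] by (simp add: b_def)
    next
      case False
      then obtain j where j: "0 < j" "j < len" "T < 2 * j" "s vSUF T = len - j + ?f j"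
        using Q by (auto simp: is_max_def suffix_vals_def)
      then have "d u (c (lo + j)) = b + (len - j)" using dist[of j] ab by (auto simp: T_def)
      moreover have "u \<noteq> c (lo + j)" using u(2) j by auto
      ultimately show ?thesis using W_le[OF u(1) cH[of j]] j by simp
    qed
    moreover have "w u + ?f j + d u (c (lo + j)) \<le> max (w u + a + s vPRE T) (w u + b + s vSUF T)"
      if j: "0 < j \<and> j < len" for j
    proof (cases "2 * j \<le> T")
      case True
      then have "j + ?f j \<in> prefix_vals ?f len T" using j by (auto simp: prefix_vals_def)
      then have "j + ?f j \<le> s vPRE T" using P by (auto simp: is_max_def)
      then show ?thesis using dist[of j] j by auto
    next
      case False
      then have "len - j + ?f j \<in> suffix_vals ?f len T" using j by (auto simp: suffix_vals_def)
      then have "len - j + ?f j \<le> s vSUF T" using Q by (auto simp: is_max_def)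
      then show ?thesis using dist[of j] j by auto
    qed
    ultimately show ?thesis using Du S(3)[OF u(1)] unfolding T(1)
      by (intro exI[of _ "w u + a + s vPRE T"] exI[of _ "w u + b + s vSUF T"]) auto
  qed
  show ?thesis
  proof (rule runs_for_loop[where N = n and T = "\<lambda>_. 5" and P = "\<lambda>i s'. improves (s vBEST 0) (s' vBEST 0) \<and>
      (\<forall>u<n. s' vSEG u = (if u < i then 0 else s vSEG u)) \<and>
      (\<forall>u\<in>H. u < i \<and> u \<notin> ?in \<longrightarrow>
        (\<forall>j. 0 < j \<and> j < len \<longrightarrow> w u + ?f j + d u (c (lo + j)) \<le> s' vBEST 0))"], goal_cases)
    case 5
    then show ?case by (simp add: improves_refl)
  next
    case (6 i s1)
    have fr: "s1 k = s k" if "k \<notin> {vSEG, vT, vBEST, vJ}" for k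
      using 6(4) that by (auto simp: outside_body_def)
    have deg: "s1 vDEG i = 0 \<longleftrightarrow> i \<notin> H" using fr S(2)[OF 6(1)] by simp
    have segi: "s1 vSEG i \<noteq> 0 \<longleftrightarrow> i \<in> ?in" using 6(1,2) seg by simp
    consider "i \<notin> H" | "i \<in> ?in" | "i \<in> H" "i \<notin> ?in" by blast
    then show ?case
    proof cases
      case 1
      then have "s vSEG i = 0" using seg 6(1) inH by blast
      then have run: "runs outside_body s1 (\<lambda>t s2. t = 1 \<and> s2 = s1)"
        using deg 6(3) 1 by (simp add: outside_body_def)
      show ?thesis by (rule runs_mono[OF run])
        (use 6(2) 1 \<open>s vSEG i = 0\<close> in \<open>auto simp: less_Suc_eq\<close>)
    next
      case 2
      then have "i \<in> H" using inH by blast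
      then have run: "runs outside_body s1 (\<lambda>t s2. t = 3 \<and> s2 = s1(vSEG := (s1 vSEG)(i := 0)))"
        using deg segi 2 6(3) by (simp add: outside_body_def)
      show ?thesis by (rule runs_mono[OF run]) (use 6(2) 2 in \<open>auto simp: less_Suc_eq\<close>)
    next
      case 3
      obtain A B where AB: "s vW i + s vDL i + s vPRE (len + s vD i - s vDL i) - 1 = A"
        "s vW i + s vD i + s vSUF (len + s vD i - s vDL i) - 1 = B" "A \<le> diam" "B \<le> diam"
        "\<forall>j. 0 < j \<and> j < len \<longrightarrow> w i + ?f j + d i (c (lo + j)) \<le> max A B"
        using key[OF 3] by blast
      have run: "runs outside_body s1 (\<lambda>t s2. t = 5 \<and> s2 vSEG = s1 vSEG \<and>
          s2 vBEST 0 = max (max (s1 vBEST 0) A) B)"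
        using deg segi 3 6(3) fr len AB(1,2) by (simp add: outside_body_def runs_Seq)
      have segz: "s vSEG i = 0" using seg 6(1) 3 by blast
      show ?thesis
      proof (rule runs_mono[OF run], goal_cases)
        case (1 t s2)
        have imp: "improves (s vBEST 0) (s2 vBEST 0)" using 1 6(2) AB(3,4) by (auto simp: improves_def)
        have "w u + ?f j + d u (c (lo + j)) \<le> s2 vBEST 0"
          if u: "u \<in> H" "u < Suc i" "u \<notin> ?in" and j: "0 < j \<and> j < len" for u j
        proof (cases "u = i")
          case True
          then show ?thesis using AB(5)[rule_format, OF j] 1 by (auto simp: le_max_iff_disj)
        next
          case False
          then have "w u + ?f j + d u (c (lo + j)) \<le> s1 vBEST 0" using 6(2) u j by simp
          then show ?thesis using 1 by simp
        qed
        then show ?case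
          using 1 6(2) segz imp by (simp add: less_Suc_eq)
      qed
    qed
  next
    case (7 t s1)
    then show ?case using H_lt by auto
  qed (use S in \<open>auto simp: outside_body_def\<close>)
qed

end

subsection \<open>Chains\<close>

definition walk_init :: com where
  "walk_init = Wr vCH (Num 0) (Rd vX (V vI)) ;; (vCUR ::= Rd vDST (V vI)) ;; (vL ::= Num 1)"

definition walk_body :: com where
  "walk_body =
    Wr vCH (V vL) (V vCUR) ;; Wr vVIS (V vCUR) (Num 1) ;;
    (vCUR ::= Minus (Rd vNBS (V vCUR)) (Rd vCH (Minus (V vL) (Num 1)))) ;;
    (vL ::= Plus (V vL) (Num 1))"

definition walk_prog :: com where
  "walk_prog =
    walk_init ;; While (Minus (Num 1) (Rd vSPEC (V vCUR))) walk_body ;; Wr vCH (V vL) (V vCUR)"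

text \<open>Counting up replaces division by 2: the loop stops as soon as
  \<open>L \<le> 2 * MID + 1\<close>, which is at \<open>MID = L div 2\<close>.\<close>

definition mid_prog :: com where
  "mid_prog =
    (vMID ::= Num 0) ;;
    While (Minus (V vL) (Plus (Plus (V vMID) (V vMID)) (Num 1))) (vMID ::= Plus (V vMID) (Num 1))"

text \<open>The middle vertex is an end of both halves and thereby gets a search of its own. A pair
  of inner vertices of different halves is found when either half is processed, as one of them is
  outside.\<close>

definition chain_prog :: com where
  "chain_prog =
    walk_prog ;; mid_prog ;;
    ((vLO ::= Num 0) ;; (vHI ::= V vMID)) ;; seg_prog ;;
    ((vLO ::= V vMID) ;; (vHI ::= V vL)) ;; seg_prog"

text \<open>A chain can be entered from either of its ends; the test of \<open>VIS\<close> prevents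
  a second walk. Half-edges between special vertices start no chain.\<close>

definition chains_body :: com where
  "chains_body =
    If (Rd vSPEC (Rd vX (V vI)))
      (If (Rd vDEG (Rd vDST (V vI)))
        (If (Plus (Rd vSPEC (Rd vDST (V vI))) (Rd vVIS (Rd vDST (V vI)))) Skip chain_prog) Skip)
      Skip ;;
    (vI ::= Plus (V vI) (Num 1))"

definition chains_prog :: com where
  "chains_prog = (vI ::= Num 2) ;; While (Minus (V vE) (V vI)) chains_body"

lemma mods_scan_prog: "mods scan_prog = {vJ, vD, vQ, vH, vTL, vPT, vY, vBEST}"
  by (auto simp: scan_prog_def bfs_prog_def bfs_start_def bfs_body_def)

lemma mods_seg_prog: "mods seg_prog = {vSRC, vDL, vJ, vD, vQ, vH, vTL, vPT, vY, vBEST, vLEN, vVAL, vFOLD,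
    vPRE, vU, vSEG, vSUF, vT}"
  by (auto simp: seg_prog_def ends_prog_def mods_scan_prog fold_init_def fold_body_def suffix_init_def
      suffix_body_def outside_body_def)

lemma mods_walk_prog: "mods walk_prog = {vCH, vCUR, vL, vVIS}"
  by (auto simp: walk_prog_def walk_init_def walk_body_def)

lemma mods_mid_prog: "mods mid_prog = {vMID}"
  by (auto simp: mid_prog_def)

context pruned
begin

definition seg_time :: nat where
  "seg_time = 2 * scan_time + 40 + 30 * n"

lemma runs_seg_prog:
  assumes st: "core_state s" and hc: "half_chain (s vCH) (s vLO 0) (s vHI 0)" and seg: "\<forall>u<n. s vSEG u = 0"
  shows "runs seg_prog s (\<lambda>t s'. t \<le> seg_time \<and> improves (s vBEST 0) (s' vBEST 0) \<and>
    (\<forall>u<n. s' vSEG u = 0) \<and> (\<forall>i. s vLO 0 \<le> i \<and> i \<le> s vHI 0 \<longrightarrow> covered (s' vBEST 0) (s vCH i)))"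
proof -
  define c where "c = s vCH"
  define lo where "lo = s vLO 0"
  define len where "len = s vHI 0 - lo"
  let ?f = "\<lambda>j. w (c (lo + j))"
  have lohi: "lo < s vHI 0" using hc by (simp add: half_chain_def chain_def lo_def)
  then have hi: "s vHI 0 = lo + len" and len1: "1 \<le> len" by (auto simp: len_def)
  have hc': "half_chain c lo (lo + len)" using hc hi by (simp add: c_def lo_def)
  have lenn: "len \<le> n + 1" using half_chain_len[OF hc'] by simp
  have ch: "chain H c lo (lo + len)" using hc' by (simp add: half_chain_def)
  have cH: "c (lo + j) \<in> H" if "j \<le> len" for j using ch that by (auto simp: chain_def)
  have 1: "runs ends_prog s (\<lambda>t s'. t \<le> 2 * scan_time + 4 + 3 * n \<and>
      (\<forall>v<n. s' vDL v = Suc (d (c lo) v) \<and> s' vD v = Suc (d (c (lo + len)) v)) \<and>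
      improves (s vBEST 0) (s' vBEST 0) \<and> covered (s' vBEST 0) (c lo) \<and> covered (s' vBEST 0) (c (lo + len)))"
    using cH[of 0] cH[of len] hi by (intro runs_ends_prog[OF st]) (auto simp: c_def lo_def)
  show ?thesis
    unfolding seg_prog_def
  proof (rule runs_SeqI[OF 1], goal_cases)
    case (1 t1 s1)
    have fr1: "s1 k = s k" if "k \<notin> {vSRC, vDL, vJ, vD, vQ, vH, vTL, vPT, vY, vBEST}" for k
      using 1(2) that by (auto simp: ends_prog_def mods_scan_prog)
    have st1: "core_state s1" by (rule core_state_cong[OF st]) (auto simp: fr1)
    have init: "runs fold_init s1 (\<lambda>t s2. t = 6 \<and> s2 vLEN 0 = len \<and> s2 vVAL 0 = 0 \<and> s2 vFOLD 0 = 0 \<and>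
        s2 vPRE 0 = 0 \<and> s2 vPRE 1 = 0 \<and> s2 vJ 0 = 1)"
      by (simp add: fold_init_def runs_Seq fr1 len_def lo_def)
    show ?case
    proof (rule runs_SeqI[OF init], goal_cases)
      case (1 t2 s2)
      have fr2: "s2 k = s1 k" if "k \<notin> {vLEN, vVAL, vFOLD, vPRE, vJ}" for k
        using 1(2) that by (auto simp: fold_init_def)
      have st2: "core_state s2" by (rule core_state_cong[OF st1]) (auto simp: fr2)
      have e2: "s2 vCH = c" "s2 vLO 0 = lo" "s2 vLEN 0 = len" "s2 vJ 0 = 1"
        using 1 by (auto simp: fr1 fr2 c_def lo_def)
      have i2: "fold_inv (s1 vBEST 0) c lo len 1 s2"
        using 1 len1 seg by (intro fold_inv_init) (auto simp: fr1 fr2 improves_refl)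
      note t2 = 1(1)
      show ?case
      proof (rule runs_SeqI[OF runs_fold_loop[OF st2 hc' e2 i2]], goal_cases)
        case (1 t3 s3)
        have fr3: "s3 k = s2 k" if "k \<notin> {vU, vVAL, vPRE, vBEST, vFOLD, vSEG, vJ}" for k
          using 1(2) that by (auto simp: fold_body_def)
        have i3: "fold_inv (s1 vBEST 0) c lo len len s3" and t3: "t3 \<le> 1 + 9 * len" using 1(1) by auto
        have sinit: "runs suffix_init s3 (\<lambda>t s4. t = 4 \<and> s4 vPRE = (s3 vPRE)(2 * len := s3 vVAL 0) \<and>
            s4 vVAL 0 = 0 \<and> s4 vSUF (2 * len) = 0 \<and> s4 vJ 0 = len)"
          using e2 by (simp add: suffix_init_def runs_Seq fr3 mult_2)
        show ?case
        proof (rule runs_SeqI[OF sinit], goal_cases)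
          case (1 t4 s4)
          have fr4: "s4 k = s3 k" if "k \<notin> {vPRE, vVAL, vSUF, vJ}" for k
            using 1(2) that by (auto simp: suffix_init_def)
          have st4: "core_state s4" by (rule core_state_cong[OF st2]) (auto simp: fr3 fr4)
          have e4: "s4 vCH = c" "s4 vLO 0 = lo" "s4 vLEN 0 = len" "s4 vJ 0 = len" "s4 vVAL 0 = 0"
            "s4 vSUF (2 * len) = 0"
            using 1(1) e2 by (auto simp: fr3 fr4)
          note t4 = 1(1)
          show ?case
          proof (rule runs_SeqI[OF runs_suffix_loop[OF st4 hc' e4]], goal_cases)
            case (1 t5 s5)
            have fr5: "s5 k = s4 k" if "k \<notin> {vVAL, vSUF, vJ}" for k
              using 1(2) that by (auto simp: suffix_body_def)
            have st5: "core_state s5" by (rule core_state_cong[OF st4]) (auto simp: fr5)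
            have D5: "\<forall>v<n. s5 vDL v = Suc (d (c lo) v) \<and> s5 vD v = Suc (d (c (lo + len)) v)"
              using \<open>t1 \<le> _ \<and> _\<close> by (simp add: fr2 fr3 fr4 fr5)
            have len5: "s5 vLEN 0 = len" using e4 fr5 by simp
            have pre5: "\<forall>x\<le>2 * len. is_max (prefix_vals ?f len x) (s5 vPRE x)"
            proof (intro allI impI)
              fix x assume x: "x \<le> 2 * len"
              show "is_max (prefix_vals ?f len x) (s5 vPRE x)"
              proof (cases "x = 2 * len")
                case True
                then show ?thesis using i3 t4 prefix_vals_end[of ?f len] by (simp add: fold_inv_def fr5)
              next
                case False
                then show ?thesis using i3 t4 x by (simp add: fold_inv_def fr5)
              qed
            qed
            have seg5: "\<forall>u<n. s5 vSEG u \<noteq> 0 \<longleftrightarrow> u \<in> (\<lambda>j. c (lo + j)) ` {0<..<len}"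
              using i3 by (simp add: fold_inv_def fr4 fr5)
            have suf5: "\<forall>x\<le>2 * len. is_max (suffix_vals ?f len x) (s5 vSUF x)" and t5: "t5 \<le> 1 + 5 * len"
              using 1(1) by auto
            have b5: "s5 vBEST 0 = s3 vBEST 0" by (simp add: fr4 fr5)
            show ?case
            proof (rule runs_mono[OF runs_outside_loop[OF st5 hc' len5 D5 pre5 suf5 seg5]], goal_cases)
              case (1 t6 s6)
              have i01: "improves (s vBEST 0) (s1 vBEST 0)" using \<open>t1 \<le> _ \<and> _\<close> by simp
              have i13: "improves (s1 vBEST 0) (s3 vBEST 0)" using i3 by (simp add: fold_inv_def)
              have i36: "improves (s3 vBEST 0) (s6 vBEST 0)" using 1(1) b5 by simp
              have le36: "s3 vBEST 0 \<le> s6 vBEST 0" using i36 by (simp add: improves_def)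
              have le16: "s1 vBEST 0 \<le> s6 vBEST 0" using i13 le36 by (simp add: improves_def)
              have time: "t1 + (t2 + (t3 + (t4 + (t5 + t6)))) \<le> seg_time"
                using \<open>t1 \<le> _ \<and> _\<close> t2 t3 t4 t5 1(1) lenn by (simp add: seg_time_def)
              have cov: "covered (s6 vBEST 0) (c (lo + j))" if j: "j \<le> len" for j
              proof -
                \<comment> \<open>Ends are settled by their own searches. For an inner vertex,
                  partners outside the half were treated by the last sweep and partners inside by
                  the fold.\<close>
                consider "j = 0" | "j = len" | "0 < j" "j < len" using j by linarith
                then show ?thesis
                proof cases
                  case a: 1
                  then show ?thesis using \<open>t1 \<le> _ \<and> _\<close> covered_mono le16 by auto
                next
                  case a: 2
                  then show ?thesis using \<open>t1 \<le> _ \<and> _\<close> covered_mono le16 by auto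
                next
                  case a: 3
                  show ?thesis unfolding covered_def
                  proof (intro ballI impI)
                    fix u assume u: "u \<in> H" "u \<noteq> c (lo + j)"
                    show "w u + ?f j + d u (c (lo + j)) \<le> s6 vBEST 0"
                    proof (cases "u \<in> (\<lambda>j. c (lo + j)) ` {0<..<len}")
                      case False
                      then show ?thesis using 1(1) u a by blast
                    next
                      case True
                      then obtain i where i: "0 < i" "i < len" "u = c (lo + i)" by auto
                      have pairs: "?f x + ?f y + (y - x) \<le> s3 vBEST 0" if "0 < x" "x < y" "y < len" for x y
                        using i3 that by (simp add: fold_inv_def)
                      have dd: "d (c (lo + x)) (c (lo + y)) = y - x" if "0 < x" "x < y" "y < len" for x y
                        using hc' that unfolding half_chain_def by auto
                      have ij: "i \<noteq> j" using u i by auto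
                      have "d u (c (lo + j)) = d (c (lo + j)) u"
                        using d_sym H_lt u cH[OF j] by auto
                      then have "w u + ?f j + d u (c (lo + j)) \<le> s3 vBEST 0"
                        using pairs[of i j] pairs[of j i] dd[of i j] dd[of j i] i a ij
                        by (cases "i < j") (auto simp: add_ac)
                      then show ?thesis using le36 by simp
                    qed
                  qed
                qed
              qed
              have "covered (s6 vBEST 0) (s vCH i)" if i: "s vLO 0 \<le> i" "i \<le> s vHI 0" for i
                using cov[of "i - lo"] i hi by (simp add: c_def lo_def)
              then show ?case using time 1(1) improves_trans[OF i01 improves_trans[OF i13 i36]] by simp
            qed
          qed
        qed
      qed
    qed
  qed
qed

text \<open>The current vertex belongs to position \<open>l\<close>, which is not yet written, hence
  the updated function in the neighbour condition. \<open>V0\<close> holds the vertices of earlier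
  chains, and the last clause says that the walk does not turn back.\<close>

definition walk_inv :: "nat set \<Rightarrow> nat set \<Rightarrow> nat \<Rightarrow> nat \<Rightarrow> (nat \<Rightarrow> nat) \<Rightarrow> nat \<Rightarrow> nat \<Rightarrow> bool" where
  "walk_inv SP V0 x y c l cur \<longleftrightarrow> 1 \<le> l \<and> c 0 = x \<and> cur \<in> H \<and> adj (c (l - 1)) cur \<and>
     (\<forall>i. 0 < i \<and> i < l \<longrightarrow> c i \<in> H - SP - V0 \<and> nb (c i) \<inter> H = {(c(l := cur)) (i - 1), (c(l := cur)) (i + 1)}) \<and>
     (\<forall>i. i + 1 < l \<longrightarrow> adj (c i) (c (i + 1))) \<and> inj_on c {0<..<l} \<and>
     (l = 1 \<longrightarrow> cur = y) \<and> (1 < l \<longrightarrow> c 1 = y) \<and> (2 \<le> l \<longrightarrow> cur \<noteq> c (l - 2))"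

text \<open>A vertex of an earlier chain has all its core neighbours in \<open>V0\<close> or among
  the special vertices, and the predecessor is in neither. If the current vertex occurred before,
  the predecessor would be one of the two chain neighbours of that occurrence, which contradicts
  injectivity, irreflexivity or the ban on turning back.\<close>

lemma walk_inv_step:
  assumes inv: "walk_inv SP V0 x y c l cur" and cur: "cur \<notin> SP" and x: "x \<in> SP" and SP: "SP \<subseteq> H"
    and two: "\<And>v. v \<in> H - SP \<Longrightarrow> dg v = 2"
    and cl: "\<And>v. v \<in> V0 \<Longrightarrow> nb v \<inter> H \<subseteq> V0 \<union> SP" and y: "y \<notin> V0" and V0: "V0 \<subseteq> H - SP"
  shows "walk_inv SP V0 x y (c(l := cur)) (Suc l) (\<Sum> (nb cur \<inter> H) - c (l - 1))"
    and "cur \<notin> V0" and "cur \<notin> c ` {0<..<l}"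
proof -
  let ?c = "c(l := cur)"
  have I: "1 \<le> l" "c 0 = x" "cur \<in> H" "adj (c (l - 1)) cur"
    "\<And>i. 0 < i \<Longrightarrow> i < l \<Longrightarrow> c i \<in> H \<and> c i \<notin> SP \<and> c i \<notin> V0"
    "\<And>i. 0 < i \<Longrightarrow> i < l \<Longrightarrow> nb (c i) \<inter> H = {?c (i - 1), ?c (i + 1)}"
    "\<And>i. i + 1 < l \<Longrightarrow> adj (c i) (c (i + 1))" "inj_on c {0<..<l}"
    "l = 1 \<Longrightarrow> cur = y" "1 < l \<Longrightarrow> c 1 = y" "2 \<le> l \<Longrightarrow> cur \<noteq> c (l - 2)"
    using inv unfolding walk_inv_def by blast+
  have prevH: "c (l - 1) \<in> H" using I(1,2) I(5)[of "l - 1"] x SP by (cases "l = 1") auto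
  have prev: "c (l - 1) \<in> nb cur \<inter> H" using I(4) adj_sym prevH by (auto simp: nb_def)
  have "dg cur = 2" using two cur I(3) by simp
  then obtain p q where pq: "nb cur \<inter> H = {p, q}" "p \<noteq> q" by (auto simp: card_2_iff)
  obtain z where z: "nb cur \<inter> H = {c (l - 1), z}" "z \<noteq> c (l - 1)"
  proof (cases "p = c (l - 1)")
    case True then show ?thesis using pq that[of q] by auto
  next
    case False
    then have "q = c (l - 1)" using pq prev by auto
    then show ?thesis using pq that[of p] by (auto simp: insert_commute)
  qed
  have zsum: "\<Sum> (nb cur \<inter> H) - c (l - 1) = z" using z by simp
  have zH: "z \<in> H" "adj cur z" using z(1) by (auto simp: nb_def)
  show V: "cur \<notin> V0"
  proof
    assume "cur \<in> V0"
    then have "c (l - 1) \<in> V0 \<union> SP" using cl prev by blast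
    then show False using I(5)[of "l - 1"] I(1) I(9) y \<open>cur \<in> V0\<close> by (cases "l = 1") auto
  qed
  show fresh: "cur \<notin> c ` {0<..<l}"
  proof
    assume "cur \<in> c ` {0<..<l}"
    then obtain i where i: "0 < i" "i < l" "cur = c i" by auto
    have l2: "2 \<le> l" using i by simp
    have nsp: "c (l - 1) \<notin> SP" using I(5)[of "l - 1"] l2 by simp
    have "c (l - 1) \<in> {?c (i - 1), ?c (i + 1)}" using prev I(6)[OF i(1,2)] i(3) by simp
    then consider "c (l - 1) = c (i - 1)" | "i + 1 = l" "c (l - 1) = cur" | "i + 1 < l" "c (l - 1) = c (i + 1)"
      using i by (auto split: if_splits)
    then show False
    proof cases
      case 1
      show False
      proof (cases "i = 1")
        case True then show False using 1 nsp I(2) x by simp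
      next
        case False
        then have "l - 1 = i - 1" using inj_onD[OF I(8) 1] i l2 by simp
        then show False using i by simp
      qed
    next
      case 2 then show False using I(4) adjD by metis
    next
      case 3
      then have "l - 1 = i + 1" using inj_onD[OF I(8) 3(2)] l2 by simp
      then have "i = l - 2" using l2 by simp
      then show False using I(11)[OF l2] i by simp
    qed
  qed
  show "walk_inv SP V0 x y ?c (Suc l) (\<Sum> (nb cur \<inter> H) - c (l - 1))"
    unfolding zsum walk_inv_def
  proof (intro conjI)
    have set: "{0<..<Suc l} = insert l {0<..<l}" using I(1) by auto
    have "inj_on ?c {0<..<l}" using I(8) by (auto simp: inj_on_def)
    moreover have "?c l \<notin> ?c ` {0<..<l}" using fresh by auto
    ultimately show "inj_on ?c {0<..<Suc l}" unfolding set by simp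
    show "\<forall>i. 0 < i \<and> i < Suc l \<longrightarrow> ?c i \<in> H - SP - V0 \<and>
        nb (?c i) \<inter> H = {(?c(Suc l := z)) (i - 1), (?c(Suc l := z)) (i + 1)}"
    proof (intro allI impI)
      fix i assume i: "0 < i \<and> i < Suc l"
      show "?c i \<in> H - SP - V0 \<and> nb (?c i) \<inter> H = {(?c(Suc l := z)) (i - 1), (?c(Suc l := z)) (i + 1)}"
      proof (cases "i = l")
        case True then show ?thesis using I(3) cur V z(1) I(1) by auto
      next
        case False
        then have "i < l" "i - 1 \<noteq> l" "i - 1 \<noteq> Suc l" using i by auto
        then show ?thesis using I(5)[of i] I(6)[of i] i by simp
      qed
    qed
    show "\<forall>i. i + 1 < Suc l \<longrightarrow> adj (?c i) (?c (i + 1))"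
    proof (intro allI impI)
      fix i assume "i + 1 < Suc l"
      then show "adj (?c i) (?c (i + 1))" using I(4) I(7)[of i] by (cases "i + 1 = l") auto
    qed
  qed (use I zH z(2) in \<open>auto simp: le_Suc_eq numeral_2_eq_2\<close>)
qed

text \<open>The walk ends at a special vertex, so all core neighbours of inner vertices are on the
  chain or special. This closure is what keeps later walks away from the chain.\<close>

lemma chain_if_walk_inv:
  assumes inv: "walk_inv SP V0 x y c l cur" and cur: "cur \<in> SP" and x: "x \<in> SP" and SP: "SP \<subseteq> H"
    and y: "y \<notin> SP"
  shows "chain H (c(l := cur)) 0 l" "2 \<le> l" "y \<in> c ` {0<..<l}" "c ` {0<..<l} \<subseteq> H - SP - V0"
    "\<And>v. v \<in> c ` {0<..<l} \<Longrightarrow> nb v \<inter> H \<subseteq> c ` {0<..<l} \<union> SP" "l \<le> n + 1"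
proof -
  let ?c = "c(l := cur)"
  have I: "1 \<le> l" "c 0 = x" "cur \<in> H" "adj (c (l - 1)) cur"
    "\<And>i. 0 < i \<Longrightarrow> i < l \<Longrightarrow> c i \<in> H \<and> c i \<notin> SP \<and> c i \<notin> V0"
    "\<And>i. 0 < i \<Longrightarrow> i < l \<Longrightarrow> nb (c i) \<inter> H = {?c (i - 1), ?c (i + 1)}"
    "\<And>i. i + 1 < l \<Longrightarrow> adj (c i) (c (i + 1))" "inj_on c {0<..<l}"
    "l = 1 \<Longrightarrow> cur = y" "1 < l \<Longrightarrow> c 1 = y"
    using inv unfolding walk_inv_def by blast+
  show l2: "2 \<le> l" using I(1,9) cur y by (cases "l = 1") auto
  show yc: "y \<in> c ` {0<..<l}" using I(10) l2 by (intro image_eqI[of _ _ 1]) auto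
  show sub: "c ` {0<..<l} \<subseteq> H - SP - V0" using I(5) by auto
  have im: "?c ` {0<..<l} = c ` {0<..<l}" by (intro image_cong) auto
  have cl: "?c i \<in> c ` {0<..<l} \<union> SP" if "i \<le> l" for i
    using that cur x I(2) by (cases "i = 0 \<or> i = l") auto
  show "nb v \<inter> H \<subseteq> c ` {0<..<l} \<union> SP" if "v \<in> c ` {0<..<l}" for v
  proof -
    obtain i where i: "0 < i" "i < l" "v = c i" using \<open>v \<in> c ` {0<..<l}\<close> by auto
    then show ?thesis using I(6)[OF i(1,2)] cl[of "i - 1"] cl[of "i + 1"] by auto
  qed
  show "chain H ?c 0 l" unfolding chain_def
  proof (intro conjI)
    show "0 < l" using I(1) by simp
    show "\<forall>i. 0 \<le> i \<and> i \<le> l \<longrightarrow> ?c i \<in> H" using cl sub SP by blast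
    show "\<forall>i. 0 < i \<and> i < l \<longrightarrow> nb (?c i) \<inter> H = {?c (i - 1), ?c (i + 1)}"
    proof (intro allI impI)
      fix i assume i: "0 < i \<and> i < l"
      then have "?c i = c i" by simp
      then show "nb (?c i) \<inter> H = {?c (i - 1), ?c (i + 1)}" using I(6)[of i] i by metis
    qed
    show "\<forall>i. 0 \<le> i \<and> i < l \<longrightarrow> adj (?c i) (?c (i + 1))"
    proof (intro allI impI)
      fix i assume "0 \<le> i \<and> i < l"
      then show "adj (?c i) (?c (i + 1))" using I(4) I(7)[of i] by (cases "i + 1 = l") auto
    qed
    show "inj_on ?c {0<..<l}" using I(8) by (auto simp: inj_on_def)
    show "?c 0 \<notin> ?c ` {0<..<l}" using sub x I(1,2) unfolding im by auto
    show "?c l \<notin> ?c ` {0<..<l}" using sub cur unfolding im by auto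
  qed
  have "card {0<..<l} = card (c ` {0<..<l})" using I(8) by (simp add: card_image)
  also have "\<dots> \<le> card {..<n}" using sub H_sub by (intro card_mono) auto
  finally show "l \<le> n + 1" by simp
qed

section \<open>Walking and processing a whole chain\<close>

lemma runs_walk_prog:
  assumes st: "core_state s" and sp: "specials SP s" and a: "s vI 0 = a" "a \<in> HE"
    and x: "src a \<in> SP" and y: "dst a \<in> H - SP - V0"
    and V0: "V0 \<subseteq> H - SP" "\<forall>v<n. s vVIS v \<noteq> 0 \<longleftrightarrow> v \<in> V0" and cl: "\<And>v. v \<in> V0 \<Longrightarrow> nb v \<inter> H \<subseteq> V0 \<union> SP"
  shows "runs walk_prog s (\<lambda>t s'. t \<le> 5 + 5 * n \<and> chain H (s' vCH) 0 (s' vL 0) \<and> 2 \<le> s' vL 0 \<and> s' vL 0 \<le> n + 1 \<and>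
    dst a \<in> s' vCH ` {0<..<s' vL 0} \<and> s' vCH ` {0<..<s' vL 0} \<subseteq> H - SP - V0 \<and>
    (\<forall>v\<in>s' vCH ` {0<..<s' vL 0}. nb v \<inter> H \<subseteq> s' vCH ` {0<..<s' vL 0} \<union> SP) \<and>
    s' vCH 0 \<in> SP \<and> s' vCH (s' vL 0) \<in> SP \<and>
    (\<forall>v<n. s' vVIS v \<noteq> 0 \<longleftrightarrow> v \<in> V0 \<union> s' vCH ` {0<..<s' vL 0}))"
proof -
  let ?x = "src a" and ?y = "dst a"
  have SP: "SP \<subseteq> H" and two: "\<And>v. v \<in> H - SP \<Longrightarrow> dg v = 2" and spec: "\<And>v. v < n \<Longrightarrow> s vSPEC v \<noteq> 0 \<longleftrightarrow> v \<in> SP"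
    using sp by (auto simp: specials_def)
  have X: "s vX a = ?x" "s vDST a = ?y" using st a by (auto simp: core_state_def adj_state_def input_state_def)
  have nbs: "s vNBS v = \<Sum> (nb v \<inter> H)" if "v \<in> H" for v using st that by (auto simp: core_state_def degrees_def)
  have init: "runs walk_init s (\<lambda>t s'. t = 3 \<and> s' vCH 0 = ?x \<and> s' vCUR 0 = ?y \<and> s' vL 0 = 1)"
    using X a by (simp add: walk_init_def runs_Seq)
  show ?thesis unfolding walk_prog_def
  proof (rule runs_SeqI[OF init], goal_cases)
    case (1 t1 s1)
    have fr1: "s1 k = s k" if "k \<notin> {vCH, vCUR, vL}" for k using 1(2) that by (auto simp: walk_init_def)
    note s1 = 1(1)
    have adjxy: "adj ?x ?y" using half_edges a(2) by blast
    have i1: "walk_inv SP V0 ?x ?y (s1 vCH) 1 ?y"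
      using s1 y adjxy unfolding walk_inv_def by (auto simp: inj_on_def)
    have loop: "runs (While (Minus (Num 1) (Rd vSPEC (V vCUR))) walk_body) s1 (\<lambda>t s'. t \<le> 1 + 5 * n \<and>
        walk_inv SP V0 ?x ?y (s' vCH) (s' vL 0) (s' vCUR 0) \<and> s' vCUR 0 \<in> SP \<and>
        (\<forall>v<n. s' vVIS v \<noteq> 0 \<longleftrightarrow> v \<in> V0 \<union> s' vCH ` {0<..<s' vL 0}))"
    proof (rule runs_While[where I = "\<lambda>r s'. walk_inv SP V0 ?x ?y (s' vCH) (s' vL 0) (s' vCUR 0) \<and>
        (\<forall>v<n. s' vVIS v \<noteq> 0 \<longleftrightarrow> v \<in> V0 \<union> s' vCH ` {0<..<s' vL 0}) \<and> r = 5 * (n + 1 - s' vL 0)"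
        and r = "5 * n"], goal_cases)
      case 1
      have "{0<..<Suc 0} = {}" by auto
      then show ?case using i1 s1 V0 fr1 by simp
    next
      case (2 r s2)
      have fr2: "s2 k = s1 k" if "k \<notin> {vCH, vVIS, vCUR, vL}" for k using 2(2) that by (auto simp: walk_body_def)
      define c where "c = s2 vCH"
      define l where "l = s2 vL 0"
      define cur where "cur = s2 vCUR 0"
      have inv: "walk_inv SP V0 ?x ?y c l cur" using 2(1) by (simp add: c_def l_def cur_def)
      have curH: "cur \<in> H" and l1: "1 \<le> l" using inv by (auto simp: walk_inv_def)
      have ncur: "cur \<notin> SP" using 2(3) spec[of cur] curH H_lt fr1 fr2 by (auto simp: cur_def)
      have y0: "?y \<notin> V0" using y by simp
      note step = walk_inv_step[OF inv ncur x SP two cl y0 V0(1)]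
      \<comment> \<open>The walked vertices are distinct, so the position \<open>l\<close> cannot
        pass \<open>n\<close>; this bounds the number of rounds.\<close>
      have "inj_on c {0<..<l}" "c ` {0<..<l} \<subseteq> H" using inv by (auto simp: walk_inv_def)
      then have "card (insert cur (c ` {0<..<l})) = Suc (l - 1)"
        using step(3) by (simp add: card_image)
      moreover have "card (insert cur (c ` {0<..<l})) \<le> card {..<n}"
        using \<open>c ` {0<..<l} \<subseteq> H\<close> curH H_sub by (intro card_mono) auto
      ultimately have ln: "l \<le> n" using l1 by simp
      have run: "runs walk_body s2 (\<lambda>t s3. t = 4 \<and> s3 vCH = c(l := cur) \<and> s3 vVIS = (s2 vVIS)(cur := 1) \<and>
          s3 vCUR 0 = \<Sum> (nb cur \<inter> H) - c (l - 1) \<and> s3 vL 0 = Suc l)"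
        using nbs[OF curH] l1 fr1 fr2
        by (simp add: walk_body_def runs_Seq c_def[symmetric] l_def[symmetric] cur_def[symmetric])
      show ?case
      proof (rule runs_mono[OF run], goal_cases)
        case (1 t s3)
        have set: "{0<..<Suc l} = insert l {0<..<l}" using l1 by auto
        have "(c(l := cur)) ` {0<..<l} = c ` {0<..<l}" by (intro image_cong) auto
        then have im: "(c(l := cur)) ` {0<..<Suc l} = insert cur (c ` {0<..<l})"
          unfolding set by (simp only: image_insert fun_upd_same)
        have "\<forall>v<n. s3 vVIS v \<noteq> 0 \<longleftrightarrow> v \<in> V0 \<union> s3 vCH ` {0<..<s3 vL 0}"
          using 1(1) 2(1) im by (auto simp: c_def[symmetric] l_def[symmetric])
        then show ?case using 1(1) step(1) 2(1) ln by (auto simp: l_def[symmetric])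
      qed
    next
      case (3 r t s2)
      have fr2: "s2 k = s1 k" if "k \<notin> {vCH, vVIS, vCUR, vL}" for k using 3(2) that by (auto simp: walk_body_def)
      have "s2 vCUR 0 \<in> H" using 3(1) by (auto simp: walk_inv_def)
      then have "s2 vCUR 0 \<in> SP" using 3(3) spec[of "s2 vCUR 0"] H_lt fr1 fr2 by auto
      then show ?case using 3(1,4) by auto
    qed
    show ?case
    proof (rule runs_SeqI[OF loop], goal_cases)
      case (1 t2 s2)
      define c where "c = s2 vCH"
      define l where "l = s2 vL 0"
      define cur where "cur = s2 vCUR 0"
      have inv: "walk_inv SP V0 ?x ?y c l cur" and cur: "cur \<in> SP"
        using 1(1) by (auto simp: c_def l_def cur_def)
      have y0: "?y \<notin> SP" using y by simp
      note res = chain_if_walk_inv[OF inv cur x SP y0]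
      have im: "(c(l := cur)) ` {0<..<l} = c ` {0<..<l}" by (intro image_cong) auto
      have "c 0 = ?x" "0 < l" using inv by (auto simp: walk_inv_def)
      then have c0: "(c(l := cur)) 0 \<in> SP" using x by simp
      have cl: "(c(l := cur)) l \<in> SP" using cur by simp
      have run: "runs (Wr vCH (V vL) (V vCUR)) s2
          (\<lambda>t s3. t = 1 \<and> s3 vCH = c(l := cur) \<and> s3 vL 0 = l \<and> s3 vVIS = s2 vVIS)"
        by (simp add: c_def l_def cur_def)
      have vis: "\<forall>v<n. s2 vVIS v \<noteq> 0 \<longleftrightarrow> v \<in> V0 \<union> c ` {0<..<l}" and t2: "t2 \<le> 1 + 5 * n"
        using 1(1) by (simp_all add: c_def l_def)
      show ?case
      proof (rule runs_mono[OF run], goal_cases)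
        case (1 t3 s3)
        then have e: "t3 = 1" "s3 vCH = c(l := cur)" "s3 vL 0 = l" "s3 vVIS = s2 vVIS" by auto
        show ?case unfolding e im using res c0 cl vis t2 s1 by (intro conjI ballI) auto
      qed
    qed
  qed
qed

lemma runs_mid_prog:
  assumes "2 \<le> s vL 0"
  shows "runs mid_prog s (\<lambda>t s'. t \<le> 2 + 2 * s vL 0 \<and> s' vMID 0 = s vL 0 div 2)"
proof -
  let ?s = "s(vMID := (s vMID)(0 := 0))" and ?L = "s vL 0"
  have "runs (While (Minus (V vL) (Plus (Plus (V vMID) (V vMID)) (Num 1))) (vMID ::= Plus (V vMID) (Num 1))) ?s
     (\<lambda>t s'. Suc t \<le> 2 + 2 * s vL 0 \<and> s' vMID 0 = s vL 0 div 2)"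
  proof (rule runs_While[where I = "\<lambda>r s'. s' vMID 0 \<le> ?L div 2 \<and> r = 2 * (?L - s' vMID 0)" and r = "2 * ?L"],
      goal_cases)
    case (2 r s1)
    then have "s1 vL = s vL" by simp
    then show ?case using 2(1,3) by auto
  next
    case (3 r t s1)
    then have "s1 vL = s vL" by simp
    then show ?case using 3(1,3,4) by auto
  qed auto
  then show ?thesis by (simp add: mid_prog_def runs_Seq)
qed

definition chain_time :: nat where
  "chain_time = 2 * seg_time + 20 + 10 * n"

lemma runs_chain_prog:
  assumes st: "core_state s" and sp: "specials SP s" and a: "s vI 0 = a" "a \<in> HE"
    and x: "src a \<in> SP" and y: "dst a \<in> H - SP - V0"
    and V0: "V0 \<subseteq> H - SP" "\<forall>v<n. s vVIS v \<noteq> 0 \<longleftrightarrow> v \<in> V0" and cl: "\<And>v. v \<in> V0 \<Longrightarrow> nb v \<inter> H \<subseteq> V0 \<union> SP"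
    and seg: "\<forall>u<n. s vSEG u = 0"
  shows "runs chain_prog s (\<lambda>t s'. t \<le> chain_time \<and> improves (s vBEST 0) (s' vBEST 0) \<and> (\<forall>u<n. s' vSEG u = 0) \<and>
    (\<exists>C. dst a \<in> C \<and> C \<subseteq> H - SP - V0 \<and> (\<forall>v\<in>C. nb v \<inter> H \<subseteq> C \<union> SP) \<and> (\<forall>v\<in>C. covered (s' vBEST 0) v) \<and>
      (\<forall>v<n. s' vVIS v \<noteq> 0 \<longleftrightarrow> v \<in> V0 \<union> C)))"
  unfolding chain_prog_def
proof (rule runs_SeqI[OF runs_walk_prog[OF st sp a x y V0 cl]], goal_cases)
  case 1 then show ?case .
next
  case (2 t1 s1)
  define c where "c = s1 vCH"
  define L where "L = s1 vL 0"
  define C where "C = c ` {0<..<L}"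
  have w1: "t1 \<le> 5 + 5 * n" "chain H c 0 L" "2 \<le> L" "L \<le> n + 1" "dst a \<in> C" "C \<subseteq> H - SP - V0"
    "\<forall>v\<in>C. nb v \<inter> H \<subseteq> C \<union> SP" "\<forall>v<n. s1 vVIS v \<noteq> 0 \<longleftrightarrow> v \<in> V0 \<union> C"
    using 2(1) unfolding c_def L_def C_def by simp_all
  have fr1: "s1 k = s k" if "k \<notin> {vCH, vCUR, vL, vVIS}" for k using 2(2) that by (simp add: mods_walk_prog)
  have mid: "runs mid_prog s1 (\<lambda>t s'. t \<le> 2 + 2 * L \<and> s' vMID 0 = L div 2)"
    using runs_mid_prog w1(3) by (simp add: L_def)
  show ?case
  proof (rule runs_SeqI[OF mid], goal_cases)
    case (1 t2 s2)
    have fr2: "s2 k = s1 k" if "k \<noteq> vMID" for k using 1(2) that by (simp add: mods_mid_prog)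
    note s2 = 1(1)
    have asg: "runs ((vLO ::= Num 0) ;; (vHI ::= V vMID)) s2 (\<lambda>t s'. t = 2 \<and> s' vLO 0 = 0 \<and> s' vHI 0 = L div 2)"
      using s2 by (simp add: runs_Seq)
    show ?case
    proof (rule runs_SeqI[OF asg], goal_cases)
      case (1 t3 s3)
      have fr3: "s3 k = s2 k" if "k \<notin> {vLO, vHI}" for k using 1(2) that by simp
      have e3: "s3 vLO 0 = 0" "s3 vHI 0 = L div 2" "s3 vCH = c" "s3 vBEST = s vBEST" "t3 = 2"
        using 1(1) by (auto simp: fr1 fr2 fr3 c_def)
      have st3: "core_state s3" by (rule core_state_cong[OF st]) (auto simp: fr1 fr2 fr3)
      have hc3: "half_chain (s3 vCH) (s3 vLO 0) (s3 vHI 0)"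
        using chain_sub[OF w1(2), of 0 "L div 2"] chain_half_dist[OF isom_H H_sub w1(2)] w1(3)
        unfolding half_chain_def e3 by auto
      have seg3: "\<forall>u<n. s3 vSEG u = 0" using seg by (simp add: fr1 fr2 fr3)
      show ?case
      proof (rule runs_SeqI[OF runs_seg_prog[OF st3 hc3 seg3]], goal_cases)
        case (1 t4 s4)
        have fr4: "s4 k = s3 k" if "k \<notin> mods seg_prog" for k using 1(2) that by blast
        note s4 = 1(1)
        have asg: "runs ((vLO ::= V vMID) ;; (vHI ::= V vL)) s4 (\<lambda>t s'. t = 2 \<and> s' vLO 0 = L div 2 \<and> s' vHI 0 = L)"
          using s2 by (simp add: runs_Seq fr4 mods_seg_prog fr3 fr2 L_def)
        show ?case
        proof (rule runs_SeqI[OF asg], goal_cases)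
          case (1 t5 s5)
          have fr5: "s5 k = s4 k" if "k \<notin> {vLO, vHI}" for k using 1(2) that by simp
          have e5: "s5 vLO 0 = L div 2" "s5 vHI 0 = L" "s5 vCH = c" "s5 vBEST = s4 vBEST" "t5 = 2"
            using 1(1) e3 by (auto simp: fr5 fr4 mods_seg_prog)
          have st5: "core_state s5" by (rule core_state_cong[OF st3]) (auto simp: fr5 fr4 mods_seg_prog)
          have hc5: "half_chain (s5 vCH) (s5 vLO 0) (s5 vHI 0)"
            using chain_sub[OF w1(2), of "L div 2" L] chain_half_dist[OF isom_H H_sub w1(2)] w1(3)
            unfolding half_chain_def e5 by auto
          have seg5: "\<forall>u<n. s5 vSEG u = 0" using s4 by (simp add: fr5)
          show ?case
          proof (rule runs_mono[OF runs_seg_prog[OF st5 hc5 seg5]], goal_cases)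
            case (1 t6 s6)
            have fr6: "s6 k = s5 k" if "k \<notin> mods seg_prog" for k using 1(2) that by blast
            have i: "improves (s4 vBEST 0) (s6 vBEST 0)" using 1(1) e5 by simp
            have "improves (s vBEST 0) (s4 vBEST 0)" using s4 e3 by simp
            then have imp: "improves (s vBEST 0) (s6 vBEST 0)" using i by (rule improves_trans)
            have cov: "\<forall>v\<in>C. covered (s6 vBEST 0) v"
            proof
              fix v assume "v \<in> C"
              then obtain j where j: "j < L" "v = c j" by (auto simp: C_def)
              show "covered (s6 vBEST 0) v"
              proof (cases "j \<le> L div 2")
                case True
                then have "covered (s4 vBEST 0) v" using s4 e3 j by simp
                then show ?thesis using covered_mono i by (auto simp: improves_def)
              next
                case False
                then show ?thesis using 1(1) e5 j by simp
              qed
            qed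
            have vis: "s6 vVIS = s1 vVIS" by (simp add: fr6 mods_seg_prog fr5 fr4 fr3 fr2)
            have time: "t1 + (t2 + (t3 + (t4 + (t5 + t6)))) \<le> chain_time"
              using w1(1,4) s2 e3(5) s4 e5(5) 1(1) by (simp add: chain_time_def)
            show ?case using time imp 1(1) cov vis w1(5-8) by (intro conjI exI[of _ C]) simp_all
          qed
        qed
      qed
    qed
  qed
qed

end

context pruned
begin

text \<open>The number of processed chains is bounded in two ways: each one uses up a half-edge from a special
  vertex and marks a new vertex.\<close>

definition chains_left :: "nat set \<Rightarrow> nat set \<Rightarrow> nat \<Rightarrow> nat" where
  "chains_left SP VS i = min (card (H - SP - VS)) (card {a \<in> HE. i \<le> a \<and> src a \<in> SP \<and> dst a \<in> H})"

text \<open>Two clauses are there for the end of the loop: the closure of \<open>VS\<close> under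
  core neighbours up to special vertices, and the fact that processed half-edges out of special
  vertices lead to no unvisited ordinary core vertex. Together they force every core vertex to be
  special or visited.\<close>

definition chains_inv :: "nat set \<Rightarrow> nat \<Rightarrow> nat set \<Rightarrow> nat \<Rightarrow> state \<Rightarrow> bool" where
  "chains_inv SP b VS i s \<longleftrightarrow> s vI 0 = i \<and> 2 \<le> i \<and> i \<le> 2 * length es + 2 \<and> VS \<subseteq> H - SP \<and>
     (\<forall>v<n. s vVIS v \<noteq> 0 \<longleftrightarrow> v \<in> VS) \<and> (\<forall>v\<in>VS. nb v \<inter> H \<subseteq> VS \<union> SP) \<and>
     (\<forall>v\<in>VS. covered (s vBEST 0) v) \<and>
     (\<forall>a\<in>HE. a < i \<and> src a \<in> SP \<and> dst a \<in> H \<longrightarrow> dst a \<in> VS \<union> SP) \<and>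
     (\<forall>u<n. s vSEG u = 0) \<and> improves b (s vBEST 0)"

lemma chains_left_mono: "i \<le> j \<Longrightarrow> VS \<subseteq> VS' \<Longrightarrow> chains_left SP VS' j \<le> chains_left SP VS i"
  unfolding chains_left_def
  by (intro min.mono card_mono) (auto simp: finite_H HE_def)

lemma chains_left_chain:
  assumes "a \<in> HE" "src a \<in> SP" "dst a \<in> H - SP - VS" "dst a \<in> C"
  shows "Suc (chains_left SP (VS \<union> C) (Suc a)) \<le> chains_left SP VS a"
proof -
  have "card (H - SP - (VS \<union> C)) < card (H - SP - VS)"
    using assms finite_H by (intro psubset_card_mono) auto
  moreover have "card {b \<in> HE. Suc a \<le> b \<and> src b \<in> SP \<and> dst b \<in> H}
      < card {b \<in> HE. a \<le> b \<and> src b \<in> SP \<and> dst b \<in> H}"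
  proof (rule psubset_card_mono)
    have "a \<in> {b \<in> HE. a \<le> b \<and> src b \<in> SP \<and> dst b \<in> H}" using assms by simp
    moreover have "a \<notin> {b \<in> HE. Suc a \<le> b \<and> src b \<in> SP \<and> dst b \<in> H}" by simp
    moreover have "{b \<in> HE. Suc a \<le> b \<and> src b \<in> SP \<and> dst b \<in> H}
        \<subseteq> {b \<in> HE. a \<le> b \<and> src b \<in> SP \<and> dst b \<in> H}" by auto
    ultimately show "{b \<in> HE. Suc a \<le> b \<and> src b \<in> SP \<and> dst b \<in> H}
        \<subset> {b \<in> HE. a \<le> b \<and> src b \<in> SP \<and> dst b \<in> H}" by blast
  qed (simp add: HE_def)
  ultimately show ?thesis unfolding chains_left_def by linarith
qed

lemma runs_chains_body:
  assumes st: "core_state s" and sp: "specials SP s" and inv: "chains_inv SP b VS i s" and i: "i < 2 * length es + 2"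
  shows "runs chains_body s (\<lambda>t s'. \<exists>VS'. chains_inv SP b VS' (Suc i) s' \<and>
    t + chains_left SP VS' (Suc i) * chain_time \<le> 4 + chains_left SP VS i * chain_time)"
proof -
  have I: "s vI 0 = i" "2 \<le> i" "VS \<subseteq> H - SP" "\<forall>v<n. s vVIS v \<noteq> 0 \<longleftrightarrow> v \<in> VS"
    "\<And>v. v \<in> VS \<Longrightarrow> nb v \<inter> H \<subseteq> VS \<union> SP" "\<And>v. v \<in> VS \<Longrightarrow> covered (s vBEST 0) v"
    "\<And>a. a \<in> HE \<Longrightarrow> a < i \<Longrightarrow> src a \<in> SP \<Longrightarrow> dst a \<in> H \<Longrightarrow> dst a \<in> VS \<union> SP"
    "\<forall>u<n. s vSEG u = 0" "improves b (s vBEST 0)"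
    using inv by (auto simp: chains_inv_def)
  have iHE: "i \<in> HE" using I(2) i by (simp add: HE_def)
  have X: "s vX i = src i" "s vDST i = dst i" using st iHE by (auto simp: core_state_def adj_state_def input_state_def)
  have spec: "s vSPEC v \<noteq> 0 \<longleftrightarrow> v \<in> SP" if "v < n" for v using sp that by (auto simp: specials_def)
  have deg: "s vDEG (dst i) = 0 \<longleftrightarrow> dst i \<notin> H" using core_state_simps(2)[OF st dst_lt[OF iHE]] .
  have vis: "s vVIS (dst i) \<noteq> 0 \<longleftrightarrow> dst i \<in> VS" using I(4) dst_lt[OF iHE] by simp
  note tests = X spec[OF src_lt[OF iHE]] spec[OF dst_lt[OF iHE]] deg vis
  show ?thesis
  proof (cases "src i \<in> SP \<and> dst i \<in> H - SP - VS")
    case True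
    have run: "runs chain_prog s (\<lambda>t s'. t \<le> chain_time \<and> improves (s vBEST 0) (s' vBEST 0) \<and> (\<forall>u<n. s' vSEG u = 0) \<and>
      (\<exists>C. dst i \<in> C \<and> C \<subseteq> H - SP - VS \<and> (\<forall>v\<in>C. nb v \<inter> H \<subseteq> C \<union> SP) \<and> (\<forall>v\<in>C. covered (s' vBEST 0) v) \<and>
        (\<forall>v<n. s' vVIS v \<noteq> 0 \<longleftrightarrow> v \<in> VS \<union> C)))"
      using True by (intro runs_chain_prog[OF st sp I(1) iHE _ _ I(3,4,5,8)]) auto
    have run': "runs chain_prog s (\<lambda>t s'.
        let s'' = s'(vI := (s' vI)(0 := Suc (s' vI 0))) in \<exists>VS'. chains_inv SP b VS' (Suc i) s'' \<and>
        t + 4 + chains_left SP VS' (Suc i) * chain_time \<le> 4 + chains_left SP VS i * chain_time)"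
    proof (rule runs_mono[OF run], goal_cases)
      case (1 t s')
      then obtain C where C: "dst i \<in> C" "C \<subseteq> H - SP - VS" "\<forall>v\<in>C. nb v \<inter> H \<subseteq> C \<union> SP"
        "\<forall>v\<in>C. covered (s' vBEST 0) v" "\<forall>v<n. s' vVIS v \<noteq> 0 \<longleftrightarrow> v \<in> VS \<union> C" by blast
      have sI: "s' vI = s vI"
        using 1(2) by (simp add: chain_prog_def mods_seg_prog mods_walk_prog mods_mid_prog)
      have le: "s vBEST 0 \<le> s' vBEST 0" using 1(1) by (simp add: improves_def)
      let ?s = "s'(vI := (s' vI)(0 := Suc (s' vI 0)))"
      have "chains_inv SP b (VS \<union> C) (Suc i) ?s" unfolding chains_inv_def
      proof (intro conjI)
        show "\<forall>v\<in>VS \<union> C. nb v \<inter> H \<subseteq> VS \<union> C \<union> SP" using I(5) C(3) by blast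
        show "\<forall>v\<in>VS \<union> C. covered (?s vBEST 0) v"
          using covered_mono[OF I(6) le] C(4) by auto
        show "\<forall>a\<in>HE. a < Suc i \<and> src a \<in> SP \<and> dst a \<in> H \<longrightarrow> dst a \<in> VS \<union> C \<union> SP"
          using I(7) C(1) by (auto simp: less_Suc_eq)
        show "improves b (?s vBEST 0)" using I(9) 1(1) improves_trans by auto
      qed (use I(1,2,3) i sI C(2,5) 1(1) in auto)
      moreover have "t + 4 + chains_left SP (VS \<union> C) (Suc i) * chain_time \<le> 4 + chains_left SP VS i * chain_time"
      proof -
        have "Suc (chains_left SP (VS \<union> C) (Suc i)) * chain_time \<le> chains_left SP VS i * chain_time"
          using chains_left_chain[OF iHE _ _ C(1)] True by (intro mult_right_mono) auto
        then show ?thesis using 1(1) by simp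
      qed
      ultimately show ?case unfolding Let_def by blast
    qed
    then show ?thesis using True tests I(1)
      by (simp add: chains_body_def runs_Seq Let_def)
  next
    case False
    have inv': "chains_inv SP b VS (Suc i) (s(vI := (s vI)(0 := Suc i)))"
      using inv i False unfolding chains_inv_def by (auto simp: less_Suc_eq)
    have "chains_left SP VS (Suc i) * chain_time \<le> chains_left SP VS i * chain_time"
      by (intro mult_right_mono chains_left_mono) auto
    then have "\<exists>VS'. chains_inv SP b VS' (Suc i) (s(vI := (s vI)(0 := Suc i))) \<and>
        t + chains_left SP VS' (Suc i) * chain_time \<le> 4 + chains_left SP VS i * chain_time"
      if "t \<le> 4" for t using inv' that by (intro exI[of _ VS] conjI) linarith+
    note done' = this
    consider "src i \<notin> SP" | "src i \<in> SP" "dst i \<notin> H" | "src i \<in> SP" "dst i \<in> H" "dst i \<in> SP \<union> VS"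
      using False by blast
    then show ?thesis
    proof cases
      case 1
      then show ?thesis using done'[of 2] tests I(1) by (simp add: chains_body_def runs_Seq)
    next
      case 2
      then show ?thesis using done'[of 3] tests I(1) by (simp add: chains_body_def runs_Seq)
    next
      case 3
      then have "s vSPEC (dst i) + s vVIS (dst i) \<noteq> 0" using tests by auto
      then show ?thesis using done'[of 4] 3 tests I(1) by (simp add: chains_body_def runs_Seq)
    qed
  qed
qed

text \<open>Induction on the distance to a fixed special vertex. The next vertex of a shortest path
  is visited or special; from a visited one closure applies, from a special one the half-edge that
  leads to \<open>v\<close>.\<close>

lemma all_visited:
  assumes sp: "specials SP s" and VS: "VS \<subseteq> H - SP" and cl: "\<And>v. v \<in> VS \<Longrightarrow> nb v \<inter> H \<subseteq> VS \<union> SP"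
    and ent: "\<And>a. a \<in> HE \<Longrightarrow> src a \<in> SP \<Longrightarrow> dst a \<in> H \<Longrightarrow> dst a \<in> VS \<union> SP"
    and v: "v \<in> H"
  shows "v \<in> VS \<union> SP"
proof -
  obtain x where x: "x \<in> SP" "SP \<subseteq> H" using sp v by (auto simp: specials_def)
  have "m = d v x \<Longrightarrow> v \<in> H \<Longrightarrow> v \<in> VS \<union> SP" for m v
  proof (induction m arbitrary: v)
    case 0
    then have "v = x" using d_eq_0[of v x] H_lt x by auto
    then show ?case using x by simp
  next
    case (Suc m)
    have "v \<noteq> x" using Suc.prems(1) by auto
    then obtain h where h: "h \<in> H" "adj v h" "d v x = Suc (d h x)"
      using isom_H Suc.prems(2) x unfolding isom_def by (metis subsetD)
    then have "h \<in> VS \<union> SP" using Suc by simp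
    moreover have vh: "v \<in> nb h \<inter> H" using h(2) adj_sym Suc.prems(2) by (auto simp: nb_def)
    moreover have "v \<in> VS \<union> SP" if "h \<in> SP"
    proof -
      obtain a where "a \<in> HE" "src a = h" "dst a = v" using adj_half_edge adj_sym h(2) by blast
      then show ?thesis using ent that Suc.prems(2) by blast
    qed
    ultimately show ?case using cl by blast
  qed
  then show ?thesis using v by blast
qed

lemma runs_chains_prog:
  assumes st: "core_state s" and sp: "specials SP s" and vis: "\<forall>v<n. s vVIS v = 0" and seg: "\<forall>v<n. s vSEG v = 0"
    and b: "b0 \<le> s vBEST 0" "s vBEST 0 \<le> diam" and cov: "\<forall>x\<in>SP. covered (s vBEST 0) x"
  shows "runs chains_prog s (\<lambda>t s'. t \<le> 2 + 10 * length es + min n (6 * k) * chain_time \<and> s' vBEST 0 = diam)"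
proof -
  let ?s = "s(vI := (s vI)(0 := 2))" and ?b = "s vBEST 0"
  have SPn: "SP \<subseteq> {..<n}" using sp H_sub by (auto simp: specials_def)
  have left: "chains_left SP {} 2 \<le> min n (6 * k)"
  proof -
    have "card (H - SP) \<le> card {..<n}" using H_sub by (intro card_mono) auto
    moreover have "{a \<in> HE. 2 \<le> a \<and> src a \<in> SP \<and> dst a \<in> H} = {a \<in> HE. src a \<in> SP \<and> dst a \<in> H}"
      by (auto simp: HE_def)
    \<comment> \<open>Half-edges from special vertices into the core are as many as the sum of the
      core degrees of the special vertices.\<close>
    then have "card {a \<in> HE. 2 \<le> a \<and> src a \<in> SP \<and> dst a \<in> H} \<le> 6 * k"
      using card_half_edges_within[OF SPn, of H] sp by (simp add: specials_def)
    ultimately show ?thesis by (simp add: chains_left_def min.coboundedI1 min.coboundedI2)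
  qed
  have "runs (While (Minus (V vE) (V vI)) chains_body) ?s
    (\<lambda>t s'. Suc t \<le> 2 + 10 * length es + min n (6 * k) * chain_time \<and> s' vBEST 0 = diam)"
  proof (rule runs_While[where I = "\<lambda>r s'. \<exists>VS i. chains_inv SP ?b VS i s' \<and>
      r = 5 * (2 * length es + 2 - i) + chains_left SP VS i * chain_time"
      and r = "10 * length es + chains_left SP {} 2 * chain_time"], goal_cases)
    case 1
    have "chains_inv SP ?b {} 2 ?s" using vis seg by (auto simp: chains_inv_def improves_refl HE_def)
    then show ?case by (intro exI[of _ "{}"] exI[of _ 2]) simp
  next
    case (2 r s1)
    have fr: "s1 k = s k" if "k \<notin> mods chains_body" "k \<noteq> vI" for k using 2(2) that by simp
    have m: "mods chains_body = {vCH, vCUR, vL, vVIS, vMID, vLO, vHI, vI} \<union> mods seg_prog"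
      by (auto simp: chains_body_def chain_prog_def mods_walk_prog mods_mid_prog)
    have st1: "core_state s1" by (rule core_state_cong[OF st]) (auto simp: fr m mods_seg_prog)
    have "s1 vSPEC = s vSPEC" by (simp add: fr m mods_seg_prog)
    then have sp1: "specials SP s1" using sp by (simp add: specials_def)
    obtain VS i where inv: "chains_inv SP ?b VS i s1"
      and r: "r = 5 * (2 * length es + 2 - i) + chains_left SP VS i * chain_time" using 2(1) by blast
    have "s1 vE 0 = 2 * length es + 2" using st1 by (simp add: core_state_def adj_state_def input_state_def)
    then have i: "i < 2 * length es + 2" using 2(3) inv by (simp add: chains_inv_def)
    show ?case
    proof (rule runs_mono[OF runs_chains_body[OF st1 sp1 inv i]], goal_cases)
      case (1 t s2)
      then obtain VS' where VS': "chains_inv SP ?b VS' (Suc i) s2"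
        "t + chains_left SP VS' (Suc i) * chain_time \<le> 4 + chains_left SP VS i * chain_time" by blast
      let ?r = "5 * (2 * length es + 2 - Suc i) + chains_left SP VS' (Suc i) * chain_time"
      have "t + 1 + ?r \<le> r" using VS'(2) i unfolding r by simp
      then show ?case using VS'(1) by blast
    qed
  next
    case (3 r t s1)
    have fr: "s1 k = s k" if "k \<notin> mods chains_body" "k \<noteq> vI" for k using 3(2) that by simp
    have m: "mods chains_body = {vCH, vCUR, vL, vVIS, vMID, vLO, vHI, vI} \<union> mods seg_prog"
      by (auto simp: chains_body_def chain_prog_def mods_walk_prog mods_mid_prog)
    have st1: "core_state s1" by (rule core_state_cong[OF st]) (auto simp: fr m mods_seg_prog)
    obtain VS i where inv: "chains_inv SP ?b VS i s1" using 3(1) by blast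
    have "s1 vE 0 = 2 * length es + 2" using st1 by (simp add: core_state_def adj_state_def input_state_def)
    then have i: "i = 2 * length es + 2" using 3(3) inv by (simp add: chains_inv_def)
    have I: "VS \<subseteq> H - SP" "\<And>v. v \<in> VS \<Longrightarrow> nb v \<inter> H \<subseteq> VS \<union> SP" "\<And>v. v \<in> VS \<Longrightarrow> covered (s1 vBEST 0) v"
      "\<And>a. a \<in> HE \<Longrightarrow> src a \<in> SP \<Longrightarrow> dst a \<in> H \<Longrightarrow> dst a \<in> VS \<union> SP" "improves ?b (s1 vBEST 0)"
      using inv unfolding chains_inv_def i by (auto simp: HE_def)
    have le: "?b \<le> s1 vBEST 0" "s1 vBEST 0 \<le> diam" using I(5) b by (auto simp: improves_def)
    have "\<forall>x\<in>H. covered (s1 vBEST 0) x"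
      using all_visited[OF sp I(1,2,4)] I(3) cov covered_mono le(1) by blast
    then have "s1 vBEST 0 = diam" using diam_eq_if_covered b(1) le by simp
    moreover have "chains_left SP {} 2 * chain_time \<le> min n (6 * k) * chain_time"
      using left by (rule mult_right_mono) simp
    ultimately show ?case using 3(4) by linarith
  qed
  then show ?thesis by (simp add: chains_prog_def runs_Seq)
qed

end

subsection \<open>The whole program\<close>

definition main_prog :: com where
  "main_prog = clear_prog ;; dst_prog ;; adj_prog ;; prune_prog ;; spec_prog ;; scan_specials ;; chains_prog"

context cgraph
begin

text \<open>After \<open>length es \<le> n + k\<close> is inserted, the coefficients add up to 89
  for \<open>n\<close> and to 2458 for \<open>k * n\<close>; the additive constant 19 goes into
  \<open>19 * n\<close>.\<close>

lemma time_arith: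
  assumes "length es + 1 \<le> n + k"
    "t \<le> 19 + 38 * n + 32 * length es + min n (6 * k) * (161 + 150 * n + 80 * length es)"
  shows "t \<le> 2500 * (k + 1) * n"
proof -
  define q where "q = min n (6 * k)"
  have q: "q \<le> n" "q \<le> 6 * k" by (auto simp: q_def)
  have n1: "1 \<le> n" by (rule n_pos)
  have m: "length es \<le> n + k" using assms(1) by simp
  have kn: "k \<le> k * n" using n1 by simp
  have "q * (161 + 150 * n + 80 * length es) \<le> q * (161 + 230 * n + 80 * k)"
    using m by (intro mult_left_mono) auto
  also have "\<dots> = q * (161 + 230 * n) + q * (80 * k)" by (simp add: algebra_simps)
  also have "q * (161 + 230 * n) \<le> (6 * k) * (391 * n)" using q n1 by (intro mult_mono) auto
  also have "q * (80 * k) \<le> n * (80 * k)" using q by (intro mult_right_mono) auto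
  finally have "q * (161 + 150 * n + 80 * length es) \<le> 2426 * (k * n)" by (simp add: algebra_simps)
  then have "t \<le> 19 + 38 * n + 32 * length es + 2426 * (k * n)" using assms(2) unfolding q_def by simp
  also have "\<dots> \<le> 19 * n + 38 * n + 32 * (n + k * n) + 2426 * (k * n)"
  proof -
    have "length es \<le> n + k * n" using m kn by (rule order_trans[OF _ add_left_mono])
    then show ?thesis using n1 by (intro add_mono mult_le_mono) auto
  qed
  also have "\<dots> \<le> 2500 * (k + 1) * n" by (simp add: algebra_simps)
  finally show ?thesis .
qed

lemma mods_scan_specials: "mods scan_specials = {vI, vSRC} \<union> mods scan_prog"
  by (auto simp: scan_specials_def)

theorem runs_main_prog:
  assumes k: "length es + 1 \<le> n + k" and X: "\<forall>a<2 * length es + 2. s vX a = src a"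
  shows "runs main_prog s (\<lambda>t s'. t \<le> 2500 * (k + 1) * n \<and> s' vBEST 0 = diam)"
  unfolding main_prog_def
proof (rule runs_SeqI[OF runs_clear_prog[of s, OF X]], goal_cases)
  case (1 t1 s1)
  note s1 = 1(1)
  have in1: "input_state s1" using s1 by simp
  show ?case
  proof (rule runs_SeqI[OF runs_dst_prog[OF in1]], goal_cases)
    case (1 t2 s2)
    note s2 = 1(1)
    have fr2: "s2 k = s1 k" if "k \<notin> {vI, vDST}" for k using 1(2) that by (simp add: dst_prog_def)
    have in2: "input_state s2" using in1 by (simp add: input_state_def fr2)
    have dst2: "\<forall>a\<in>HE. s2 vDST a = dst a" using s2 by simp
    have z2: "\<forall>v<n. s2 vHEAD v = 0 \<and> s2 vDEG v = 0 \<and> s2 vNBS v = 0" using s1 by (simp add: fr2)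
    show ?case
    proof (rule runs_SeqI[OF runs_adj_prog[of s2, OF in2 dst2 z2]], goal_cases)
      case (1 t3 s3)
      note s3 = 1(1)
      have fr3: "s3 k = s2 k" if "k \<notin> {vI, vU, vNEXT, vHEAD, vDEG, vNBS}" for k
        using 1(2) that by (simp add: adj_prog_def adj_body_def)
      have adj3: "adj_state s3" using s3 by simp
      have N3: "s3 vN 0 = n" using adj3 by (simp add: adj_state_def input_state_def)
      have W3: "\<forall>v<n. s3 vW v = 0" using s1 by (simp add: fr2 fr3)
      have D3: "\<forall>v<n. s3 vDEG v = card (nb v) \<and> s3 vNBS v = \<Sum> (nb v)" using s3 by simp
      show ?case
      proof (rule runs_SeqI[OF runs_prune_prog[of s3, OF N3 W3 D3]], goal_cases)
        case (1 t4 s4)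
        note s4 = 1(1)
        have fr4: "s4 k = s3 k" if "k \<notin> {vBEST, vI, vCUR, vP, vW, vDEG, vNBS}" for k
          using 1(2) that by (simp add: prune_prog_def prune_body_def prune_step_def)
        obtain H where H: "core H (s4 vW) (s4 vBEST 0)" "degrees H s4" using s4 by blast
        interpret pruned n es H "s4 vW" "s4 vBEST 0" k
          by unfold_locales (use H k in auto)
        have "adj_state s4" by (rule adj_state_cong[OF adj3]) (auto simp: fr4)
        then have st4: "core_state s4" using H by (simp add: core_state_def)
        have spec4: "\<forall>v<n. s4 vSPEC v = 0" using s1 by (simp add: fr2 fr3 fr4)
        show ?case
        proof (rule runs_SeqI[OF runs_spec_prog[OF st4 spec4]], goal_cases)
          case (1 t5 s5)
          note s5 = 1(1)
          have fr5: "s5 k = s4 k" if "k \<notin> {vFL, vI, vSPEC}" for k using 1(2) that by (simp add: spec_prog_def)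
          obtain SP where sp5: "specials SP s5" using s5 by blast
          have st5: "core_state s5" by (rule core_state_cong[OF st4]) (auto simp: fr5)
          show ?case
          proof (rule runs_SeqI[OF runs_scan_specials[OF st5 sp5]], goal_cases)
            case (1 t6 s6)
            note s6 = 1(1)
            have fr6: "s6 k = s5 k" if "k \<notin> mods scan_specials" for k using 1(2) that by blast
            note ms = mods_scan_specials mods_scan_prog
            have st6: "core_state s6" by (rule core_state_cong[OF st5]) (auto simp: fr6 ms)
            have "s6 vSPEC = s5 vSPEC" by (simp add: fr6 ms)
            then have sp6: "specials SP s6" using sp5 by (simp add: specials_def)
            have vis6: "\<forall>v<n. s6 vVIS v = 0" "\<forall>v<n. s6 vSEG v = 0"
              using s1 by (simp_all add: fr2 fr3 fr4 fr5 fr6 ms)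
            have b6: "s4 vBEST 0 \<le> s6 vBEST 0" "s6 vBEST 0 \<le> diam"
              using s6 b0_le by (auto simp: improves_def fr5)
            have cov6: "\<forall>x\<in>SP. covered (s6 vBEST 0) x" using s6 by simp
            show ?case
            proof (rule runs_mono[OF runs_chains_prog[OF st6 sp6 vis6 b6 cov6]], goal_cases)
              case (1 t7 s7)
              have "card SP * (scan_time + 1) \<le> min n (6 * k) * (scan_time + 1)"
                using specials_card[OF sp5] by (rule mult_right_mono) simp
              then have "t1 + (t2 + (t3 + (t4 + (t5 + (t6 + t7))))) \<le>
                  19 + 38 * n + 32 * length es + (min n (6 * k) * (scan_time + 1) + min n (6 * k) * chain_time)"
                using s1 s2 s3 s4 s5 s6 1(1) by linarith
              also have "min n (6 * k) * (scan_time + 1) + min n (6 * k) * chain_time =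
                  min n (6 * k) * (scan_time + 1 + chain_time)"
                by (rule distrib_left[symmetric])
              also have "scan_time + 1 + chain_time = 161 + 150 * n + 80 * length es"
                by (simp add: chain_time_def seg_time_def scan_time_def)
              finally show ?case using time_arith[OF k] 1(1) by blast
            qed
          qed
        qed
      qed
    qed
  qed
qed

end

section \<open>Relocating the input\<close>

text \<open>The input occupies the low cells, so no register is free at the start. As \<open>n \<ge> 1\<close>, the address
  \<open>A = 1024 * (n + m)\<close> lies beyond the input and can be computed in cell 1 alone; \<open>n\<close> and the cells
  2 to 7 are saved at \<open>A, ..., A + 6\<close>, and \<open>m\<close> is recovered from \<open>A - 1024 * n\<close> by a loop. The remaining
  cells are then copied into the array \<open>X\<close> from the top downwards, so that no cell is overwritten before
  it has been copied.\<close>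

definition save :: "nat \<Rightarrow> instr list" where
  "save j = [Add 1 1 0, Store 1 j]"

definition restore :: "nat \<Rightarrow> instr list" where
  "restore j = [Const 3 (j - 1), Add 3 1 3, Load 3 3, Const 4 (addr vX j), Store 4 3]"

text \<open>Ten doublings turn \<open>n + m\<close> into \<open>A\<close>. Once \<open>n\<close> is
  stored at \<open>A\<close>, cell 0 becomes the increment 1 for the saves. Afterwards
  \<open>2 * n\<close> and nine doublings give \<open>1024 * n\<close>, whose difference from
  \<open>A\<close> is \<open>1024 * m\<close>.\<close>

definition boot_regs :: "instr list" where
  "boot_regs =
    [Add 1 1 0] @ replicate 10 (Add 1 1 1) @ [Store 1 0, Const 0 1] @ concat (map save [2..<8]) @
    [Const 2 6, Sub 1 1 2, Load 2 1, Add 3 2 2] @ replicate 9 (Add 3 3 3) @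
    [Sub 3 1 3, Const 4 1024, Const 5 0, Const 6 1]"

text \<open>Division by 1024 through repeated subtraction, one round per edge.\<close>

definition boot_count :: rcom where
  "boot_count = RWhile [] 3 (Block [Sub 3 3 4, Add 5 5 6])"

definition boot_move :: rcom where
  "boot_move = RWhile [Const 4 8, Sub 4 3 4] 4
    (Block ([Sub 3 3 6, Load 4 3, Const 7 0, Add 7 7 3] @ adr vX 7 0 @ [Store 7 4]))"

definition boot_rest :: "instr list" where
  "boot_rest = concat (map restore [2, 3, 4, 5, 6, 7]) @
    [Const 4 (addr vX 0), Store 4 2, Const 4 (addr vX 1), Store 4 5]"

definition boot :: rcom where
  "boot = RSeq (Block boot_regs) (RSeq boot_count
    (RSeq (Block [Add 3 5 5, Add 3 3 6, Add 3 3 6]) (RSeq boot_move (Block boot_rest))))"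

section \<open>Correctness of the relocation\<close>

lemma exs_doubling: "exs (replicate r (Add x x x)) m = m(x := 2 ^ r * m x)"
  by (induction r arbitrary: m) (auto simp: algebra_simps mult_2)

lemma fitss_doubling: "2 ^ r * m x \<le> B \<Longrightarrow> fitss B (replicate r (Add x x x)) m"
proof (induction r arbitrary: m)
  case (Suc r)
  have "m x + m x \<le> 2 ^ Suc r * m x" by (induction r) auto
  then show ?case using Suc by (auto simp: algebra_simps mult_2 intro!: Suc.IH)
qed simp

lemma exs_saves:
  assumes "m 1 = A" "m 0 = 1" "1024 \<le> A" "j \<le> 6" "A + 6 \<le> B" "m' = exs (concat (map save [2..<2 + j])) m"
  shows "m' 1 = A + j \<and> (\<forall>i<j. m' (A + 1 + i) = m (2 + i)) \<and>
    (\<forall>a. a \<noteq> 1 \<and> \<not> (A < a \<and> a \<le> A + j) \<longrightarrow> m' a = m a) \<and> fitss B (concat (map save [2..<2 + j])) m"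
  using assms(4,6)
proof (induction j arbitrary: m')
  case 0 then show ?case using assms by simp
next
  case (Suc j)
  define m1 where "m1 = exs (concat (map save [2..<2 + j])) m"
  have IH: "m1 1 = A + j" "\<And>i. i < j \<Longrightarrow> m1 (A + 1 + i) = m (2 + i)"
    "\<And>a. a \<noteq> 1 \<Longrightarrow> \<not> (A < a \<and> a \<le> A + j) \<Longrightarrow> m1 a = m a" "fitss B (concat (map save [2..<2 + j])) m"
    using Suc.IH[OF _ m1_def] Suc.prems(1) by auto
  have c: "concat (map save [2..<2 + Suc j]) = concat (map save [2..<2 + j]) @ save (2 + j)" by simp
  have m0: "m1 0 = 1" "m1 (2 + j) = m (2 + j)" using IH(3)[of 0] IH(3)[of "2 + j"] assms(2,3) Suc.prems(1) by auto
  have m': "m' = m1(1 := A + Suc j, A + Suc j := m (2 + j))"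
    unfolding Suc.prems(2) c exs_append m1_def[symmetric] using IH(1) m0 by (simp add: save_def)
  have f: "fitss B (save (2 + j)) m1" using IH(1) m0 assms(5) Suc.prems(1) by (simp add: save_def)
  show ?case unfolding c fitss_append m1_def[symmetric]
  proof (intro conjI allI impI)
    show "m' 1 = A + Suc j" using m' assms(3) by simp
    fix i assume "i < Suc j"
    then show "m' (A + 1 + i) = m (2 + i)" using m' IH(2)[of i] assms(3) by (cases "i = j") auto
  next
    fix a assume "a \<noteq> 1 \<and> \<not> (A < a \<and> a \<le> A + Suc j)"
    then show "m' a = m a" using m' IH(3)[of a] by auto
  qed (use IH(4) f in auto)
qed

lemma exs_restores:
  assumes "\<forall>j\<in>set js. 2 \<le> j \<and> j \<le> 7" "m 1 = A" "1024 \<le> A" "A + 6 \<le> B" "m' = exs (concat (map restore js)) m"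
  shows "(\<forall>j\<in>set js. m' (addr vX j) = m (A + (j - 1))) \<and>
    (\<forall>a. a \<notin> {3, 4} \<union> addr vX ` set js \<longrightarrow> m' a = m a) \<and> fitss B (concat (map restore js)) m"
  using assms(1,2,5)
proof (induction js arbitrary: m)
  case Nil then show ?case by simp
next
  case (Cons j js)
  have j: "2 \<le> j" "j \<le> 7" using Cons.prems(1) by auto
  define m1 where "m1 = exs (restore j) m"
  \<comment> \<open>The restored cells lie above the registers and below \<open>A\<close>, so
    restoring one value destroys neither the base address nor the other saved values.\<close>
  have q: "64 \<le> addr vX j" "addr vX j < 1000" using j by (auto simp: addr_def)
  have m1: "m1 = m(3 := m (A + (j - 1)), 4 := addr vX j, addr vX j := m (A + (j - 1)))"
    unfolding m1_def using Cons.prems(2) assms(3) q by (simp add: restore_def)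
  have f: "fitss B (restore j) m" using Cons.prems(2) assms(3,4) q j by (simp add: restore_def; arith)
  have m11: "m1 1 = A" using m1 Cons.prems(2) q by simp
  have keep: "m1 (A + (i - 1)) = m (A + (i - 1))" for i using m1 assms(3) q by simp
  have IH: "\<forall>i\<in>set js. m' (addr vX i) = m1 (A + (i - 1))"
    "\<forall>a. a \<notin> {3, 4} \<union> addr vX ` set js \<longrightarrow> m' a = m1 a" "fitss B (concat (map restore js)) m1"
    using Cons.IH[of m1] Cons.prems m11 by (auto simp: exs_append m1_def)
  have "m' (addr vX j) = m (A + (j - 1))"
  proof (cases "j \<in> set js")
    case True then show ?thesis using IH(1) keep by auto
  next
    case False
    then have "addr vX j \<notin> {3, 4} \<union> addr vX ` set js" using q by (auto simp: addr_eq_iff)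
    then show ?thesis using IH(2) m1 by simp
  qed
  moreover have "m' a = m a" if "a \<notin> {3, 4} \<union> addr vX ` set (j # js)" for a
    using IH(2) m1 that by auto
  ultimately show ?case using IH(1,3) keep f by (auto simp: fitss_append m1_def[symmetric])
qed

lemma rbig_boot_count:
  assumes "m 3 = 1024 * r" "m 4 = 1024" "m 6 = 1" "m 5 + r \<le> B"
  shows "\<exists>t m'. rbig B boot_count m t m' \<and> t \<le> 5 * r + 1 \<and> m' 5 = m 5 + r \<and>
    (\<forall>a. a \<notin> {0, 3, 5} \<longrightarrow> m' a = m a)"
  using assms
proof (induction r arbitrary: m)
  case 0
  then have "rbig B boot_count m (length ([] :: instr list) + 1) (exs [] m)"
    unfolding boot_count_def by (intro rbig.RWhileF) auto
  then show ?case by auto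
next
  case (Suc r)
  let ?is = "[Sub 3 3 4, Add 5 5 6]" and ?m = "(exs [Sub 3 3 4, Add 5 5 6] m)(0 := 0)"
  have "fitss B ?is m" using Suc.prems by simp
  then have "rbig B (Block ?is) m (length ?is) (exs ?is m)" by (rule rbig.Block)
  then have b: "rbig B (Block ?is) (exs [] m) (length ?is) (exs ?is m)" by simp
  have m1: "?m 3 = 1024 * r" "?m 4 = 1024" "?m 6 = 1" "?m 5 = Suc (m 5)" using Suc.prems by auto
  then have p: "?m 5 + r \<le> B" using Suc.prems(4) by simp
  obtain t m' where t: "rbig B boot_count ?m t m'" "t \<le> 5 * r + 1" "m' 5 = ?m 5 + r"
    "\<forall>a. a \<notin> {0, 3, 5} \<longrightarrow> m' a = ?m a" using Suc.IH[OF m1(1-3) p] by blast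
  have "rbig B boot_count m (length ([] :: instr list) + length ?is + t + 3) m'"
    unfolding boot_count_def
    using Suc.prems(1) by (intro rbig.RWhileT[OF _ _ b t(1)[unfolded boot_count_def]]) auto
  moreover have "\<forall>a. a \<notin> {0, 3, 5} \<longrightarrow> m' a = m a" using t(4) by auto
  moreover have "length ([] :: instr list) + length ?is + t + 3 \<le> 5 * Suc r + 1" using t(2) by simp
  moreover have "m' 5 = m 5 + Suc r" using t(3) m1(4) by simp
  ultimately show ?case by blast
qed

text \<open>Since \<open>addr vX x > x\<close>, writing the copy of cell \<open>x\<close> spares all
  cells below \<open>x\<close>, which are still to be copied. Cells below 8 hold registers; their
  input values are restored separately.\<close>

lemma rbig_boot_move:
  assumes "m 3 = x" "m 6 = 1" "addr vX x \<le> B"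
  shows "\<exists>t m'. rbig B boot_move m t m' \<and> t \<le> 20 * x + 3 \<and>
    (\<forall>a. 8 \<le> a \<and> a < x \<longrightarrow> m' (addr vX a) = m a) \<and>
    (\<forall>a. a \<notin> {0, 3, 4, 7} \<and> (\<forall>b. 8 \<le> b \<and> b < x \<longrightarrow> a \<noteq> addr vX b) \<longrightarrow> m' a = m a)"
  using assms
proof (induction x arbitrary: m)
  case 0
  let ?h = "[Const 4 8, Sub 4 3 4]"
  have "rbig B boot_move m (length ?h + 1) (exs ?h m)"
    using 0 unfolding boot_move_def by (intro rbig.RWhileF) (auto simp: addr_def)
  moreover have "length ?h + 1 \<le> 20 * 0 + 3" "\<And>a. a \<notin> {0, 3, 4, 7} \<Longrightarrow> exs ?h m a = m a" by auto
  ultimately show ?case by blast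
next
  case (Suc x)
  let ?h = "[Const 4 8, Sub 4 3 4]"
  have f: "fitss B ?h m" using Suc.prems by (simp add: addr_def)
  have xB: "addr vX x \<le> B" using Suc.prems(3) by (simp add: addr_def)
  show ?case
  proof (cases "Suc x \<le> 8")
    case True
    then have "rbig B boot_move m (length ?h + 1) (exs ?h m)"
      unfolding boot_move_def using Suc.prems f by (intro rbig.RWhileF) auto
    moreover have "length ?h + 1 \<le> 20 * Suc x + 3" "\<And>a. a \<notin> {0, 3, 4, 7} \<Longrightarrow> exs ?h m a = m a"
      "\<And>a. \<not> (8 \<le> a \<and> a < Suc x)" using True by auto
    ultimately show ?thesis by blast
  next
    case False
    then have x8: "8 \<le> x" by simp
    let ?is = "[Sub 3 3 6, Load 4 3, Const 7 0, Add 7 7 3] @ adr vX 7 0 @ [Store 7 4]"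
    let ?m0 = "exs ?h m"
    let ?m1 = "(exs ?is ?m0)(0 := 0)"
    have gt: "addr vX x > x" "addr vX x \<ge> 64" by (auto simp: addr_def)
    have e: "exs ?is ?m0 = m(3 := x, 4 := m x, 7 := addr vX x, 0 := 66, addr vX x := m x)"
      using Suc.prems(1,2) x8 gt by (simp add: exs_append exs_adr fun_upd_twist)
    have fi: "fitss B ?is ?m0"
      using Suc.prems(1,2) x8 xB by (simp add: fitss_append exs_append fitss_adr addr_def)
    have b: "rbig B (Block ?is) ?m0 (length ?is) (exs ?is ?m0)" using rbig.Block[OF fi] .
    have m1: "?m1 3 = x" "?m1 6 = 1" "?m1 (addr vX x) = m x" unfolding e using Suc.prems(2) gt by auto
    have m1': "?m1 a = m a" if "a \<notin> {0, 3, 4, 7}" "a \<noteq> addr vX x" for a unfolding e using that by simp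
    obtain t m' where t: "rbig B boot_move ?m1 t m'" "t \<le> 20 * x + 3"
      "\<forall>a. 8 \<le> a \<and> a < x \<longrightarrow> m' (addr vX a) = ?m1 a"
      "\<forall>a. a \<notin> {0, 3, 4, 7} \<and> (\<forall>b. 8 \<le> b \<and> b < x \<longrightarrow> a \<noteq> addr vX b) \<longrightarrow> m' a = ?m1 a"
      using Suc.IH[OF m1(1,2) xB] by blast
    have r: "rbig B boot_move m (length ?h + length ?is + t + 3) m'"
      unfolding boot_move_def
      using Suc.prems(1) x8 by (intro rbig.RWhileT[OF f _ b t(1)[unfolded boot_move_def]]) simp
    have time: "length ?h + length ?is + t + 3 \<le> 20 * Suc x + 3" using t(2) by (simp add: adr_def)
    have copied: "m' (addr vX a) = m a" if a: "8 \<le> a" "a < Suc x" for a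
    proof (cases "a = x")
      case True
      have "addr vX x \<notin> {0, 3, 4, 7}" using gt by auto
      moreover have "addr vX x \<noteq> addr vX b" if "b < x" for b using that by (simp add: addr_eq_iff)
      ultimately show ?thesis using t(4) m1(3) True by auto
    next
      case False
      then have "m' (addr vX a) = ?m1 a" using t(3) a by simp
      moreover have "a \<noteq> addr vX x" using a gt by simp
      ultimately show ?thesis using m1'[of a] a by auto
    qed
    have keep: "m' a = m a" if a: "a \<notin> {0, 3, 4, 7}" "\<forall>b. 8 \<le> b \<and> b < Suc x \<longrightarrow> a \<noteq> addr vX b" for a
      using t(4) m1'[OF a(1)] a x8 by auto
    show ?thesis using r time copied keep by blast
  qed
qed

lemma rbig_boot:
  assumes n: "1 \<le> n" and B: "2048 * (n + length es + 1) \<le> B"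
  shows "\<exists>t m'. rbig B boot (input_mem n es) t m' \<and> t \<le> 200 * (length es + 1) \<and>
    (\<forall>a<2 * length es + 2. m' (addr vX a) = input_mem n es a)"
proof -
  define l where "l = length es"
  define A where "A = 1024 * (n + l)"
  define m0 where "m0 = input_mem n es"
  have A: "1024 \<le> A" "1024 * l + 1024 \<le> A" using n by (auto simp: A_def)
  have AB: "A + 2048 \<le> B" "2 * A \<le> B" using B by (auto simp: A_def l_def)
  have m0: "m0 0 = n" "m0 1 = l" by (auto simp: m0_def input_mem_def l_def)
  define m1 where "m1 = m0(1 := A, A := n, 0 := 1)"
  let ?a = "[Add 1 1 0] @ replicate 10 (Add 1 1 1) @ [Store 1 0, Const 0 1]"
  have e1: "exs ?a m0 = m1" unfolding exs_append exs_doubling using m0 A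
    by (simp add: m1_def A_def fun_upd_twist add.commute)
  have f1: "fitss B ?a m0" unfolding fitss_append exs_append exs_doubling using m0 AB
    by (auto simp: A_def add.commute intro!: fitss_doubling)
  let ?b = "concat (map save [2..<8])"
  define m2 where "m2 = exs ?b m1"
  have "m1 1 = A" "m1 0 = 1" using A by (auto simp: m1_def)
  moreover have "m2 = exs (concat (map save [2..<2 + 6])) m1" "[2..<8] = [2..<2 + 6 :: nat]"
    by (simp_all add: m2_def)
  ultimately have m2: "m2 1 = A + 6" "\<And>i. i < 6 \<Longrightarrow> m2 (A + 1 + i) = m1 (2 + i)"
    "\<And>a. a \<noteq> 1 \<Longrightarrow> \<not> (A < a \<and> a \<le> A + 6) \<Longrightarrow> m2 a = m1 a" and f2: "fitss B ?b m1"
    using exs_saves[of m1 A 6 B m2] A(1) AB by auto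
  have m2A: "m2 A = n" using m2(3)[of A] A by (simp add: m1_def)
  define m3 where "m3 = m2(2 := n, 1 := A, 3 := 1024 * l, 4 := 1024, 5 := 0, 6 := 1)"
  let ?c = "[Const 2 6, Sub 1 1 2, Load 2 1, Add 3 2 2] @ replicate 9 (Add 3 3 3) @
    [Sub 3 1 3, Const 4 1024, Const 5 0, Const 6 1]"
  have e3: "exs ?c m2 = m3" unfolding exs_append exs_doubling using m2(1) m2A A
    by (simp add: m3_def fun_upd_twist) (simp add: A_def)
  have f3: "fitss B ?c m2" unfolding fitss_append exs_append exs_doubling using m2(1) m2A A AB
    by (auto simp: A_def intro!: fitss_doubling)
  have regs: "boot_regs = ?a @ ?b @ ?c" unfolding boot_regs_def append_assoc by (rule refl)
  have "fitss B boot_regs m0"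
    unfolding regs fitss_append[of B ?a] fitss_append[of B ?b] e1 m2_def[symmetric] using f1 f2 f3 by blast
  moreover have "exs boot_regs m0 = m3"
    unfolding regs exs_append[of ?a] exs_append[of ?b] e1 m2_def[symmetric] by (rule e3)
  ultimately have r1: "rbig B (Block boot_regs) m0 (length boot_regs) m3" using rbig.Block by metis
  have m3v: "m3 3 = 1024 * l" "m3 4 = 1024" "m3 6 = 1" "m3 5 = 0" "m3 1 = A" "m3 2 = n" by (auto simp: m3_def)
  have m3a: "m3 a = m0 a" if "8 \<le> a" "a < A" for a
    using that m2(3)[of a] by (simp add: m3_def m1_def)
  have m3s: "m3 (A + (j - 1)) = m0 j" if "2 \<le> j" "j \<le> 7" for j
  proof -
    have "A + (j - 1) = A + 1 + (j - 2)" using that by simp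
    moreover have "m3 x = m2 x" if "6 < x" for x using that by (simp add: m3_def)
    moreover have "6 < A + 1 + (j - 2)" using A(1) by simp
    ultimately have "m3 (A + (j - 1)) = m2 (A + 1 + (j - 2))" by simp
    also have "\<dots> = m1 (2 + (j - 2))" using that by (intro m2(2)) simp
    also have "2 + (j - 2) = j" using that by simp
    also have "m1 j = m0 j" using that A(1) by (auto simp: m1_def)
    finally show ?thesis .
  qed
  obtain t4 m4 where r4: "rbig B boot_count m3 t4 m4" "t4 \<le> 5 * l + 1" "m4 5 = l"
    "\<forall>a. a \<notin> {0, 3, 5} \<longrightarrow> m4 a = m3 a"
    using rbig_boot_count[OF m3v(1-3), of B] m3v(4) AB A by auto
  define m5 where "m5 = m4(3 := 2 * l + 2)"
  let ?d = "[Add 3 5 5, Add 3 3 6, Add 3 3 6]"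
  have m46: "m4 6 = 1" using r4(4) m3v(3) by simp
  have "exs ?d m4 = m5" using r4(3) m46 by (simp add: m5_def mult_2)
  moreover have "fitss B ?d m4" using r4(3) m46 AB A by simp
  ultimately have r5: "rbig B (Block ?d) m4 (length ?d) m5" using rbig.Block by metis
  have aB: "addr vX (2 * l + 2) \<le> B" using AB A by (simp add: addr_def)
  have m5v: "m5 3 = 2 * l + 2" "m5 6 = 1" "m5 5 = l" using r4(3) m46 by (auto simp: m5_def)
  have m5a: "m5 a = m3 a" if "a \<notin> {0, 3, 5}" for a using r4(4) that by (simp add: m5_def)
  obtain t6 m6 where r6: "rbig B boot_move m5 t6 m6" "t6 \<le> 20 * (2 * l + 2) + 3"
    "\<And>a. 8 \<le> a \<Longrightarrow> a < 2 * l + 2 \<Longrightarrow> m6 (addr vX a) = m5 a"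
    "\<And>a. a \<notin> {0, 3, 4, 7} \<Longrightarrow> (\<And>b. 8 \<le> b \<Longrightarrow> b < 2 * l + 2 \<Longrightarrow> a \<noteq> addr vX b) \<Longrightarrow> m6 a = m5 a"
    using rbig_boot_move[OF m5v(1,2) aB] by blast
  have big: "64 \<le> addr vX b" for b by (rule addr_ge)
  \<comment> \<open>The whole copy stays below \<open>A\<close>, so the saved values survive it; the
    factor 1024 in \<open>A\<close> leaves room for this.\<close>
  have ltA: "addr vX b < A" if "b < 2 * l + 2" for b using that A by (simp add: addr_def)
  have low: "m6 a = m5 a" if "a \<in> {1, 2, 5}" for a
  proof (rule r6(4))
    show "a \<notin> {0, 3, 4, 7}" using that by auto
    show "a \<noteq> addr vX b" for b using big[of b] that by auto
  qed
  have m6v: "m6 1 = A" "m6 2 = n" "m6 5 = l"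
    using low[of 1] low[of 2] low[of 5] m5a[of 1] m5a[of 2] m5v(3) m3v(5,6) by simp_all
  have m6s: "m6 (A + (j - 1)) = m0 j" if "2 \<le> j" "j \<le> 7" for j
  proof -
    have "m6 (A + (j - 1)) = m5 (A + (j - 1))"
    proof (rule r6(4))
      show "A + (j - 1) \<notin> {0, 3, 4, 7}" using A(1) by auto
      show "A + (j - 1) \<noteq> addr vX b" if "b < 2 * l + 2" for b using ltA[OF that] by simp
    qed
    then show ?thesis using m5a[of "A + (j - 1)"] A m3s[OF that] by simp
  qed
  define m7 where "m7 = exs (concat (map restore [2, 3, 4, 5, 6, 7])) m6"
  have m7: "\<And>j. 2 \<le> j \<Longrightarrow> j \<le> 7 \<Longrightarrow> m7 (addr vX j) = m0 j"
    "\<And>a. a \<notin> {3, 4} \<union> addr vX ` {2, 3, 4, 5, 6, 7} \<Longrightarrow> m7 a = m6 a"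
    and f7: "fitss B (concat (map restore [2, 3, 4, 5, 6, 7])) m6"
  proof -
    have *: "(\<forall>j\<in>set [2, 3, 4, 5, 6, 7]. m7 (addr vX j) = m6 (A + (j - 1))) \<and>
      (\<forall>a. a \<notin> {3, 4} \<union> addr vX ` set [2, 3, 4, 5, 6, 7] \<longrightarrow> m7 a = m6 a) \<and>
      fitss B (concat (map restore [2, 3, 4, 5, 6, 7])) m6"
      using AB by (intro exs_restores[OF _ m6v(1) A(1) _ m7_def]) auto
    show "m7 (addr vX j) = m0 j" if "2 \<le> j" "j \<le> 7" for j
    proof -
      have "j \<in> set [2, 3, 4, 5, 6, 7]" using that by auto
      then show ?thesis using * m6s[OF that] by metis
    qed
    show "m7 a = m6 a" if "a \<notin> {3, 4} \<union> addr vX ` {2, 3, 4, 5, 6, 7}" for a using * that by simp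
    show "fitss B (concat (map restore [2, 3, 4, 5, 6, 7])) m6" using * by blast
  qed
  have m7v: "m7 2 = n" "m7 5 = l"
    using m7(2)[of 2] m7(2)[of 5] m6v by (auto simp: addr_def)
  let ?e = "[Const 4 (addr vX 0), Store 4 2, Const 4 (addr vX 1), Store 4 5]"
  define m8 where "m8 = m7(4 := addr vX 1, addr vX 0 := n, addr vX 1 := l)"
  have e8: "exs ?e m7 = m8" using m7v by (simp add: m8_def addr_def fun_upd_twist)
  have f8: "fitss B ?e m7" using AB A by (simp add: addr_def)
  have "fitss B boot_rest m6" "exs boot_rest m6 = m8"
    unfolding boot_rest_def fitss_append exs_append m7_def[symmetric] using f7 f8 e8 by blast+
  then have r8: "rbig B (Block boot_rest) m6 (length boot_rest) m8" using rbig.Block by metis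
  have len: "length boot_regs = 42" "length boot_rest = 34"
    by (auto simp: boot_regs_def boot_rest_def save_def restore_def upt_conv_Cons)
  have "rbig B boot m0 (length boot_regs + (t4 + (length ?d + (t6 + length boot_rest)))) m8"
    unfolding boot_def by (intro rbig.RSeq[OF r1] rbig.RSeq[OF r4(1)] rbig.RSeq[OF r5] rbig.RSeq[OF r6(1) r8])
  moreover have "length boot_regs + (t4 + (length ?d + (t6 + length boot_rest))) \<le> 200 * (l + 1)"
    using r4(2) r6(2) len by simp
  moreover have "m8 (addr vX a) = m0 a" if a: "a < 2 * l + 2" for a
  proof -
    consider "a = 0" | "a = 1" | "2 \<le> a" "a \<le> 7" | "8 \<le> a" by linarith
    then show ?thesis
    proof cases
      case 1 then show ?thesis using m0 by (simp add: m8_def addr_def)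
    next
      case 2 then show ?thesis using m0 by (simp add: m8_def addr_def)
    next
      case 3
      then show ?thesis using m7(1)[of a] by (simp add: m8_def addr_def)
    next
      case 4
      have "m8 (addr vX a) = m7 (addr vX a)" using 4 by (simp add: m8_def addr_def)
      also have "\<dots> = m6 (addr vX a)" using 4 by (intro m7(2)) (auto simp: addr_def)
      also have "\<dots> = m5 a" using r6(3) 4 a by simp
      also have "\<dots> = m3 a" using 4 by (intro m5a) auto
      also have "\<dots> = m0 a" using 4 a A by (intro m3a) auto
      finally show ?thesis .
    qed
  qed
  ultimately show ?thesis unfolding m0_def l_def by blast
qed

section \<open>The main theorem\<close>

lemma fits_mono: "fits B i m \<Longrightarrow> B \<le> B' \<Longrightarrow> fits B' i m"
  by (cases i) auto

lemma fitss_mono: "fitss B is m \<Longrightarrow> B \<le> B' \<Longrightarrow> fitss B' is m"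
  by (induction "is" arbitrary: m) (auto intro: fits_mono)

lemma rbig_mono: "rbig B c m t m' \<Longrightarrow> B \<le> B' \<Longrightarrow> rbig B' c m t m'"
  by (induction rule: rbig.induct) (blast intro: rbig.intros fitss_mono)+

text \<open>Level 0 is the input. Variables of level 1 are copied or grow by constants and input
  values, those of level 2 by sums of level 1, and \<open>BEST\<close> adds entries of level
  2.\<close>

definition lev :: "nat \<Rightarrow> nat" where
  "lev v = (if v = vX then 0 else if v = vBEST then 3
     else if v \<in> {vNBS, vCUR, vP, vCH, vSRC, vQ, vVAL, vPRE, vSUF, vFOLD, vT, vU, vY} then 2 else 1)"

lemma lev_le: "lev v \<le> 3"
  by (simp add: lev_def)

lemma wfc_for_loop:
  "wfc lv K (for_loop i b c) \<longleftrightarrow> i < 64 \<and> b < 64 \<and> 1 \<le> K \<and> 1 \<le> lv i \<and> wfc lv K c"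
  by (auto simp: for_loop_def)

lemma wfc_main_prog: "wfc lev 2048 main_prog"
  unfolding main_prog_def clear_prog_def dst_prog_def adj_prog_def adj_body_def prune_prog_def prune_body_def
    prune_step_def spec_prog_def scan_specials_def scan_prog_def bfs_prog_def bfs_start_def bfs_body_def
    chains_prog_def chains_body_def chain_prog_def walk_prog_def walk_init_def walk_body_def mid_prog_def
    seg_prog_def ends_prog_def fold_init_def fold_body_def suffix_init_def suffix_body_def outside_body_def
  by (simp add: wfc_for_loop lev_def)

definition diameter_code :: rcom where
  "diameter_code = RSeq boot (RSeq (cc main_prog) (Block [Const 1 (addr vBEST 0), Load 0 1]))"

text \<open>Constants are absorbed as powers of \<open>x = n + m + 2 \<ge> 2\<close>. From
  \<open>T \<le> 2 ^ 13 * x ^ 2 \<le> x ^ 15\<close> follows \<open>2048 * T \<le> x ^ 26\<close>;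
  the top level 3 raises this to the fourth power 104, and the address factor adds 13.\<close>

lemma bound_arith:
  fixes n m k t :: nat
  assumes "1 \<le> n" "k \<le> m" "t \<le> 2500 * (k + 1) * n" "2048 * (n + m + 1) + t = T"
  shows "bigbound 2048 T 3 \<le> (n + m + 2) ^ 117"
proof -
  define x where "x = n + m + 2"
  have x2: "2 \<le> x" by (simp add: x_def)
  have "(k + 1) * n \<le> x * x" using assms(1,2) by (intro mult_mono) (auto simp: x_def)
  moreover have "t \<le> 2500 * ((k + 1) * n)" using assms(3) by (simp only: mult.assoc)
  ultimately have "t \<le> 2500 * (x * x)" by (meson le_trans mult_le_mono2)
  moreover have "n + m + 1 \<le> x" by (simp add: x_def)
  then have "n + m + 1 \<le> x * x" by (rule le_trans[OF _ le_square])
  ultimately have "T \<le> 2048 * (x * x) + 2500 * (x * x)"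
    unfolding assms(4)[symmetric] by (intro add_mono mult_le_mono2)
  also have "\<dots> \<le> 2 ^ 13 * x ^ 2" by (simp add: power2_eq_square)
  also have "\<dots> \<le> x ^ 13 * x ^ 2" using x2 by (intro mult_right_mono power_mono) auto
  finally have T: "T \<le> x ^ 15" by (simp add: power_add[symmetric])
  have "(2048 :: nat) = 2 ^ 11" by simp
  also have "\<dots> \<le> x ^ 11" using x2 by (intro power_mono) auto
  finally have "2048 * T \<le> x ^ 11 * x ^ 15" using T by (intro mult_mono) auto
  then have "2048 * T \<le> x ^ 26" by (simp add: power_add[symmetric])
  then have "(2048 * T) ^ 4 \<le> (x ^ 26) ^ 4" by (intro power_mono) auto
  then have l: "lbound 2048 T 3 \<le> x ^ 104" by (simp add: lbound_def power_mult[symmetric])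
  have "1 \<le> x ^ 104" using x2 by simp
  then have "bigbound 2048 T 3 \<le> 2 ^ 13 * x ^ 104" using l by (simp add: bigbound_def)
  also have "\<dots> \<le> x ^ 13 * x ^ 104" using x2 by (intro mult_right_mono power_mono) auto
  finally show ?thesis by (simp add: power_add[symmetric] x_def)
qed

theorem theorem3:
  shows "\<exists>(prog :: instr list) (c :: nat).
    \<forall>n es. simple_graph n es \<and> connected_graph n es \<and> 1 \<le> n \<longrightarrow>
      (\<exists>t. t \<le> c * (feedback_edge_number es + 1) * n
         \<and> halted prog (run prog t (init_config n es))
         \<and> snd (run prog t (init_config n es)) 0 = diameter n es
         \<and> (\<forall>s \<le> t. \<forall>a. snd (run prog s (init_config n es)) a \<le> (n + length es + 2) ^ c))"
proof -
  define C where "C = clen (cc main_prog) + 3"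
  \<comment> \<open>One number serves as time factor and as exponent:
    \<open>319 = 202 + 117\<close>, where 202 pays for the relocation and the two final instructions
    and 117 is the exponent of \<open>bound_arith\<close>.\<close>
  define c where "c = 2500 * C + 319"
  define prog where "prog = code 0 diameter_code"
  have "\<exists>t. t \<le> c * (feedback_edge_number es + 1) * n
         \<and> halted prog (run prog t (init_config n es))
         \<and> snd (run prog t (init_config n es)) 0 = diameter n es
         \<and> (\<forall>s \<le> t. \<forall>a. snd (run prog s (init_config n es)) a \<le> (n + length es + 2) ^ c)"
    if g: "simple_graph n es" "connected_graph n es" "1 \<le> n" for n es
  proof -
    interpret cgraph n es by unfold_locales (use g in auto)
    define k where "k = feedback_edge_number es"
    have k: "length es + 1 \<le> n + k" "k \<le> length es"
      using edges_le_feedback_edge_number[OF g(1,3)] by (auto simp: k_def)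
    define N0 where "N0 = 2048 * (n + length es + 1)"
    have in_le: "input_mem n es a \<le> N0" for a
    proof (cases "a \<in> HE")
      case True
      then show ?thesis using src_lt[of a] by (simp add: src_def N0_def)
    next
      case False
      then show ?thesis by (auto simp: input_mem_def HE_def N0_def)
    qed
    obtain t1 m1 where b: "rbig N0 boot (input_mem n es) t1 m1" "t1 \<le> 200 * (length es + 1)"
      "\<forall>a<2 * length es + 2. m1 (addr vX a) = input_mem n es a"
      using rbig_boot[OF g(3), of es N0] by (auto simp: N0_def)
    have m1_le: "m1 a \<le> N0" for a using rbig_bounded[OF b(1) in_le] .
    define s1 where "s1 = (\<lambda>v i. m1 (addr v i))"
    have rep1: "rep m1 s1" by (simp add: rep_def s1_def)
    have X: "\<forall>a<2 * length es + 2. s1 vX a = src a" using b(3) by (simp add: s1_def src_def)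
    obtain t2 s2 where main: "big main_prog s1 t2 s2" "t2 \<le> 2500 * (k + 1) * n" "s2 vBEST 0 = diameter n es"
      using runs_main_prog[OF k(1), of s1, OF X] by (auto simp: runs_def)
    \<comment> \<open>The clock of the level bounds starts at \<open>N0\<close> instead of 0, so
      that the relocated memory, whose cells are at most \<open>N0\<close>, satisfies the bounds of
      all levels from the outset.\<close>
    define B where "B = bigbound 2048 (N0 + t2) 3"
    have N01: "1 \<le> N0" by (simp add: N0_def)
    have bnd: "bounded lev 2048 N0 s1"
      unfolding bounded_def lbound_def
    proof (intro allI impI)
      fix v i
      have "s1 v i \<le> N0" using m1_le by (simp add: s1_def)
      also have "\<dots> \<le> (2048 * N0) ^ 1" by simp
      also have "\<dots> \<le> (2048 * N0) ^ (lev v + 1)" using N01 by (intro power_increasing) auto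
      finally show "s1 v i \<le> (2048 * N0) ^ (lev v + 1)" .
    qed
    have "\<exists>t' m'. rbig B (cc main_prog) m1 t' m' \<and> rep m' s2 \<and> t' \<le> C * t2"
      using cc_correct[OF main(1) lev_le _ N01 wfc_main_prog bnd rep1 le_refl, of B C]
      by (simp add: B_def C_def)
    then obtain t3 m3 where m3: "rbig B (cc main_prog) m1 t3 m3" "rep m3 s2" "t3 \<le> C * t2" by blast
    have N0B: "N0 \<le> B"
    proof -
      have "N0 + t2 \<le> (2048 * (N0 + t2)) ^ 1" by simp
      also have "\<dots> \<le> (2048 * (N0 + t2)) ^ (3 + 1)" using N01 by (intro power_increasing) auto
      finally show ?thesis by (simp add: B_def bigbound_def lbound_def)
    qed
    have m3_le: "m3 a \<le> B" for a using rbig_bounded[OF m3(1)] m1_le N0B le_trans by blast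
    let ?fin = "[Const 1 (addr vBEST 0), Load 0 1]"
    have "fitss B ?fin m3" by (simp add: B_def bigbound_def addr_def)
    then have fin: "rbig B (Block ?fin) m3 (length ?fin) (exs ?fin m3)" by (rule rbig.Block)
    have "m3 (addr vBEST 0) = s2 vBEST 0" using m3(2)[unfolded rep_def, rule_format, of vBEST 0] by simp
    then have res: "exs ?fin m3 0 = diameter n es" using main(3) by (simp add: addr_def)
    have "rbig B diameter_code (input_mem n es) (t1 + (t3 + length ?fin)) (exs ?fin m3)"
      unfolding diameter_code_def
      by (intro rbig.RSeq[OF rbig_mono[OF b(1) N0B]] rbig.RSeq[OF m3(1) fin])
    then have "reaches prog B (length ([] :: instr list), input_mem n es) (t1 + (t3 + length ?fin))
        (length ([] :: instr list) + clen diameter_code, exs ?fin m3)"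
      by (rule code_correct[OF _ le_trans[OF in_le N0B]]) (simp add: prog_def)
    then have r: "run prog (t1 + (t3 + 2)) (init_config n es) = (clen diameter_code, exs ?fin m3)"
      "\<forall>s\<le>t1 + (t3 + 2). \<forall>a. snd (run prog s (init_config n es)) a \<le> B"
      by (auto simp: reaches_def init_config_def)
    have "t1 + (t3 + 2) \<le> c * (k + 1) * n"
    proof -
      \<comment> \<open>The relocation is linear in the number of edges, and
        \<open>n + k \<le> (k + 1) * n\<close> as \<open>n\<close> is positive.\<close>
      have "length es + 1 \<le> (k + 1) * n"
        using k(1) g(3) by (auto simp: algebra_simps intro: le_trans)
      then have "t1 \<le> 200 * ((k + 1) * n)" by (rule le_trans[OF b(2) mult_le_mono2])
      moreover have "t3 \<le> C * (2500 * ((k + 1) * n))"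
        using main(2) unfolding mult.assoc by (rule le_trans[OF m3(3) mult_le_mono2])
      moreover have "1 \<le> (k + 1) * n" using g(3) by simp
      ultimately have "t1 + (t3 + 2) \<le> (202 + 2500 * C) * ((k + 1) * n)" by (simp add: algebra_simps)
      also have "\<dots> \<le> c * ((k + 1) * n)" by (intro mult_right_mono) (auto simp: c_def)
      finally show ?thesis by (simp only: mult.assoc)
    qed
    moreover have "B \<le> (n + length es + 2) ^ c"
    proof -
      have "B \<le> (n + length es + 2) ^ 117"
        unfolding B_def using bound_arith[OF g(3) k(2) main(2) refl] by (simp add: N0_def)
      also have "\<dots> \<le> (n + length es + 2) ^ c" by (intro power_increasing) (auto simp: c_def)
      finally show ?thesis .
    qed
    moreover have "halted prog (run prog (t1 + (t3 + 2)) (init_config n es))"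
      unfolding r(1) by (simp add: halted_def prog_def)
    ultimately show ?thesis using r res unfolding k_def
      by (intro exI[of _ "t1 + (t3 + 2)"]) (auto intro: le_trans)
  qed
  then show ?thesis by blast
qed

end
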